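(* Let $E=B_p$ for some $1<p<\infty$ or $E=S_p$ for some $1\le p<\infty$. The following conditions are equivalent for all infinite subsets $M,N$ of $\mathbb{N}$: (a) The Gasparis--Leung indices $\Gamma\mathrm{L}_1(M,N)$ and $\Gamma\mathrm{L}_1(N,M)$ are both finite. (b) The basic sequences $(e_m)_{m\in M}$ and $(e_n)_{n\in N}$ are equivalent. (c) The subspaces $E_M$ and $E_N$ are isomorphic.
   Context: Scalars are $\mathbb{K}\in\{\mathbb{R},\mathbb{C}\}$ and $\mathbb{N}=\{1,2,3,\ldots\}$. The Schreier sets are $\mathcal{S}_1=\{F\subset\mathbb{N}\text{ finite} : |F|\le\min F\}$, with the convention $\min\emptyset=0$, so $\emptyset\in\mathcal{S}_1$. Let $c_{00}$ be the space of finitely supported elements of $\mathbb{K}^{\mathbb{N}}$. For $1\le p<\infty$, the $p$-th Schreier space $S_p$ is the completion of $c_{00}$ in the norm $\|x\|_{S_p}=\sup\{(\sum_{n\in F}|x(n)|^p)^{1/p} : F\in\mathcal{S}_1\setminus\{\emptyset\}\}$. For $1<p<\infty$, the $p$-th Baernstein space $B_p$ is the completion of $c_{00}$ in the norm $\|x\|_{B_p}=\sup\{(\sum_{j=1}^m(\sum_{n\in F_j}|x(n)|)^p)^{1/p} : m\in\mathbb{N},\ F_1,\ldots,F_m\in\mathcal{S}_1\setminus\{\emptyset\},\ \max F_j<\min F_{j+1}\text{ for }1\le j<m\}$. The unit vectors $(e_n)_{n\in\mathbb{N}}$ form a normalized, $1$-unconditional basis for $E$. For $N\subseteq\mathbb{N}$,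 $E_N=\overline{\operatorname{span}}(e_n : n\in N)$. Isomorphic means linearly homeomorphic. Schreier covering number: for a finite set $A\subset\mathbb{N}$, $\tau_1(\emptyset)=0$ and, for $A\ne\emptyset$, $\tau_1(A)=\min\{m\in\mathbb{N} : A\subseteq\bigcup_{j=1}^mF_j\text{ for some non-empty }F_1,\ldots,F_m\in\mathcal{S}_1\text{ with }\max F_j<\min F_{j+1}\ (1\le j<m)\}$. For an infinite set $M=\{m_1<m_2<\cdots\}\subseteq\mathbb{N}$ and $J\subseteq\mathbb{N}$, $M(J)=\{m_j : j\in J\}$. For infinite $M,N\subseteq\mathbb{N}$, the Gasparis--Leung index of $M$ with respect to $N$ is $\Gamma\mathrm{L}_1(M,N)=\sup\{\tau_1(M(J)) : J\subset\mathbb{N}\text{ finite},\ N(J)\in\mathcal{S}_1\}\in\mathbb{N}\cup\{\infty\}$. A basic sequence $(x_n)_{n\in\mathbb{N}}$ dominates a basic sequence $(y_n)_{n\in\mathbb{N}}$ if there is $C>0$ with $\|\sum_{n=1}^m\alpha_ny_n\|\le C\|\sum_{n=1}^m\alpha_nx_n\|$ for all $m\in\mathbb{N}$ and scalars $\alpha_1,\ldots,\alpha_m$; two basic sequences are equivalent if each dominates the other. Sequences indexed by infinite sets $M,N\subseteq\mathbb{N}$ are enumerated increasingly. *)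

theory Defs
  imports "HOL-Analysis.Analysis" "HOL-Library.Function_Algebras" "HOL-Library.Extended_Nat"
begin

text \<open>
  The natural numbers of the mathematical text start at 1, so subsets of them are sets
  \<open>A \<subseteq> {1..}\<close> of type \<^typ>\<open>nat set\<close>, and scalar sequences are functions \<open>x\<close>
  on \<^typ>\<open>nat\<close> with \<open>x 0 = 0\<close>.

  The scalar field is a type \<open>'k :: {real_normed_field, banach}\<close>. Both \<^typ>\<open>real\<close> and
  \<^typ>\<open>complex\<close> are instances, and by the Gelfand--Mazur theorem there are no others up to
  isometric isomorphism. Linearity always means linearity over \<open>'k\<close>.
\<close>

section \<open>Schreier sets\<close>

definition schreier :: "nat set set" where
  "schreier = {F. F \<subseteq> {1..} \<and> finite F \<and> (F = {} \<or> card F \<le> Min F)}"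

definition schreier_chain :: "nat \<Rightarrow> (nat \<Rightarrow> nat set) \<Rightarrow> bool" where
  "schreier_chain m F \<longleftrightarrow>
     (\<forall>j\<in>{1..m}. F j \<in> schreier - {{}}) \<and> (\<forall>j\<in>{1..<m}. Max (F j) < Min (F (Suc j)))"

text \<open>Meaningful for finite \<open>A \<subseteq> {1..}\<close>; the chain of singletons shows that the minimum is then attained.\<close>

definition schreier_cover :: "nat set \<Rightarrow> nat" where
  "schreier_cover A =
     (if A = {} then 0
      else LEAST m. 1 \<le> m \<and> (\<exists>F. schreier_chain m F \<and> A \<subseteq> (\<Union>j\<in>{1..m}. F j)))"

text \<open>\<open>nth_elem M j\<close> is \<open>m\<^sub>j\<close> for \<open>M = {m\<^sub>1 < m\<^sub>2 < \<dots>}\<close>; the library function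
  \<^const>\<open>enumerate\<close> counts from 0.\<close>

definition nth_elem :: "nat set \<Rightarrow> nat \<Rightarrow> nat" where
  "nth_elem M j = enumerate M (j - 1)"

definition GL_index :: "nat set \<Rightarrow> nat set \<Rightarrow> enat" where
  "GL_index M N =
     (SUP J\<in>{J. J \<subseteq> {1..} \<and> finite J \<and> nth_elem N ` J \<in> schreier}.
        enat (schreier_cover (nth_elem M ` J)))"

section \<open>Sequence spaces\<close>

definition seq_scale :: "'k \<Rightarrow> (nat \<Rightarrow> 'k::field) \<Rightarrow> nat \<Rightarrow> 'k" where
  "seq_scale c x = (\<lambda>n. c * x n)"

interpretation seq: vector_space seq_scale
  by unfold_locales (auto simp: seq_scale_def algebra_simps fun_eq_iff)

definition unit_vec :: "nat \<Rightarrow> nat \<Rightarrow> 'k::field" where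
  "unit_vec n = (\<lambda>k. if k = n then 1 else 0)"

definition c00 :: "(nat \<Rightarrow> 'k::field) set" where
  "c00 = {x. x 0 = 0 \<and> finite {n. x n \<noteq> 0}}"

text \<open>The norms are defined on all sequences, with values in \<open>[0, \<infinity>]\<close>.\<close>

definition schreier_norm :: "real \<Rightarrow> (nat \<Rightarrow> 'k::real_normed_field) \<Rightarrow> ennreal" where
  "schreier_norm p x =
     (SUP F\<in>schreier - {{}}. ennreal ((\<Sum>n\<in>F. norm (x n) powr p) powr (1 / p)))"

definition baernstein_norm :: "real \<Rightarrow> (nat \<Rightarrow> 'k::real_normed_field) \<Rightarrow> ennreal" where
  "baernstein_norm p x =
     (SUP (m, F)\<in>{(m, F). 1 \<le> m \<and> schreier_chain m F}.
        ennreal ((\<Sum>j=1..m. (\<Sum>n\<in>F j. norm (x n)) powr p) powr (1 / p)))"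

text \<open>
  The completion of \<^term>\<open>c00\<close> is realised as its closure in the space of all sequences of finite
  norm. This is a completion because that ambient space is complete: see
  \<open>completion_space\<close> below.
\<close>

definition finite_norm :: "((nat \<Rightarrow> 'k::field) \<Rightarrow> ennreal) \<Rightarrow> (nat \<Rightarrow> 'k) set" where
  "finite_norm nrm = {x. x 0 = 0 \<and> nrm x < \<infinity>}"

definition norm_dist :: "((nat \<Rightarrow> 'k::field) \<Rightarrow> ennreal) \<Rightarrow> (nat \<Rightarrow> 'k) \<Rightarrow> (nat \<Rightarrow> 'k) \<Rightarrow> real" where
  "norm_dist nrm x y = enn2real (nrm (x - y))"

definition norm_topology :: "((nat \<Rightarrow> 'k::field) \<Rightarrow> ennreal) \<Rightarrow> (nat \<Rightarrow> 'k) topology" where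
  "norm_topology nrm = Metric_space.mtopology (finite_norm nrm) (norm_dist nrm)"

definition completion :: "((nat \<Rightarrow> 'k::field) \<Rightarrow> ennreal) \<Rightarrow> (nat \<Rightarrow> 'k) set" where
  "completion nrm = norm_topology nrm closure_of c00"

definition space_topology :: "((nat \<Rightarrow> 'k::field) \<Rightarrow> ennreal) \<Rightarrow> (nat \<Rightarrow> 'k) topology" where
  "space_topology nrm = subtopology (norm_topology nrm) (completion nrm)"

definition unit_subspace :: "((nat \<Rightarrow> 'k::field) \<Rightarrow> ennreal) \<Rightarrow> nat set \<Rightarrow> (nat \<Rightarrow> 'k) set" where
  "unit_subspace nrm N = space_topology nrm closure_of (seq.span (unit_vec ` N))"

definition isomorphic_subspaces ::
    "((nat \<Rightarrow> 'k::field) \<Rightarrow> ennreal) \<Rightarrow> (nat \<Rightarrow> 'k) set \<Rightarrow> (nat \<Rightarrow> 'k) set \<Rightarrow> bool" where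
  "isomorphic_subspaces nrm U V \<longleftrightarrow>
     (\<exists>T. (\<forall>x\<in>U. \<forall>y\<in>U. T (x + y) = T x + T y) \<and>
          (\<forall>c. \<forall>x\<in>U. T (seq_scale c x) = seq_scale c (T x)) \<and>
          homeomorphic_map (subtopology (space_topology nrm) U)
                           (subtopology (space_topology nrm) V) T)"

text \<open>Domination and equivalence of sequences of vectors, indexed from 1.\<close>

definition dominates ::
    "((nat \<Rightarrow> 'k::field) \<Rightarrow> ennreal) \<Rightarrow> (nat \<Rightarrow> nat \<Rightarrow> 'k) \<Rightarrow> (nat \<Rightarrow> nat \<Rightarrow> 'k) \<Rightarrow> bool" where
  "dominates nrm x y \<longleftrightarrow>
     (\<exists>C>0. \<forall>m\<ge>1. \<forall>\<alpha>.
        nrm (\<Sum>n=1..m. seq_scale (\<alpha> n) (y n)) \<le> ennreal C * nrm (\<Sum>n=1..m. seq_scale (\<alpha> n) (x n)))"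

definition equivalent_seqs ::
    "((nat \<Rightarrow> 'k::field) \<Rightarrow> ennreal) \<Rightarrow> (nat \<Rightarrow> nat \<Rightarrow> 'k) \<Rightarrow> (nat \<Rightarrow> nat \<Rightarrow> 'k) \<Rightarrow> bool" where
  "equivalent_seqs nrm x y \<longleftrightarrow> dominates nrm x y \<and> dominates nrm y x"

section \<open>The space is a completion\<close>

lemma powr_convex_nonneg:
  fixes p t u v :: real
  assumes "1 \<le> p" "0 \<le> t" "t \<le> 1" "0 \<le> u" "0 \<le> v"
  shows "(t * u + (1 - t) * v) powr p \<le> t * u powr p + (1 - t) * v powr p"
proof -
  have small: "(s * w) powr p \<le> s * w powr p" if "0 \<le> s" "s \<le> 1" "0 \<le> w" for s w :: real
  proof -
    have "s powr p \<le> s"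
      using that assms(1) powr_mono'[of 1 p s] by (cases "s = 0") auto
    then show ?thesis
      using that by (simp add: powr_mult mult_right_mono)
  qed
  consider "u = 0" | "v = 0" | "u > 0" "v > 0" using assms by linarith
  then show ?thesis
  proof cases
    case 1 then show ?thesis using small[of "1 - t" v] assms by simp
  next
    case 2 then show ?thesis using small[of t u] assms by simp
  next
    case 3
    then show ?thesis
      using convex_onD[OF powr_convex[OF assms(1)], of "1 - t" u v] assms by simp
  qed
qed

lemma minkowski_sum:
  fixes a b :: "'i \<Rightarrow> real" and p :: real
  assumes "1 \<le> p" "finite I" "\<And>i. i \<in> I \<Longrightarrow> 0 \<le> a i" "\<And>i. i \<in> I \<Longrightarrow> 0 \<le> b i"
  shows "(\<Sum>i\<in>I. (a i + b i) powr p) powr (1 / p)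
           \<le> (\<Sum>i\<in>I. a i powr p) powr (1 / p) + (\<Sum>i\<in>I. b i powr p) powr (1 / p)"
proof -
  define A where "A = (\<Sum>i\<in>I. a i powr p) powr (1 / p)"
  define B where "B = (\<Sum>i\<in>I. b i powr p) powr (1 / p)"
  have nonneg: "0 \<le> A" "0 \<le> B" by (auto simp: A_def B_def)
  have Ap: "A powr p = (\<Sum>i\<in>I. a i powr p)" and Bp: "B powr p = (\<Sum>i\<in>I. b i powr p)"
    using assms(1) by (auto simp: A_def B_def powr_powr sum_nonneg)
  have zero: "\<And>i. i \<in> I \<Longrightarrow> c i = 0" if "(\<Sum>i\<in>I. c i powr p) powr (1 / p) = 0" for c :: "'i \<Rightarrow> real"
    using that assms(2) by (simp add: sum_nonneg_eq_0_iff)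
  consider "A = 0" | "B = 0" | "A > 0" "B > 0" using nonneg by linarith
  then have "(\<Sum>i\<in>I. (a i + b i) powr p) powr (1 / p) \<le> A + B"
  proof cases
    case 1
    then have "(\<Sum>i\<in>I. (a i + b i) powr p) = (\<Sum>i\<in>I. b i powr p)"
      using zero[of a] by (intro sum.cong) (auto simp: A_def)
    then show ?thesis using 1 by (simp add: B_def)
  next
    case 2
    then have "(\<Sum>i\<in>I. (a i + b i) powr p) = (\<Sum>i\<in>I. a i powr p)"
      using zero[of b] by (intro sum.cong) (auto simp: B_def)
    then show ?thesis using 2 by (simp add: A_def)
  next
    case 3
    define t where "t = A / (A + B)"
    have t: "0 \<le> t" "t \<le> 1" "1 - t = B / (A + B)" using 3 by (auto simp: t_def field_simps)
    have "(\<Sum>i\<in>I. ((a i + b i) / (A + B)) powr p)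
            \<le> (\<Sum>i\<in>I. t * (a i / A) powr p + (1 - t) * (b i / B) powr p)"
    proof (rule sum_mono)
      fix i assume i: "i \<in> I"
      have "(a i + b i) / (A + B) = t * (a i / A) + (1 - t) * (b i / B)"
        unfolding t(3) using 3 by (simp add: t_def add_divide_distrib)
      then show "((a i + b i) / (A + B)) powr p \<le> t * (a i / A) powr p + (1 - t) * (b i / B) powr p"
        using powr_convex_nonneg[OF assms(1) t(1,2), of "a i / A" "b i / B"] 3 assms(3,4)[OF i] by simp
    qed
    also have "\<dots> = t * ((\<Sum>i\<in>I. a i powr p) / A powr p) + (1 - t) * ((\<Sum>i\<in>I. b i powr p) / B powr p)"
      using 3 assms(3,4)
      by (simp add: sum.distrib sum_distrib_left sum_divide_distrib powr_divide)
    also have "\<dots> = 1"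
      using 3 by (simp flip: Ap Bp)
    finally have "(\<Sum>i\<in>I. (a i + b i) powr p) / (A + B) powr p \<le> 1"
      using 3 assms(3,4) by (simp add: powr_divide sum_divide_distrib)
    then have "(\<Sum>i\<in>I. (a i + b i) powr p) \<le> (A + B) powr p"
      using 3 by (simp add: divide_simps)
    then have "(\<Sum>i\<in>I. (a i + b i) powr p) powr (1 / p) \<le> ((A + B) powr p) powr (1 / p)"
      using assms(1) by (intro powr_mono2) (auto intro: sum_nonneg)
    also have "\<dots> = A + B" using 3 assms(1) by (simp add: powr_powr)
    finally show ?thesis .
  qed
  then show ?thesis by (simp add: A_def B_def)
qed

lemma lp_le_l1:
  fixes a :: "'i \<Rightarrow> real" and p :: real
  assumes "1 \<le> p" "finite I" "\<And>i. i \<in> I \<Longrightarrow> 0 \<le> a i"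
  shows "(\<Sum>i\<in>I. a i powr p) powr (1 / p) \<le> (\<Sum>i\<in>I. a i)"
  using assms(2,3)
proof (induction I)
  case (insert i I)
  have "(\<Sum>j\<in>insert i I. a j powr p) powr (1 / p)
      = (\<Sum>j\<in>insert i I. ((if j = i then a i else 0) + (if j = i then 0 else a j)) powr p) powr (1 / p)"
    by (intro arg_cong2[where f = "(powr)"] sum.cong) auto
  also have "\<dots> \<le> (\<Sum>j\<in>insert i I. (if j = i then a i else 0) powr p) powr (1 / p)
                + (\<Sum>j\<in>insert i I. (if j = i then 0 else a j) powr p) powr (1 / p)"
    using insert assms(1) by (intro minkowski_sum) auto
  also have "(\<Sum>j\<in>insert i I. (if j = i then a i else 0) powr p) = (a i powr p)"
    using insert by (subst sum.insert) (auto intro!: sum.neutral)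
  also have "(\<Sum>j\<in>insert i I. (if j = i then 0 else a j) powr p) = (\<Sum>j\<in>I. a j powr p)"
    using insert by (subst sum.insert) (auto intro!: sum.cong)
  also have "(a i powr p) powr (1 / p) = a i"
    using insert assms(1) by (simp add: powr_powr)
  finally show ?case
    using insert by auto
qed auto

lemma schreier_singleton: "1 \<le> n \<Longrightarrow> {n} \<in> schreier - {{}}"
  by (auto simp: schreier_def)

lemma chain_finite: "schreier_chain m F \<Longrightarrow> j \<in> {1..m} \<Longrightarrow> finite (F j)"
  by (auto simp: schreier_chain_def schreier_def)

lemma chain_less:
  assumes "schreier_chain m F" "1 \<le> i" "i < j" "j \<le> m"
  shows "Max (F i) < Min (F j)"
  using assms(3,4)
proof (induction j rule: less_induct)
  case (less j)
  have ne: "finite (F k)" "F k \<noteq> {}" if "1 \<le> k" "k \<le> m" for k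
    using assms(1) that by (auto simp: schreier_chain_def schreier_def)
  obtain k where k: "j = Suc k" using less.prems by (cases j) auto
  have step: "Max (F k) < Min (F j)"
    using assms(1,2) less.prems k by (auto simp: schreier_chain_def)
  show ?case
  proof (cases "i = k")
    case False
    then have "Max (F i) < Min (F k)" using less.IH[of k] less.prems k by auto
    also have "Min (F k) \<le> Max (F k)"
      using ne[of k] assms(2) less.prems k False by (intro Min_le_iff[THEN iffD2]) auto
    finally show ?thesis using step by simp
  qed (use step in simp)
qed

lemma chain_disjoint:
  assumes "schreier_chain m F" "i \<in> {1..m}" "j \<in> {1..m}" "i \<noteq> j"
  shows "F i \<inter> F j = {}"
proof -
  have "F i \<inter> F j = {}" if "1 \<le> i" "i < j" "j \<le> m" for i j
  proof -
    have "finite (F i)" "finite (F j)" using chain_finite[OF assms(1)] that by auto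
    then show ?thesis
      using chain_less[OF assms(1) that] Max_ge[of "F i"] Min_le[of "F j"]
      by (meson disjoint_iff leD le_trans)
  qed
  from this[of i j] this[of j i] show ?thesis using assms by (cases "i < j") auto
qed

text \<open>Both norms are suprema of seminorms, each depending on finitely many coordinates.\<close>

locale sup_norm =
  fixes nrm :: "(nat \<Rightarrow> 'k::{real_normed_field,banach}) \<Rightarrow> ennreal"
    and I :: "'i set" and q :: "'i \<Rightarrow> (nat \<Rightarrow> 'k) \<Rightarrow> real"
  assumes nrm_eq: "nrm x = (SUP i\<in>I. ennreal (q i x))"
    and q_nonneg: "i \<in> I \<Longrightarrow> 0 \<le> q i x"
    and q_add: "i \<in> I \<Longrightarrow> q i (x + y) \<le> q i x + q i y"
    and q_scale: "i \<in> I \<Longrightarrow> q i (seq_scale c x) = norm c * q i x"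
    and q_coord: "1 \<le> n \<Longrightarrow> \<exists>i\<in>I. \<forall>x. norm (x n) \<le> q i x"
    and q_tendsto: "i \<in> I \<Longrightarrow> (\<And>n. (\<lambda>k. f k n) \<longlonglongrightarrow> g n) \<Longrightarrow> (\<lambda>k. q i (f k)) \<longlonglongrightarrow> q i g"
    and q_c00: "i \<in> I \<Longrightarrow> x \<in> c00 \<Longrightarrow> q i x \<le> (\<Sum>n\<in>{n. x n \<noteq> 0}. norm (x n))"
begin

lemma nrm_le_iff: "0 \<le> B \<Longrightarrow> nrm x \<le> ennreal B \<longleftrightarrow> (\<forall>i\<in>I. q i x \<le> B)"
  by (auto simp: nrm_eq SUP_le_iff)

lemma q_le: "i \<in> I \<Longrightarrow> nrm x < \<infinity> \<Longrightarrow> q i x \<le> enn2real (nrm x)"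
  by (metis ennreal_enn2real_if infinity_ennreal_def less_irrefl nrm_le_iff enn2real_nonneg order_refl)

lemma coord_le: "1 \<le> n \<Longrightarrow> nrm x < \<infinity> \<Longrightarrow> norm (x n) \<le> enn2real (nrm x)"
  using q_coord[of n] q_le order_trans by blast

lemma nrm_add: "nrm (x + y) \<le> nrm x + nrm y"
  unfolding nrm_eq[of "x + y"]
proof (rule SUP_least)
  fix i assume i: "i \<in> I"
  have "ennreal (q i (x + y)) \<le> ennreal (q i x) + ennreal (q i y)"
    using q_add[OF i] q_nonneg[OF i] by (metis ennreal_leI ennreal_plus)
  also have "\<dots> \<le> nrm x + nrm y"
    unfolding nrm_eq by (intro add_mono SUP_upper i)
  finally show "ennreal (q i (x + y)) \<le> nrm x + nrm y" .
qed

lemma nrm_scale: "nrm (seq_scale c x) = ennreal (norm c) * nrm x"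
  unfolding nrm_eq by (simp add: q_scale q_nonneg ennreal_mult SUP_mult_left_ennreal)

lemma nrm_minus: "nrm (- x) = nrm x"
proof -
  have "- x = seq_scale (- 1) x" by (simp add: seq_scale_def fun_eq_iff)
  then show ?thesis using nrm_scale[of "-1" x] by simp
qed

lemma nrm_diff_commute: "nrm (x - y) = nrm (y - x)"
  using nrm_minus[of "x - y"] by simp

lemma diff_mem: "x \<in> finite_norm nrm \<Longrightarrow> y \<in> finite_norm nrm \<Longrightarrow> x - y \<in> finite_norm nrm"
  using nrm_add[of x "- y"] nrm_minus[of y]
  by (auto simp: finite_norm_def intro: le_less_trans)

lemma nrm_zero: "nrm 0 = 0"
  using nrm_scale[of 0 0] by (simp add: seq_scale_def zero_fun_def)

lemma metric: "Metric_space (finite_norm nrm) (norm_dist nrm)"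
proof
  fix x y show "0 \<le> norm_dist nrm x y" by (simp add: norm_dist_def)
  show "norm_dist nrm x y = norm_dist nrm y x" by (simp add: norm_dist_def nrm_diff_commute)
next
  fix x y assume xy: "x \<in> finite_norm nrm" "y \<in> finite_norm nrm"
  show "norm_dist nrm x y = 0 \<longleftrightarrow> x = y"
  proof
    assume 0: "norm_dist nrm x y = 0"
    have "x n = y n" for n
    proof (cases "n = 0")
      case True then show ?thesis using xy by (simp add: finite_norm_def)
    next
      case False
      then show ?thesis
        using coord_le[of n "x - y"] diff_mem[OF xy] 0 by (simp add: finite_norm_def norm_dist_def)
    qed
    then show "x = y" by blast
  qed (simp add: norm_dist_def nrm_zero)
next
  fix x y z assume xyz: "x \<in> finite_norm nrm" "y \<in> finite_norm nrm" "z \<in> finite_norm nrm"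
  have "nrm (x - z) \<le> nrm (x - y) + nrm (y - z)"
    using nrm_add[of "x - y" "y - z"] by simp
  moreover have "nrm (x - y) < \<infinity>" "nrm (y - z) < \<infinity>"
    using diff_mem xyz by (auto simp: finite_norm_def)
  ultimately show "norm_dist nrm x z \<le> norm_dist nrm x y + norm_dist nrm y z"
    unfolding norm_dist_def
    by (subst enn2real_plus[symmetric]) (auto intro!: enn2real_mono)
qed

lemma complete: "Metric_space.mcomplete (finite_norm nrm) (norm_dist nrm)"
proof -
  interpret X: Metric_space "finite_norm nrm" "norm_dist nrm" by (rule metric)
  have "\<exists>g. limitin X.mtopology f g sequentially" if f: "X.MCauchy f" for f
  proof -
    have mem: "f k \<in> finite_norm nrm" for k using f by (auto simp: X.MCauchy_def)
    have cau: "\<exists>K. \<forall>k\<ge>K. \<forall>l\<ge>K. norm_dist nrm (f k) (f l) < e" if "e > 0" for e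
      using f that by (auto simp: X.MCauchy_def)
    have dmem: "f k - f l \<in> finite_norm nrm" for k l using diff_mem mem by blast
    have "convergent (\<lambda>k. f k n)" for n
    proof (cases "n = 0")
      case True
      then have "(\<lambda>k. f k n) = (\<lambda>k. 0)" using mem by (auto simp: finite_norm_def)
      then show ?thesis by (simp add: convergent_const)
    next
      case False
      have "norm (f k n - f l n) \<le> norm_dist nrm (f k) (f l)" for k l
        using coord_le[of n "f k - f l"] dmem[of k l] False by (simp add: finite_norm_def norm_dist_def)
      then have "Cauchy (\<lambda>k. f k n)"
        unfolding Cauchy_def dist_norm using cau by (meson le_less_trans)
      then show ?thesis by (simp add: Cauchy_convergent_iff)
    qed
    then obtain g where g: "\<And>n. (\<lambda>k. f k n) \<longlonglongrightarrow> g n" unfolding convergent_def by metis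
    have "(\<lambda>k. f k 0) = (\<lambda>k. 0)" using mem by (auto simp: finite_norm_def)
    then have g0: "g 0 = 0" using g[of 0] by (simp add: LIMSEQ_const_iff)
    have close: "\<exists>K. \<forall>k\<ge>K. nrm (f k - g) \<le> ennreal e" if e: "e > 0" for e
    proof -
      obtain K where K: "\<And>k l. k \<ge> K \<Longrightarrow> l \<ge> K \<Longrightarrow> norm_dist nrm (f k) (f l) < e"
        using cau[OF e] by blast
      have "q i (f k - g) \<le> e" if "k \<ge> K" "i \<in> I" for k i
      proof (rule LIMSEQ_le_const2)
        show "(\<lambda>l. q i (f k - f l)) \<longlonglongrightarrow> q i (f k - g)"
          using that(2) g by (intro q_tendsto) (auto intro!: tendsto_intros)
        have "q i (f k - f l) \<le> e" if "l \<ge> K" for l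
        proof -
          have "nrm (f k - f l) < \<infinity>" using dmem[of k l] by (simp add: finite_norm_def)
          then have "q i (f k - f l) \<le> norm_dist nrm (f k) (f l)"
            using q_le[OF \<open>i \<in> I\<close>] by (simp add: norm_dist_def)
          then show ?thesis using K[OF \<open>k \<ge> K\<close> that] by linarith
        qed
        then show "\<exists>N. \<forall>l\<ge>N. q i (f k - f l) \<le> e" by blast
      qed
      then show ?thesis using e by (auto simp: nrm_le_iff)
    qed
    obtain k where "nrm (f k - g) \<le> ennreal 1" using close[of 1] by auto
    then have "f k - g \<in> finite_norm nrm"
      using g0 mem[of k] by (auto simp: finite_norm_def intro: le_less_trans)
    then have gm: "g \<in> finite_norm nrm" using diff_mem[OF mem[of k]] by fastforce
    have "\<exists>K. \<forall>k\<ge>K. f k \<in> finite_norm nrm \<and> norm_dist nrm (f k) g < e" if e: "e > 0" for e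
    proof -
      obtain K where "\<And>k. k \<ge> K \<Longrightarrow> nrm (f k - g) \<le> ennreal (e / 2)" using close[of "e / 2"] e by auto
      then have "norm_dist nrm (f k) g \<le> e / 2" if "k \<ge> K" for k
        using that e by (metis enn2real_ennreal enn2real_mono ennreal_less_top half_gt_zero less_imp_le norm_dist_def)
      then show ?thesis using e mem by (intro exI[of _ K]) fastforce
    qed
    then have "limitin X.mtopology f g sequentially"
      using gm by (auto simp: X.limitin_metric eventually_sequentially)
    then show ?thesis by blast
  qed
  then show ?thesis by (simp add: X.mcomplete_def)
qed

lemma c00_subset: "c00 \<subseteq> finite_norm nrm"
proof
  fix x :: "nat \<Rightarrow> 'k" assume x: "x \<in> c00"
  have "nrm x \<le> ennreal (\<Sum>n\<in>{n. x n \<noteq> 0}. norm (x n))"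
    using q_c00[OF _ x] by (subst nrm_le_iff) (auto intro: sum_nonneg)
  then show "x \<in> finite_norm nrm"
    using x by (auto simp: finite_norm_def c00_def intro: le_less_trans)
qed

lemma completion_space:
  "Metric_space (completion nrm) (norm_dist nrm)"
  "Metric_space.mcomplete (completion nrm) (norm_dist nrm)"
  "Metric_space.mtopology (completion nrm) (norm_dist nrm) = space_topology nrm"
  "c00 \<subseteq> completion nrm"
  "space_topology nrm closure_of c00 = completion nrm"
proof -
  interpret X: Metric_space "finite_norm nrm" "norm_dist nrm" by (rule metric)
  have sub: "completion nrm \<subseteq> finite_norm nrm"
    unfolding completion_def norm_topology_def
    using closure_of_subset_topspace[of X.mtopology c00] by simp
  then interpret Y: Submetric "finite_norm nrm" "norm_dist nrm" "completion nrm"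
    by unfold_locales
  show "Metric_space (completion nrm) (norm_dist nrm)" by (rule X.subspace[OF sub])
  have "closedin X.mtopology (completion nrm)"
    by (simp add: completion_def norm_topology_def)
  then show "Metric_space.mcomplete (completion nrm) (norm_dist nrm)"
    using Y.closedin_mcomplete_imp_mcomplete complete by blast
  show "Metric_space.mtopology (completion nrm) (norm_dist nrm) = space_topology nrm"
    by (simp add: space_topology_def norm_topology_def Y.mtopology_submetric)
  show c: "c00 \<subseteq> completion nrm"
    unfolding completion_def norm_topology_def by (rule closure_of_subset) (simp add: c00_subset)
  show "space_topology nrm closure_of c00 = completion nrm"
    unfolding space_topology_def closure_of_subtopology
    using c by (simp add: Int_absorb1 completion_def)
qed

end

lemma sup_norm_schreier:
  assumes "1 \<le> p"
  shows "sup_norm (schreier_norm p :: (nat \<Rightarrow> 'k::{real_normed_field,banach}) \<Rightarrow> ennreal) (schreier - {{}})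
           (\<lambda>F x. (\<Sum>n\<in>F. norm (x n) powr p) powr (1 / p))"
proof
  fix F :: "nat set" and x y :: "nat \<Rightarrow> 'k" and c :: 'k assume F: "F \<in> schreier - {{}}"
  then have fin: "finite F" by (auto simp: schreier_def)
  have "(\<Sum>n\<in>F. norm ((x + y) n) powr p) powr (1 / p) \<le> (\<Sum>n\<in>F. (norm (x n) + norm (y n)) powr p) powr (1 / p)"
    using assms by (intro powr_mono2 sum_mono sum_nonneg) (auto intro: norm_triangle_ineq)
  also have "\<dots> \<le> (\<Sum>n\<in>F. norm (x n) powr p) powr (1 / p) + (\<Sum>n\<in>F. norm (y n) powr p) powr (1 / p)"
    using fin assms by (intro minkowski_sum) auto
  finally show "(\<Sum>n\<in>F. norm ((x + y) n) powr p) powr (1 / p)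
    \<le> (\<Sum>n\<in>F. norm (x n) powr p) powr (1 / p) + (\<Sum>n\<in>F. norm (y n) powr p) powr (1 / p)" .
  show "(\<Sum>n\<in>F. norm (seq_scale c x n) powr p) powr (1 / p) = norm c * (\<Sum>n\<in>F. norm (x n) powr p) powr (1 / p)"
    using assms by (simp add: seq_scale_def norm_mult powr_mult powr_powr sum_nonneg flip: sum_distrib_left)
next
  fix n :: nat assume "1 \<le> n"
  then show "\<exists>F\<in>schreier - {{}}. \<forall>x::nat \<Rightarrow> 'k. norm (x n) \<le> (\<Sum>n\<in>F. norm (x n) powr p) powr (1 / p)"
    using assms by (intro bexI[of _ "{n}"] schreier_singleton) (auto simp: powr_powr)
next
  fix F :: "nat set" and f :: "nat \<Rightarrow> nat \<Rightarrow> 'k" and g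
  assume "\<And>n. (\<lambda>k. f k n) \<longlonglongrightarrow> g n"
  then show "(\<lambda>k. (\<Sum>n\<in>F. norm (f k n) powr p) powr (1 / p)) \<longlonglongrightarrow> (\<Sum>n\<in>F. norm (g n) powr p) powr (1 / p)"
    using assms by (intro tendsto_powr' tendsto_sum tendsto_norm tendsto_const) (auto intro!: sum_nonneg always_eventually)
next
  fix F :: "nat set" and x :: "nat \<Rightarrow> 'k" assume F: "F \<in> schreier - {{}}" and x: "x \<in> c00"
  then have fin: "finite F" "finite {n. x n \<noteq> 0}" by (auto simp: schreier_def c00_def)
  have "(\<Sum>n\<in>F. norm (x n) powr p) powr (1 / p) \<le> (\<Sum>n\<in>F. norm (x n))"
    using fin assms by (intro lp_le_l1) auto
  also have "\<dots> = (\<Sum>n\<in>F \<inter> {n. x n \<noteq> 0}. norm (x n))"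
    using fin by (intro sum.mono_neutral_right) auto
  also have "\<dots> \<le> (\<Sum>n\<in>{n. x n \<noteq> 0}. norm (x n))"
    using fin by (intro sum_mono2) auto
  finally show "(\<Sum>n\<in>F. norm (x n) powr p) powr (1 / p) \<le> (\<Sum>n\<in>{n. x n \<noteq> 0}. norm (x n))" .
qed (auto simp: schreier_norm_def)

lemma sup_norm_baernstein:
  assumes "1 < p"
  shows "sup_norm (baernstein_norm p :: (nat \<Rightarrow> 'k::{real_normed_field,banach}) \<Rightarrow> ennreal)
           {(m, F). 1 \<le> m \<and> schreier_chain m F}
           (\<lambda>(m, F) x. (\<Sum>j=1..m. (\<Sum>n\<in>F j. norm (x n)) powr p) powr (1 / p))"
    (is "sup_norm _ ?I ?q")
proof
  fix i and x y :: "nat \<Rightarrow> 'k" and c :: 'k assume "i \<in> ?I"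
  then obtain m F where i: "i = (m, F)" and F: "1 \<le> m" "schreier_chain m F" by auto
  have "(\<Sum>j=1..m. (\<Sum>n\<in>F j. norm ((x + y) n)) powr p) powr (1 / p)
     \<le> (\<Sum>j=1..m. ((\<Sum>n\<in>F j. norm (x n)) + (\<Sum>n\<in>F j. norm (y n))) powr p) powr (1 / p)"
    using assms unfolding sum.distrib[symmetric]
    by (intro powr_mono2 sum_mono sum_nonneg) (auto intro: norm_triangle_ineq sum_nonneg)
  also have "\<dots> \<le> ?q i x + ?q i y"
    using assms unfolding i prod.case by (intro minkowski_sum) (auto intro: sum_nonneg)
  finally show "?q i (x + y) \<le> ?q i x + ?q i y" by (simp add: i)
  show "?q i (seq_scale c x) = norm c * ?q i x"
    using assms
    by (simp add: i seq_scale_def norm_mult powr_mult powr_powr sum_nonneg flip: sum_distrib_left)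
next
  fix n :: nat assume n: "1 \<le> n"
  have "schreier_chain 1 (\<lambda>_. {n})" using schreier_singleton[OF n] by (auto simp: schreier_chain_def)
  then show "\<exists>i\<in>?I. \<forall>x::nat \<Rightarrow> 'k. norm (x n) \<le> ?q i x"
    using assms by (intro bexI[of _ "(1, \<lambda>_. {n})"]) (auto simp: powr_powr)
next
  fix i and f :: "nat \<Rightarrow> nat \<Rightarrow> 'k" and g
  assume "i \<in> ?I" and lim: "\<And>n. (\<lambda>k. f k n) \<longlonglongrightarrow> g n"
  then obtain m F where i: "i = (m, F)" by auto
  show "(\<lambda>k. ?q i (f k)) \<longlonglongrightarrow> ?q i g"
    unfolding i prod.case using assms lim
    by (intro tendsto_powr' tendsto_sum tendsto_norm tendsto_const) (auto intro!: sum_nonneg always_eventually)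
next
  fix i and x :: "nat \<Rightarrow> 'k" assume "i \<in> ?I" and x: "x \<in> c00"
  then obtain m F where i: "i = (m, F)" and F: "1 \<le> m" "schreier_chain m F" by auto
  have fin: "finite {n. x n \<noteq> 0}" using x by (auto simp: c00_def)
  have finF: "finite (F j)" if "j \<in> {1..m}" for j using chain_finite[OF F(2) that] .
  have "(\<Sum>j=1..m. (\<Sum>n\<in>F j. norm (x n)) powr p) powr (1 / p) \<le> (\<Sum>j=1..m. \<Sum>n\<in>F j. norm (x n))"
    using assms by (intro lp_le_l1) (auto intro: sum_nonneg)
  also have "\<dots> = (\<Sum>n\<in>(\<Union>j\<in>{1..m}. F j). norm (x n))"
    using finF chain_disjoint[OF F(2)] by (intro sum.UNION_disjoint[symmetric]) auto
  also have "\<dots> = (\<Sum>n\<in>(\<Union>j\<in>{1..m}. F j) \<inter> {n. x n \<noteq> 0}. norm (x n))"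
    using finF by (intro sum.mono_neutral_right) auto
  also have "\<dots> \<le> (\<Sum>n\<in>{n. x n \<noteq> 0}. norm (x n))"
    using fin by (intro sum_mono2) auto
  finally show "?q i x \<le> (\<Sum>n\<in>{n. x n \<noteq> 0}. norm (x n))" by (simp add: i)
qed (auto simp: baernstein_norm_def case_prod_beta)

lemmas schreier_completion = sup_norm.completion_space[OF sup_norm_schreier]
lemmas baernstein_completion = sup_norm.completion_space[OF sup_norm_baernstein]

end

theory Submission
  imports Defs
begin

text \<open>
  Write \<open>u\<^sub>m = T e\<^sub>m\<close> for an isomorphism \<open>T\<close> from the span of \<open>(e\<^sub>m)\<close>, \<open>m \<in> M\<close>, onto the span of \<open>(e\<^sub>n)\<close>,
  \<open>n \<in> N\<close>, and let \<open>S\<close> be its inverse. Both families of norms share three estimates, with exponents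
  \<open>s < P\<close> (\<open>s = p\<close>, \<open>P = p + 1\<close> for Schreier norms and \<open>s = 1\<close>, \<open>P = p\<close> for Baernstein norms), the core of the
  locale \<open>schreier_type\<close>: on a Schreier set the norm is at least the \<open>\<ell>\<^sub>s\<close> norm; a weight \<open>w\<close> whose sum over every
  Schreier set is at most 2 and whose total \<open>W\<close> is at least 1 gives a vector \<open>w\<^bsup>1/s\<^esup>\<close> of norm at
  most \<open>2 W\<^bsup>1/P\<^esup>\<close>; and a vector followed by a far and flat one obeys an upper \<open>\<ell>\<^sub>P\<close> estimate, up to a small error.

  Finite indices give equivalent bases because a Schreier set of indices on the side of \<open>N\<close> splits,
  on the side of \<open>M\<close>, into boundedly many Schreier sets, so each sum in the norm splits into
  boundedly many sums of the same kind. Equivalent bases give an isomorphism by relabelling coordinates.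

  The step from an isomorphism back to the indices is the deep one. Let \<open>N(J)\<close> be a Schreier set with least
  element \<open>b\<close>, and let \<open>A = M(J)\<close>. The greedy decomposition of \<open>A\<close> into \<open>\<tau>(A)\<close> Schreier sets yields
  a weight on \<open>A\<close> of total at least \<open>\<tau>(A) - 1\<close>, bounded by \<open>1 / min A\<close>, whose sum over every Schreier set is at
  most 2 (\<open>greedy_weight\<close>). It remains to bound its total.
  For \<open>m \<in> A\<close> the identity \<open>1 = (S u\<^sub>m)(m)\<close> splits according to the coordinates of \<open>u\<^sub>m\<close> below \<open>b\<close> and from \<open>b\<close> on.

  \<^item> Each coordinate \<open>n \<in> N\<close> contributes in total at most \<open>\<parallel>T\<parallel> \<parallel>S\<parallel>\<close>, by unconditionality
    (\<open>coordinate_mass\<close>), and fewer than \<open>min A\<close> elements of \<open>N\<close> lie below \<open>b\<close>. So the lower part dominates for at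
    most a constant times \<open>min A\<close> many \<open>m\<close>, and these carry a bounded weight.

  \<^item> For every other \<open>m\<close> the upper part of \<open>u\<^sub>m\<close> is seen by \<open>S\<close> at \<open>m\<close>. Such parts cannot become flat: infinitely many
    flat ones would give sums of \<open>r\<close> vectors of norm of order \<open>r\<^bsup>1/P\<^esup>\<close>, whereas their images under \<open>S\<close> have
    norm at least of order \<open>r\<^bsup>1/s\<^esup>\<close>. So, unless \<open>b\<close> or \<open>m\<close> is small, \<open>u\<^sub>m\<close> has a coordinate of size at least a
    fixed \<open>\<delta> > 0\<close> at some \<open>\<sigma>(m) \<ge> b\<close> (\<open>large_coordinate\<close>). The set of all \<open>\<sigma>(m)\<close> is a Schreier set, since it has at
    most \<open>b\<close> elements. Hence the vector \<open>w\<^bsup>1/s\<^esup>\<close>, restricted to these \<open>m\<close> and given suitable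
    phases, is mapped to a vector of norm at least \<open>\<delta> W\<^bsup>1/s\<^esup>\<close>, where \<open>W\<close> is the weight of these \<open>m\<close>, while it has norm at most \<open>2 W\<^bsup>1/P\<^esup>\<close>; this bounds \<open>W\<close> (\<open>cover_bounded\<close>).

  Both uses of the lower estimate read off single matrix entries of an operator. This is legitimate because
  averaging over signs replaces an operator by its (block) diagonal (\<open>diagonal_bound\<close>).
\<close>

section \<open>Schreier sets and greedy weights\<close>

lemma schreier_subset: "F \<in> schreier \<Longrightarrow> G \<subseteq> F \<Longrightarrow> G \<in> schreier"
proof -
  assume F: "F \<in> schreier" and G: "G \<subseteq> F"
  show "G \<in> schreier"
  proof (cases "G = {}")
    case False
    then have "finite F" "card F \<le> Min F" using F G by (auto simp: schreier_def)
    moreover have "card G \<le> card F" using G \<open>finite F\<close> by (rule card_mono[rotated])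
    moreover have "Min F \<le> Min G" using G False \<open>finite F\<close> by (rule Min_antimono)
    ultimately show ?thesis using F G by (auto simp: schreier_def intro: finite_subset)
  qed (simp add: schreier_def)
qed

lemma schreier_finite: "F \<in> schreier \<Longrightarrow> finite F"
  by (auto simp: schreier_def)

lemma schreierI:
  assumes "finite F" "1 \<le> b" "card F \<le> b" "\<And>n. n \<in> F \<Longrightarrow> b \<le> n"
  shows "F \<in> schreier"
proof -
  have "card F \<le> n" "1 \<le> n" if "n \<in> F" for n
    using assms(2,3) assms(4)[OF that] by linarith+
  moreover from this have "card F \<le> Min F" if "F \<noteq> {}"
    using that assms(1) Min_in by blast
  moreover have "F \<subseteq> {1..}" using calculation(2) by auto
  ultimately show ?thesis unfolding schreier_def using assms(1) by blast
qed

lemma schreier_card_le: "F \<in> schreier \<Longrightarrow> n \<in> F \<Longrightarrow> card F \<le> n"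
  unfolding schreier_def by (auto intro: order_trans[OF _ Min_le])

text \<open>
  The chain of singletons shows that the minimum defining the covering number is attained.
\<close>

lemma schreier_cover_exists:
  assumes "finite A" "A \<subseteq> {1..}" "A \<noteq> {}"
  shows "\<exists>F. schreier_chain (schreier_cover A) F \<and> A \<subseteq> (\<Union>j\<in>{1..schreier_cover A}. F j)"
    and "1 \<le> schreier_cover A"
proof -
  let ?P = "\<lambda>m. 1 \<le> m \<and> (\<exists>F. schreier_chain m F \<and> A \<subseteq> (\<Union>j\<in>{1..m}. F j))"
  define e where "e j = {sorted_list_of_set A ! (j - 1)}" for j
  have len: "length (sorted_list_of_set A) = card A" using assms by simp
  have mem: "sorted_list_of_set A ! (j - 1) \<in> A" if "1 \<le> j" "j \<le> card A" for j
    using nth_mem[of "j - 1" "sorted_list_of_set A"] that len assms(1) by auto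
  have "schreier_chain (card A) e"
    unfolding schreier_chain_def
  proof (intro conjI ballI)
    fix j assume "j \<in> {1..card A}"
    then have "sorted_list_of_set A ! (j - 1) \<in> A" using mem by auto
    then show "e j \<in> schreier - {{}}" unfolding e_def using assms(2) by (intro schreier_singleton) auto
  next
    fix j assume "j \<in> {1..<card A}"
    then show "Max (e j) < Min (e (Suc j))"
      using sorted_wrt_nth_less[OF strict_sorted_list_of_set[of A], of "j - 1" j] len by (simp add: e_def)
  qed
  moreover have "A \<subseteq> (\<Union>j\<in>{1..card A}. e j)"
  proof
    fix a assume "a \<in> A"
    then obtain i where "i < card A" "a = sorted_list_of_set A ! i"
      using assms(1) len by (metis in_set_conv_nth set_sorted_list_of_set)
    then show "a \<in> (\<Union>j\<in>{1..card A}. e j)" by (intro UN_I[of "Suc i"]) (auto simp: e_def)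
  qed
  moreover have "1 \<le> card A" using assms by (simp add: Suc_le_eq card_gt_0_iff)
  ultimately have "?P (card A)" by blast
  then have "?P (LEAST m. ?P m)" by (rule LeastI)
  then show "\<exists>F. schreier_chain (schreier_cover A) F \<and> A \<subseteq> (\<Union>j\<in>{1..schreier_cover A}. F j)"
    "1 \<le> schreier_cover A"
    using assms(3) by (auto simp: schreier_cover_def)
qed

lemma schreier_cover_le:
  assumes "schreier_chain m F" "A \<subseteq> (\<Union>j\<in>{1..m}. F j)" "1 \<le> m"
  shows "schreier_cover A \<le> m"
  using assms by (auto simp: schreier_cover_def intro!: Least_le)

text \<open>
  One step of the greedy covering: putting a Schreier set in front costs at most one covering set. The sets
  covering the rest may reach down into the new one and have to be trimmed.
\<close>

lemma schreier_cover_Un: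
  assumes "finite A" "A \<subseteq> {1..}" "F \<in> schreier" "F \<noteq> {}" "\<And>n k. n \<in> F \<Longrightarrow> k \<in> A \<Longrightarrow> n < k"
  shows "schreier_cover (F \<union> A) \<le> Suc (schreier_cover A)"
proof (cases "A = {}")
  case True
  have "schreier_cover F \<le> 1"
    using assms by (intro schreier_cover_le[of _ "\<lambda>_. F"]) (auto simp: schreier_chain_def)
  then show ?thesis using True by (simp add: schreier_cover_def)
next
  case False
  obtain G where G: "schreier_chain (schreier_cover A) G" "A \<subseteq> (\<Union>j\<in>{1..schreier_cover A}. G j)"
    using schreier_cover_exists[OF assms(1,2) False] by blast
  let ?m = "schreier_cover A"
  \<comment> \<open>the covering sets are cut down to the part above \<open>F\<close>; the ones that become empty are dropped\<close>
  define l where "l = (LEAST l. l \<in> {1..?m} \<and> G l \<inter> A \<noteq> {})"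
  obtain a where a: "a \<in> A" using False by blast
  then obtain j where "j \<in> {1..?m}" "a \<in> G j" using G(2) by blast
  with a have ex: "j \<in> {1..?m} \<and> G j \<inter> A \<noteq> {}" by blast
  have l: "l \<in> {1..?m}" "G l \<inter> A \<noteq> {}"
    using LeastI[of "\<lambda>l. l \<in> {1..?m} \<and> G l \<inter> A \<noteq> {}", OF ex] by (auto simp: l_def)
  have l_min: "G i \<inter> A = {}" if "i \<in> {1..?m}" "i < l" for i
    using not_less_Least[OF that(2)[unfolded l_def]] that(1) by blast
  define H where "H i = (if i = 1 then F else if i = 2 then G l \<inter> A else G (l + i - 2))" for i
  have "schreier_chain (?m - l + 2) H"
    unfolding schreier_chain_def
  proof (intro conjI ballI)
    fix i assume i: "i \<in> {1..?m - l + 2}"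
    show "H i \<in> schreier - {{}}"
    proof (cases "i = 1 \<or> i = 2")
      case True
      then show ?thesis
        using G(1) l assms schreier_subset[of "G l" "G l \<inter> A"] unfolding H_def schreier_chain_def by auto
    next
      case False
      then have "l + i - 2 \<in> {1..?m}" using i l by auto
      then show ?thesis using False G(1) unfolding H_def schreier_chain_def by auto
    qed
  next
    fix i assume i: "i \<in> {1..<?m - l + 2}"
    have fin: "finite (G l)" using chain_finite[OF G(1) l(1)] .
    consider "i = 1" | "i = 2" | "2 < i" using i by fastforce
    then show "Max (H i) < Min (H (Suc i))"
    proof cases
      case 1
      have "Max F \<in> F" using assms(3,4) by (simp add: schreier_finite)
      moreover have "Min (G l \<inter> A) \<in> G l \<inter> A" using l fin by (intro Min_in) auto
      ultimately show ?thesis using assms(5) 1 by (auto simp: H_def)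
    next
      case 2
      have "Max (G l \<inter> A) \<le> Max (G l)" using fin l by (intro Max_mono) auto
      also have "\<dots> < Min (G (Suc l))"
        using i 2 l by (intro chain_less[OF G(1)]) auto
      finally show ?thesis using 2 by (simp add: H_def)
    next
      case 3
      then show ?thesis using i l chain_less[OF G(1), of "l + i - 2" "l + Suc i - 2"] by (auto simp: H_def)
    qed
  qed
  moreover have "F \<union> A \<subseteq> (\<Union>j\<in>{1..?m - l + 2}. H j)"
  proof
    fix n assume n: "n \<in> F \<union> A"
    show "n \<in> (\<Union>j\<in>{1..?m - l + 2}. H j)"
    proof (cases "n \<in> F")
      case True then show ?thesis by (intro UN_I[of 1]) (auto simp: H_def)
    next
      case False
      then obtain i where i: "i \<in> {1..?m}" "n \<in> G i" "n \<in> A" using n G(2) by blast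
      then have "l \<le> i" using l_min by (meson disjoint_iff not_less)
      then show ?thesis using i by (intro UN_I[of "i - l + 2"]) (auto simp: H_def)
    qed
  qed
  ultimately have "schreier_cover (F \<union> A) \<le> ?m - l + 2" by (intro schreier_cover_le) auto
  then show ?thesis using l by auto
qed

text \<open>
  Spread mass 1 evenly over the first \<open>min A\<close> elements of \<open>A\<close>, and continue with the remaining elements until at most
  one Schreier set is left, which gets no mass. A Schreier set \<open>F\<close> starting in one of these groups, \<open>G\<close>, collects mass at most 1
  from \<open>G\<close>. It has at most \<open>max G\<close> elements, and beyond \<open>G\<close> each of them weighs at most
  \<open>1 / k\<close> for some \<open>k > max G\<close>, so it collects at most 1 there as well.
\<close>

lemma greedy_weight:
  assumes "finite A" "A \<subseteq> {1..}" "A \<noteq> {}"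
  shows "\<exists>w :: nat \<Rightarrow> real. (\<forall>n. 0 \<le> w n) \<and> (\<forall>n. n \<notin> A \<longrightarrow> w n = 0) \<and> (\<forall>n. w n \<le> 1 / Min A)
           \<and> (\<forall>F\<in>schreier. sum w F \<le> 2) \<and> real (schreier_cover A) - 1 \<le> sum w A"
  using assms
proof (induction "card A" arbitrary: A rule: less_induct)
  case less
  let ?a = "Min A"
  have a: "?a \<in> A" "1 \<le> ?a" using less.prems by auto
  show ?case
  proof (cases "card A \<le> ?a")
    case True
    then have "A \<in> schreier" using less.prems by (auto simp: schreier_def)
    then have "schreier_cover A \<le> 1"
      using less.prems by (intro schreier_cover_le[of _ "\<lambda>_. A"]) (auto simp: schreier_chain_def)
    then show ?thesis using a by (intro exI[of _ "\<lambda>_. 0"]) auto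
  next
    case False
    define A1 where "A1 = set (take ?a (sorted_list_of_set A))"
    define A2 where "A2 = A - A1"
    have set_eq: "A = A1 \<union> set (drop ?a (sorted_list_of_set A))"
      unfolding A1_def using less.prems(1) by (metis append_take_drop_id set_append set_sorted_list_of_set)
    have dist: "distinct (take ?a (sorted_list_of_set A) @ drop ?a (sorted_list_of_set A))"
      by simp
    have A2: "A2 = set (drop ?a (sorted_list_of_set A))"
      using set_eq dist unfolding distinct_append A2_def A1_def by blast
    have less12: "n < k" if "n \<in> A1" "k \<in> A2" for n k
    proof -
      have "sorted_wrt (<) (take ?a (sorted_list_of_set A) @ drop ?a (sorted_list_of_set A))"
        by simp
      then show ?thesis using that unfolding A2 A1_def sorted_wrt_append by blast
    qed
    have c1: "card A1 = ?a"
      unfolding A1_def using False less.prems by (subst distinct_card) (simp_all del: Min_le_iff Min_ge_iff)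
    have sub: "A1 \<subseteq> A" "A2 \<subseteq> A" and un: "A = A1 \<union> A2" "A1 \<inter> A2 = {}"
      using set_eq by (auto simp: A2_def)
    have fin: "finite A1" "finite A2" using sub less.prems finite_subset by blast+
    have ne: "A1 \<noteq> {}" using c1 a by auto
    have "card A = card A1 + card A2" using un fin by (metis card_Un_disjoint)
    then have ne2: "A2 \<noteq> {}" and c2: "card A2 < card A" using False c1 a by auto
    have S1: "A1 \<in> schreier"
      using a sub less.prems c1 fin by (intro schreierI[of _ ?a]) auto
    obtain w where w: "\<And>n. 0 \<le> w n" "\<And>n. n \<notin> A2 \<Longrightarrow> w n = (0::real)" "\<And>n. w n \<le> 1 / Min A2"
      "\<And>F. F \<in> schreier \<Longrightarrow> sum w F \<le> 2" "real (schreier_cover A2) - 1 \<le> sum w A2"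
      using less.hyps[OF c2 fin(2) _ ne2] sub less.prems by blast
    define v where "v n = (if n \<in> A1 then 1 / ?a else w n)" for n
    have minle: "?a \<le> Min A2" using sub less.prems ne2 by (intro Min_antimono) auto
    have "1 / Min A2 \<le> 1 / real ?a" using minle a by (simp add: frac_le)
    then have vle: "v n \<le> 1 / ?a" for n using w(3)[of n] by (auto simp: v_def)
    have v0: "0 \<le> v n" for n using w(1) by (simp add: v_def)
    have vF: "sum v F \<le> 2" if F: "F \<in> schreier" for F
    proof (cases "F \<inter> A1 = {}")
      case True
      then have "sum v F = sum w F" by (intro sum.cong) (auto simp: v_def)
      then show ?thesis using w(4)[OF F] by simp
    next
      case False
      then obtain n where n: "n \<in> F" "n \<in> A1" by blast
      have finF: "finite F" using F by (rule schreier_finite)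
      have "Min A2 \<in> A2" using fin ne2 by simp
      then have "card F \<le> Min A2" using schreier_card_le[OF F n(1)] less12[OF n(2)] by fastforce
      then have "card (F - A1) \<le> Min A2"
        using card_mono[OF finF, of "F - A1"] by auto
      then have "real (card (F - A1)) * (1 / Min A2) \<le> 1"
        by (auto simp: divide_simps)
      then have "sum w (F - A1) \<le> 1"
        using sum_bounded_above[of "F - A1" w "1 / Min A2"] w(3) by force
      moreover have "sum v (F \<inter> A1) \<le> 1"
      proof -
        have "sum v (F \<inter> A1) = card (F \<inter> A1) / ?a" by (simp add: v_def)
        moreover have "real (card (F \<inter> A1)) \<le> ?a" using card_mono[OF fin(1), of "F \<inter> A1"] c1 by auto
        ultimately show ?thesis using a(2) by (simp only: divide_le_eq_1_pos of_nat_0_less_iff)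
      qed
      moreover have "sum v F = sum v (F \<inter> A1) + sum v (F - A1)"
        using finF by (simp add: sum.Int_Diff)
      moreover have "sum v (F - A1) = sum w (F - A1)" by (intro sum.cong) (auto simp: v_def)
      ultimately show ?thesis by simp
    qed
    have "sum v A = sum v A1 + sum v A2"
      using un fin by (subst un(1)) (rule sum.union_disjoint)
    also have "sum v A1 = 1" using c1 a by (simp add: v_def)
    also have "sum v A2 = sum w A2" using un(2) by (intro sum.cong) (auto simp: v_def)
    finally have "sum v A = 1 + sum w A2" .
    moreover have "schreier_cover A \<le> Suc (schreier_cover A2)"
      unfolding un(1) using fin sub less.prems S1 ne less12 by (intro schreier_cover_Un) auto
    ultimately have "real (schreier_cover A) - 1 \<le> sum v A" using w(5) by linarith
    moreover have "\<forall>n. n \<notin> A \<longrightarrow> v n = 0" using sub w(2) by (auto simp: v_def)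
    ultimately show ?thesis using v0 vle vF by blast
  qed
qed

section \<open>Norms of Schreier type\<close>

lemma sum_fun_apply: "(\<Sum>i\<in>A. f i) x = (\<Sum>i\<in>A. (f i x :: 'a::comm_monoid_add))"
  by (induction A rule: infinite_finite_induct) auto

lemma sum_Pow_sign:
  assumes "finite I" "k \<in> I"
  shows "(\<Sum>H\<in>Pow I. (if k \<in> H then - 1 else 1) * (if n \<in> H then - 1 else (1::'a::real_normed_field)))
           = (if n = k then 2 ^ card I else 0)"
proof (cases "n = k")
  case True
  have "(\<Sum>H\<in>Pow I. (if k \<in> H then - 1 else 1) * (if n \<in> H then - 1 else (1::'a))) = (\<Sum>H\<in>Pow I. 1)"
    using True by (intro sum.cong) auto
  then show ?thesis using True assms by (simp add: card_Pow)
next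
  case False
  let ?f = "\<lambda>H. (if k \<in> H then - 1 else 1) * (if n \<in> H then - 1 else (1::'a))"
  let ?t = "\<lambda>H. if k \<in> H then H - {k} else insert k H"
  have "sum ?f (Pow I) = (\<Sum>H\<in>Pow I. - ?f H)"
    using assms False by (intro sum.reindex_bij_witness[of _ ?t ?t]) auto
  then have "sum ?f (Pow I) + sum ?f (Pow I) = 0" by (simp add: sum_negf)
  then have "2 * sum ?f (Pow I) = 0" by (simp only: mult_2)
  then show ?thesis using False by simp
qed

definition head :: "nat \<Rightarrow> (nat \<Rightarrow> 'k::zero) \<Rightarrow> nat \<Rightarrow> 'k" where
  "head b x = (\<lambda>n. if n < b then x n else 0)"

definition tail :: "nat \<Rightarrow> (nat \<Rightarrow> 'k::zero) \<Rightarrow> nat \<Rightarrow> 'k" where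
  "tail b x = (\<lambda>n. if n < b then 0 else x n)"

lemma head_plus_tail: "head b x + tail b x = (x :: nat \<Rightarrow> 'k::monoid_add)"
  by (auto simp: head_def tail_def)

text \<open>
  The features of the Schreier and Baernstein norms on which the argument rests. In the last estimate a Schreier set
  that meets \<open>{..d}\<close> has at most \<open>d\<close> elements, so it collects at most \<open>d \<delta>\<close> from \<open>y\<close>; all others see only \<open>y\<close>.
\<close>

locale schreier_type = sup_norm nrm I q
  for nrm :: "(nat \<Rightarrow> 'k::{real_normed_field,banach}) \<Rightarrow> ennreal" and I :: "'i set" and q +
  fixes s P :: real
  assumes s_ge_1: "1 \<le> s" and s_less_P: "s < P"
    and nrm_mono: "(\<And>n. norm (x n) \<le> norm (y n)) \<Longrightarrow> nrm x \<le> nrm y"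
    and nrm_unit: "nrm (unit_vec n) \<le> 1"
    and schreier_lower: "F \<in> schreier \<Longrightarrow> nrm x \<le> ennreal B \<Longrightarrow> 0 \<le> B \<Longrightarrow>
          (\<Sum>n\<in>F. norm (x n) powr s) powr (1 / s) \<le> B"
    and weight_upper: "finite A \<Longrightarrow> (\<And>n. 0 \<le> w n) \<Longrightarrow> (\<And>n. n \<notin> A \<Longrightarrow> w n = 0) \<Longrightarrow>
          (\<And>F. F \<in> schreier \<Longrightarrow> sum w F \<le> 2) \<Longrightarrow> 1 \<le> sum w A \<Longrightarrow>
          nrm (\<lambda>n. of_real (w n powr (1 / s))) \<le> ennreal (2 * sum w A powr (1 / P))"
    and split_upper: "nrm z \<le> ennreal C \<Longrightarrow> nrm y \<le> ennreal D \<Longrightarrow> 0 \<le> C \<Longrightarrow> 0 \<le> D \<Longrightarrow>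
          (\<And>n. (d :: nat) < n \<Longrightarrow> z n = 0) \<Longrightarrow> (\<And>n. n \<le> d \<Longrightarrow> y n = 0) \<Longrightarrow> (\<And>n. norm (y n) \<le> \<delta>) \<Longrightarrow>
          nrm (z + y) \<le> ennreal ((C powr P + D powr P) powr (1 / P) + d * \<delta>)"
begin

lemma nrm_sum: "nrm (\<Sum>i\<in>A. f i) \<le> (\<Sum>i\<in>A. nrm (f i))"
proof (induction A rule: infinite_finite_induct)
  case (insert a A)
  then show ?case
    using order_trans[OF nrm_add[of "f a" "\<Sum>i\<in>A. f i"] add_left_mono[OF insert.IH]]
    by (simp only: sum.insert[OF insert.hyps])
qed (simp_all only: sum.infinite sum.empty nrm_zero order_refl not_False_eq_True)

lemma coord_bound: "nrm x \<le> ennreal B \<Longrightarrow> 0 \<le> B \<Longrightarrow> 1 \<le> n \<Longrightarrow> norm (x n) \<le> B"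
  using schreier_lower[of "{n}" x B] schreier_singleton[of n] s_ge_1 by (simp add: powr_powr)

lemma nrm_head_le: "nrm (head b x) \<le> nrm x"
  by (rule nrm_mono) (simp add: head_def)

lemma nrm_tail_le: "nrm (tail b x) \<le> nrm x"
  by (rule nrm_mono) (simp add: tail_def)

lemma nrm_tail_antimono: "b \<le> c \<Longrightarrow> nrm (tail c x) \<le> nrm (tail b x)"
  by (rule nrm_mono) (simp add: tail_def)

text \<open>
  The norm is a supremum of seminorms that are continuous under coordinatewise convergence.
\<close>

lemma nrm_le_of_heads:
  assumes "0 \<le> B" "\<And>b. nrm (head b x) \<le> ennreal B"
  shows "nrm x \<le> ennreal B"
proof -
  have "q i x \<le> B" if i: "i \<in> I" for i
  proof (rule LIMSEQ_le_const2)
    have "(\<lambda>b. head b x n) \<longlonglongrightarrow> x n" for n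
      by (rule tendsto_eventually, rule eventually_sequentiallyI[of "Suc n"]) (simp add: head_def)
    then show "(\<lambda>b. q i (head b x)) \<longlonglongrightarrow> q i x" by (rule q_tendsto[OF i])
    show "\<exists>N. \<forall>b\<ge>N. q i (head b x) \<le> B"
      using assms(2) i nrm_le_iff[OF assms(1)] by blast
  qed
  then show ?thesis by (simp add: nrm_le_iff[OF assms(1)])
qed

text \<open>
  Let \<open>D\<^sub>\<epsilon>\<close> change the signs of the coordinates \<open>n\<close> by \<open>\<epsilon>(n)\<close>, and those of the coefficients \<open>m\<close> by \<open>\<epsilon>(\<sigma>(m))\<close>.
  Conjugating the operator that sends \<open>\<alpha>\<close> to \<open>\<Sum>m. \<alpha> m u\<^sub>m\<close> by these isometries and averaging over all signs keeps
  exactly the entries \<open>u\<^sub>m(n)\<close> with \<open>\<sigma>(m) = n\<close>, and an average of vectors of norm at most \<open>B\<close> has norm at most \<open>B\<close>.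
\<close>

lemma diagonal_bound:
  assumes G: "finite G" and B: "0 \<le> B"
    and bound: "\<And>\<beta>. (\<And>m. m \<in> G \<Longrightarrow> norm (\<beta> m) \<le> norm (\<alpha> m)) \<Longrightarrow>
                   nrm (\<Sum>m\<in>G. seq_scale (\<beta> m) (u m)) \<le> ennreal B"
  shows "nrm (\<lambda>n. \<Sum>m\<in>{m\<in>G. \<sigma> m = n}. \<alpha> m * u m n) \<le> ennreal B"
proof -
  \<comment> \<open>a sign pattern is encoded by the set \<open>H\<close> of coordinates in \<open>J\<close> whose sign changes\<close>
  define J where "J = \<sigma> ` G"
  define \<epsilon> where "\<epsilon> H n = (if n \<in> H then - 1 else (1::'k))" for H :: "nat set" and n :: nat
  define z where "z H = (\<Sum>m\<in>G. seq_scale (\<epsilon> H (\<sigma> m) * \<alpha> m) (u m))" for H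
  define z' where "z' H = (\<lambda>n. \<epsilon> H n * z H n)" for H
  have norm_\<epsilon>: "norm (\<epsilon> H n) = 1" for H n by (simp add: \<epsilon>_def)
  have finJ: "finite J" using G by (simp add: J_def)
  have "nrm (z' H) \<le> ennreal B" for H
  proof -
    have "nrm (z' H) \<le> nrm (z H)" by (rule nrm_mono) (simp add: z'_def norm_mult norm_\<epsilon>)
    also have "\<dots> \<le> ennreal B" unfolding z_def by (rule bound) (simp add: norm_mult norm_\<epsilon>)
    finally show ?thesis .
  qed
  then have "nrm (\<Sum>H\<in>Pow J. z' H) \<le> (\<Sum>H\<in>Pow J. ennreal B)"
    by (intro order_trans[OF nrm_sum] sum_mono) auto
  also have "\<dots> = ennreal (2 ^ card J * B)"
    using finJ B by (simp add: card_Pow ennreal_mult'' ennreal_power flip: ennreal_numeral)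
  finally have sum_le: "nrm (\<Sum>H\<in>Pow J. z' H) \<le> ennreal (2 ^ card J * B)" .
  have "(\<lambda>n. \<Sum>m\<in>{m\<in>G. \<sigma> m = n}. \<alpha> m * u m n) = seq_scale (1 / 2 ^ card J) (\<Sum>H\<in>Pow J. z' H)"
  proof
    fix n
    have "(\<Sum>H\<in>Pow J. z' H) n = (\<Sum>H\<in>Pow J. \<Sum>m\<in>G. (\<epsilon> H (\<sigma> m) * \<epsilon> H n) * (\<alpha> m * u m n))"
      by (simp add: sum_fun_apply z'_def z_def seq_scale_def sum_distrib_left mult_ac)
    also have "\<dots> = (\<Sum>m\<in>G. (\<Sum>H\<in>Pow J. \<epsilon> H (\<sigma> m) * \<epsilon> H n) * (\<alpha> m * u m n))"
      by (subst sum.swap) (simp add: sum_distrib_right)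
    also have "\<dots> = (\<Sum>m\<in>G. (if n = \<sigma> m then 2 ^ card J else 0) * (\<alpha> m * u m n))"
      unfolding \<epsilon>_def using finJ by (intro sum.cong arg_cong2[where f = "(*)"] refl sum_Pow_sign) (auto simp: J_def)
    also have "\<dots> = (\<Sum>m\<in>{m\<in>G. \<sigma> m = n}. 2 ^ card J * (\<alpha> m * u m n))"
      using G by (intro sum.mono_neutral_cong_right) auto
    finally show "(\<Sum>m\<in>{m\<in>G. \<sigma> m = n}. \<alpha> m * u m n) = seq_scale (1 / 2 ^ card J) (\<Sum>H\<in>Pow J. z' H) n"
      by (simp add: seq_scale_def sum_divide_distrib)
  qed
  then have "nrm (\<lambda>n. \<Sum>m\<in>{m\<in>G. \<sigma> m = n}. \<alpha> m * u m n)
      = ennreal (1 / 2 ^ card J) * nrm (\<Sum>H\<in>Pow J. z' H)"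
    by (simp only: nrm_scale norm_divide norm_one norm_power norm_numeral)
  also have "\<dots> \<le> ennreal (1 / 2 ^ card J) * ennreal (2 ^ card J * B)"
    using sum_le by (rule mult_left_mono) simp
  also have "\<dots> = ennreal B" using B by (simp flip: ennreal_mult)
  finally show ?thesis .
qed

text \<open>
  The closed span of the unit vectors indexed by \<open>M\<close>, described by coordinates; see \<open>unit_subspace_eq\<close>.
\<close>

definition tail_null :: "nat set \<Rightarrow> (nat \<Rightarrow> 'k) set" where
  "tail_null M = {x. (\<forall>n. n \<notin> M \<longrightarrow> x n = 0) \<and> nrm x < \<infinity> \<and> (\<forall>e>0. \<exists>b. nrm (tail b x) \<le> ennreal e)}"

lemma tail_null_add:
  assumes "x \<in> tail_null M" "y \<in> tail_null M"
  shows "x + y \<in> tail_null M"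
proof -
  have "nrm (x + y) < \<infinity>"
    using nrm_add[of x y] assms by (auto simp: tail_null_def intro: le_less_trans)
  moreover have "\<exists>b. nrm (tail b (x + y)) \<le> ennreal e" if e: "e > 0" for e
  proof -
    obtain b c where "nrm (tail b x) \<le> ennreal (e / 2)" "nrm (tail c y) \<le> ennreal (e / 2)"
      using assms e unfolding tail_null_def mem_Collect_eq by (meson half_gt_zero)
    then have "nrm (tail (max b c) x) \<le> ennreal (e / 2)" "nrm (tail (max b c) y) \<le> ennreal (e / 2)"
      using nrm_tail_antimono[of b "max b c" x] nrm_tail_antimono[of c "max b c" y] by auto
    then have "nrm (tail (max b c) x + tail (max b c) y) \<le> ennreal (e / 2) + ennreal (e / 2)"
      by (intro order_trans[OF nrm_add] add_mono)
    moreover have "tail (max b c) x + tail (max b c) y = tail (max b c) (x + y)" 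
      by (auto simp: tail_def)
    ultimately show ?thesis using e by (metis ennreal_plus field_sum_of_halves half_gt_zero less_imp_le)
  qed
  ultimately show ?thesis using assms by (auto simp: tail_null_def)
qed

lemma tail_null_scale:
  assumes "x \<in> tail_null M"
  shows "seq_scale c x \<in> tail_null M"
proof -
  have "\<exists>b. nrm (tail b (seq_scale c x)) \<le> ennreal e" if e: "e > 0" for e
  proof -
    obtain b where b: "nrm (tail b x) \<le> ennreal (e / (norm c + 1))"
      using assms e unfolding tail_null_def mem_Collect_eq
      by (metis add_nonneg_pos divide_pos_pos norm_ge_zero zero_less_one)
    have "tail b (seq_scale c x) = seq_scale c (tail b x)" by (auto simp: tail_def seq_scale_def)
    then have "nrm (tail b (seq_scale c x)) \<le> ennreal (norm c) * ennreal (e / (norm c + 1))"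
      using b by (simp add: nrm_scale mult_left_mono)
    also have "\<dots> = ennreal (norm c * e / (norm c + 1))"
      using e by (simp flip: ennreal_mult)
    also have "\<dots> \<le> ennreal e"
      using e by (intro ennreal_leI) (simp add: divide_simps add_nonneg_pos distrib_left mult.commute)
    finally show ?thesis by blast
  qed
  moreover have "nrm (seq_scale c x) < \<infinity>"
    using assms by (auto simp: tail_null_def nrm_scale ennreal_mult_less_top)
  ultimately show ?thesis using assms by (auto simp: tail_null_def seq_scale_def)
qed

lemma tail_null_finite:
  assumes "\<And>n. n \<notin> M \<Longrightarrow> x n = 0" "x 0 = 0" "finite {n. x n \<noteq> 0}"
  shows "x \<in> tail_null M"
proof -
  have "x \<in> c00" using assms by (simp add: c00_def)
  then have "nrm x < \<infinity>" using c00_subset by (auto simp: finite_norm_def)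
  moreover have "tail (Suc (Max {n. x n \<noteq> 0})) x = 0"
  proof
    fix n
    have "x n = 0" if "\<not> n < Suc (Max {n. x n \<noteq> 0})"
      using that Max_ge[OF assms(3), of n] by fastforce
    then show "tail (Suc (Max {n. x n \<noteq> 0})) x n = 0 n" by (simp add: tail_def)
  qed
  ultimately show ?thesis using assms(1) nrm_zero by (auto simp: tail_null_def intro!: exI[of _ "Suc (Max {n. x n \<noteq> 0})"])
qed

lemma tail_null_zero: "0 \<in> tail_null M"
  by (rule tail_null_finite) auto

lemma tail_null_unit: "m \<in> M \<Longrightarrow> 1 \<le> m \<Longrightarrow> unit_vec m \<in> tail_null M"
  by (rule tail_null_finite) (auto simp: unit_vec_def)

lemma tail_null_sum: "(\<And>i. i \<in> A \<Longrightarrow> f i \<in> tail_null M) \<Longrightarrow> (\<Sum>i\<in>A. f i) \<in> tail_null M"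
  by (induction A rule: infinite_finite_induct) (auto simp: tail_null_zero tail_null_add)

lemma tail_null_head:
  assumes "x \<in> tail_null M" "M \<subseteq> {1..}"
  shows "head b x \<in> tail_null M"
proof (rule tail_null_finite)
  show "finite {n. head b x n \<noteq> 0}" by (rule finite_subset[of _ "{..<b}"]) (auto simp: head_def)
qed (use assms in \<open>auto simp: head_def tail_null_def\<close>)

lemma tail_null_uminus: "x \<in> tail_null M \<Longrightarrow> - x \<in> tail_null M"
  using tail_null_scale[of x M "- 1"] by (simp add: seq_scale_def fun_Compl_def)

lemma tail_null_diff: "x \<in> tail_null M \<Longrightarrow> y \<in> tail_null M \<Longrightarrow> x - y \<in> tail_null M"
  using tail_null_add[of x M "- y"] tail_null_uminus[of y] by simp

lemma tail_null_tail:
  assumes "x \<in> tail_null M" "M \<subseteq> {1..}"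
  shows "tail b x \<in> tail_null M"
proof -
  have "tail b x = x - head b x" by (auto simp: tail_def head_def)
  then show ?thesis using tail_null_diff tail_null_head assms by simp
qed

lemma tail_nullD: "x \<in> tail_null M \<Longrightarrow> n \<notin> M \<Longrightarrow> x n = 0"
  by (simp add: tail_null_def)

lemma head_eq_sum:
  fixes x :: "nat \<Rightarrow> 'k"
  assumes "\<And>n. n \<notin> M \<Longrightarrow> x n = 0"
  shows "head b x = (\<Sum>n\<in>{n\<in>M. n < b}. seq_scale (x n) (unit_vec n))"
proof
  fix k
  have "(\<Sum>n\<in>{n\<in>M. n < b}. seq_scale (x n) (unit_vec n)) k = (\<Sum>n\<in>{n\<in>M. n < b}. if n = k then x k else 0)"
    unfolding sum_fun_apply by (intro sum.cong) (auto simp: seq_scale_def unit_vec_def)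
  then show "head b x k = (\<Sum>n\<in>{n\<in>M. n < b}. seq_scale (x n) (unit_vec n)) k"
    using assms by (auto simp: head_def)
qed

lemma span_unit_tail_null:
  assumes "M \<subseteq> {1..}"
  shows "seq.span (unit_vec ` M) \<subseteq> tail_null M \<inter> c00"
proof (rule seq.span_minimal)
  show "unit_vec ` M \<subseteq> tail_null M \<inter> c00" using assms
    by (auto simp: tail_null_unit) (auto simp: c00_def unit_vec_def)
  show "seq.subspace (tail_null M \<inter> c00)"
  proof (rule seq.subspaceI)
    fix x y :: "nat \<Rightarrow> 'k" assume "x \<in> tail_null M \<inter> c00" "y \<in> tail_null M \<inter> c00"
    moreover have "finite {n. x n + y n \<noteq> 0}" if "finite {n. x n \<noteq> 0}" "finite {n. y n \<noteq> 0}"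
      by (rule finite_subset[OF _ finite_UnI[OF that]]) auto
    ultimately show "x + y \<in> tail_null M \<inter> c00" by (simp add: tail_null_add c00_def)
  next
    fix c :: 'k and x assume "x \<in> tail_null M \<inter> c00"
    moreover have "finite {n. c * x n \<noteq> 0}" if "finite {n. x n \<noteq> 0}"
      by (rule finite_subset[OF _ that]) auto
    ultimately show "seq_scale c x \<in> tail_null M \<inter> c00"
      using tail_null_scale[of x M c] by (simp add: c00_def seq_scale_def)
  qed (simp add: tail_null_zero c00_def)
qed

text \<open>
  Heads of a sequence in \<open>tail_null M\<close> are finite combinations of unit vectors that converge to it; conversely
  vanishing tails pass to limits in norm, because cutting off a head does not increase the norm.
\<close>

lemma unit_subspace_eq:
  assumes "M \<subseteq> {1..}"
  shows "unit_subspace nrm M = tail_null M"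
proof -
  interpret X: Metric_space "finite_norm nrm" "norm_dist nrm" by (rule metric)
  interpret Y: Metric_space "completion nrm" "norm_dist nrm" by (rule completion_space)
  have closure_Y: "unit_subspace nrm M = {x \<in> completion nrm. \<forall>r>0. \<exists>y\<in>seq.span (unit_vec ` M). y \<in> Y.mball x r}"
    by (simp add: unit_subspace_def completion_space(3)[symmetric] Y.metric_closure_of)
  have closure_X: "completion nrm = {x \<in> finite_norm nrm. \<forall>r>0. \<exists>y\<in>c00. y \<in> X.mball x r}"
    by (simp add: completion_def norm_topology_def X.metric_closure_of)
  have close: "norm_dist nrm x y < r \<longleftrightarrow> nrm (x - y) < ennreal r"
    if "x \<in> finite_norm nrm" "y \<in> finite_norm nrm" "0 < r" for x y r
    using diff_mem[OF that(1,2)] that(3)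
    by (auto simp: norm_dist_def finite_norm_def enn2real_less_iff less_top[symmetric])
  show ?thesis
  proof (intro equalityI subsetI)
    fix x assume x: "x \<in> tail_null M"
    then have xfin: "x \<in> finite_norm nrm" using assms by (auto simp: tail_null_def finite_norm_def)
    have approx: "\<exists>b. head b x \<in> seq.span (unit_vec ` M) \<and> head b x \<in> c00 \<and> norm_dist nrm x (head b x) < r"
      if r: "r > 0" for r
    proof -
      obtain b where "nrm (tail b x) \<le> ennreal (r / 2)"
        using x r unfolding tail_null_def mem_Collect_eq by (meson half_gt_zero)
      moreover have "x - head b x = tail b x" by (auto simp: tail_def head_def)
      ultimately have "nrm (x - head b x) < ennreal r"
        using r by (simp add: ennreal_lessI order.strict_trans1)
      moreover
      have "head b x = (\<Sum>n\<in>{n\<in>M. n < b}. seq_scale (x n) (unit_vec n))"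
        by (rule head_eq_sum) (rule tail_nullD[OF x])
      then have sp: "head b x \<in> seq.span (unit_vec ` M)"
        by (simp only:) (intro seq.span_sum seq.span_scale seq.span_base, auto)
      moreover have "head b x \<in> c00" using sp span_unit_tail_null[OF assms] by blast
      ultimately show ?thesis using close[OF xfin _ r, of "head b x"] c00_subset by blast
    qed
    have "x \<in> completion nrm"
      unfolding closure_X using approx xfin c00_subset by (fastforce simp: X.in_mball)
    then show "x \<in> unit_subspace nrm M"
      unfolding closure_Y using approx completion_space(4) by (fastforce simp: Y.in_mball)
  next
    fix x assume "x \<in> unit_subspace nrm M"
    then have xc: "x \<in> completion nrm" and
      near: "\<And>r. r > 0 \<Longrightarrow> \<exists>y\<in>seq.span (unit_vec ` M). norm_dist nrm x y < r"
      unfolding closure_Y by (auto simp: Y.in_mball)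
    have xfin: "x \<in> finite_norm nrm" using xc closure_X by blast
    have near': "\<exists>y\<in>tail_null M. nrm (x - y) < ennreal r" if r: "r > 0" for r
    proof -
      obtain y where "y \<in> seq.span (unit_vec ` M)" "norm_dist nrm x y < r" using near[OF r] by blast
      moreover from this have "y \<in> tail_null M" "y \<in> c00" using span_unit_tail_null[OF assms] by auto
      ultimately show ?thesis using close[OF xfin _ r, of y] c00_subset by blast
    qed
    have "x n = 0" if n: "n \<notin> M" for n
    proof (cases "n = 0")
      case True then show ?thesis using xfin by (simp add: finite_norm_def)
    next
      case False
      have "norm (x n) \<le> r" if r: "r > 0" for r
      proof -
        obtain y where y: "y \<in> tail_null M" "nrm (x - y) < ennreal r" using near'[OF r] by blast
        then have "norm ((x - y) n) \<le> r"
          using False r by (intro coord_bound[OF less_imp_le]) (assumption, simp_all)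
        then show ?thesis using y n by (simp add: tail_null_def)
      qed
      then show ?thesis by (metis dense_ge norm_le_zero_iff)
    qed
    moreover have "\<exists>b. nrm (tail b x) \<le> ennreal e" if e: "e > 0" for e
    proof -
      obtain y where y: "y \<in> tail_null M" "nrm (x - y) < ennreal (e / 2)"
        using near'[of "e / 2"] e by auto
      obtain b where b: "nrm (tail b y) \<le> ennreal (e / 2)"
        using y e unfolding tail_null_def mem_Collect_eq by (meson half_gt_zero)
      have "tail b x = tail b (x - y) + tail b y" by (auto simp: tail_def)
      then have "nrm (tail b x) \<le> nrm (tail b (x - y)) + nrm (tail b y)" using nrm_add by simp
      also have "\<dots> \<le> ennreal (e / 2) + ennreal (e / 2)"
        using b y nrm_tail_le[of b "x - y"] by (intro add_mono) auto
      finally show ?thesis using e by (metis ennreal_plus field_sum_of_halves half_gt_zero less_imp_le)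
    qed
    ultimately show "x \<in> tail_null M" using xfin by (auto simp: tail_null_def finite_norm_def)
  qed
qed

end

section \<open>Bounded operators and isomorphisms\<close>

context schreier_type
begin

definition bounded_op :: "nat set \<Rightarrow> nat set \<Rightarrow> real \<Rightarrow> ((nat \<Rightarrow> 'k) \<Rightarrow> nat \<Rightarrow> 'k) \<Rightarrow> bool" where
  "bounded_op M N C T \<longleftrightarrow> 0 \<le> C \<and> (\<forall>x\<in>tail_null M. T x \<in> tail_null N \<and> nrm (T x) \<le> ennreal C * nrm x) \<and>
     (\<forall>x\<in>tail_null M. \<forall>y\<in>tail_null M. T (x + y) = T x + T y) \<and>
     (\<forall>c. \<forall>x\<in>tail_null M. T (seq_scale c x) = seq_scale c (T x))"

lemma bounded_opD:
  assumes "bounded_op M N C T"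
  shows "0 \<le> C" "x \<in> tail_null M \<Longrightarrow> T x \<in> tail_null N"
    "x \<in> tail_null M \<Longrightarrow> y \<in> tail_null M \<Longrightarrow> T (x + y) = T x + T y"
    "x \<in> tail_null M \<Longrightarrow> T (seq_scale c x) = seq_scale c (T x)"
  using assms unfolding bounded_op_def by blast+

lemma bounded_op_bound:
  assumes "bounded_op M N C T" "x \<in> tail_null M" "nrm x \<le> ennreal B" "0 \<le> B"
  shows "nrm (T x) \<le> ennreal (C * B)"
proof -
  have "nrm (T x) \<le> ennreal C * nrm x" using assms by (simp add: bounded_op_def)
  also have "\<dots> \<le> ennreal C * ennreal B" using assms(3) by (rule mult_left_mono) simp
  finally show ?thesis using assms by (simp add: bounded_op_def ennreal_mult)
qed

lemma bounded_op_zero: "bounded_op M N C T \<Longrightarrow> T 0 = 0"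
proof -
  assume T: "bounded_op M N C T"
  then have "T (seq_scale 0 0) = seq_scale 0 (T 0)" using tail_null_zero by (rule bounded_opD)
  then show ?thesis by (simp only: seq.scale_zero_left)
qed

lemma bounded_op_sum:
  assumes T: "bounded_op M N C T" and x: "\<And>i. i \<in> A \<Longrightarrow> x i \<in> tail_null M"
  shows "T (\<Sum>i\<in>A. seq_scale (c i) (x i)) = (\<Sum>i\<in>A. seq_scale (c i) (T (x i)))"
  using x
proof (induction A rule: infinite_finite_induct)
  case (insert a A)
  have "T (seq_scale (c a) (x a) + (\<Sum>i\<in>A. seq_scale (c i) (x i)))
      = T (seq_scale (c a) (x a)) + T (\<Sum>i\<in>A. seq_scale (c i) (x i))"
    using insert.prems by (intro bounded_opD(3)[OF T] tail_null_sum tail_null_scale) auto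
  also have "T (seq_scale (c a) (x a)) = seq_scale (c a) (T (x a))"
    using insert.prems by (intro bounded_opD(4)[OF T]) auto
  also have "T (\<Sum>i\<in>A. seq_scale (c i) (x i)) = (\<Sum>i\<in>A. seq_scale (c i) (T (x i)))"
    using insert.prems by (intro insert.IH) auto
  finally show ?case by (simp only: sum.insert[OF insert.hyps])
qed (simp_all only: sum.infinite sum.empty bounded_op_zero[OF T] not_False_eq_True)

lemma tail_null_subset: "M \<subseteq> {1..} \<Longrightarrow> tail_null M \<subseteq> finite_norm nrm"
  by (auto simp: tail_null_def finite_norm_def)

lemma metric_tail_null:
  assumes "M \<subseteq> {1..}"
  shows "Metric_space (tail_null M) (norm_dist nrm)"
    and "subtopology (space_topology nrm) (tail_null M) = Metric_space.mtopology (tail_null M) (norm_dist nrm)"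
proof -
  interpret X: Metric_space "finite_norm nrm" "norm_dist nrm" by (rule metric)
  interpret Y: Submetric "finite_norm nrm" "norm_dist nrm" "tail_null M"
    using tail_null_subset[OF assms] by unfold_locales
  interpret Z: Metric_space "completion nrm" "norm_dist nrm" by (rule completion_space)
  show "Metric_space (tail_null M) (norm_dist nrm)" by (rule Y.sub.Metric_space_axioms)
  have "tail_null M \<subseteq> completion nrm"
    unfolding unit_subspace_eq[OF assms, symmetric] unit_subspace_def completion_space(3)[symmetric]
    using closure_of_subset_topspace[of Z.mtopology] by simp
  then show "subtopology (space_topology nrm) (tail_null M) = Metric_space.mtopology (tail_null M) (norm_dist nrm)"
    by (simp add: Y.mtopology_submetric space_topology_def norm_topology_def subtopology_subtopology Int_absorb1)
qed

text \<open>
  The usual equivalence of continuity and boundedness for linear maps. Here the maps are linear only on the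
  subspace, and scaling by a real factor goes through the scalar field.
\<close>

lemma bounded_op_iff_continuous:
  assumes M: "M \<subseteq> {1..}" and N: "N \<subseteq> {1..}"
    and add: "\<And>x y. x \<in> tail_null M \<Longrightarrow> y \<in> tail_null M \<Longrightarrow> T (x + y) = T x + T y"
    and scale: "\<And>c x. x \<in> tail_null M \<Longrightarrow> T (seq_scale c x) = seq_scale c (T x)"
  shows "continuous_map (subtopology (space_topology nrm) (tail_null M))
           (subtopology (space_topology nrm) (tail_null N)) T \<longleftrightarrow> (\<exists>C. bounded_op M N C T)"
proof -
  interpret X: Metric_space "tail_null M" "norm_dist nrm" by (rule metric_tail_null[OF M])
  have cont_iff: "continuous_map (subtopology (space_topology nrm) (tail_null M))
           (subtopology (space_topology nrm) (tail_null N)) T \<longleftrightarrow>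
        T ` tail_null M \<subseteq> tail_null N \<and>
          (\<forall>a\<in>tail_null M. \<forall>\<epsilon>>0. \<exists>\<delta>>0. \<forall>x. x \<in> tail_null M \<and> norm_dist nrm a x < \<delta> \<longrightarrow> norm_dist nrm (T a) (T x) < \<epsilon>)"
    unfolding metric_tail_null(2)[OF M] metric_tail_null(2)[OF N]
    by (rule X.metric_continuous_map[OF metric_tail_null(1)[OF N]])
  have diff: "T (x - y) = T x - T y" if "x \<in> tail_null M" "y \<in> tail_null M" for x y
    using add[of "x - y" y] tail_null_diff[OF that] that by simp
  have T0: "T 0 = 0" using diff[of 0 0] tail_null_zero by simp
  have fin: "nrm x = ennreal (enn2real (nrm x))" if "x \<in> tail_null L" for x L
    using that by (simp add: tail_null_def)
  show ?thesis unfolding cont_iff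
  proof
    assume L: "T ` tail_null M \<subseteq> tail_null N \<and>
          (\<forall>a\<in>tail_null M. \<forall>\<epsilon>>0. \<exists>\<delta>>0. \<forall>x. x \<in> tail_null M \<and> norm_dist nrm a x < \<delta> \<longrightarrow> norm_dist nrm (T a) (T x) < \<epsilon>)"
    then obtain \<delta> where \<delta>: "\<delta> > 0" "\<And>x. x \<in> tail_null M \<Longrightarrow> norm_dist nrm 0 x < \<delta> \<Longrightarrow> norm_dist nrm (T 0) (T x) < 1"
      using tail_null_zero zero_less_one by metis
    have small: "enn2real (nrm (T x)) < 1" if "x \<in> tail_null M" "enn2real (nrm x) < \<delta>" for x
      using \<delta>(2)[OF that(1)] that(2) by (simp only: norm_dist_def T0 nrm_diff_commute[of 0] diff_zero)
    have "nrm (T x) \<le> ennreal (2 / \<delta>) * nrm x" if x: "x \<in> tail_null M" for x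
    proof (cases "enn2real (nrm x) = 0")
      case True
      then have "norm_dist nrm x 0 = 0" by (simp only: norm_dist_def diff_zero)
      then have "x = 0" using X.zero[OF x tail_null_zero] by blast
      then show ?thesis by (simp only: T0 nrm_zero) simp
    next
      case False
      define r where "r = enn2real (nrm x)"
      have r: "r > 0" using False enn2real_nonneg[of "nrm x"] by (simp add: r_def less_le)
      define c where "c = \<delta> / (2 * r)"
      have c: "c > 0" using r \<delta>(1) by (simp add: c_def)
      have sc: "nrm (seq_scale (of_real c) y) = ennreal (c * enn2real (nrm y))" if "y \<in> tail_null L" for y L
        using c by (subst nrm_scale, subst fin[OF that]) (simp add: ennreal_mult)
      have "enn2real (nrm (seq_scale (of_real c) x)) < \<delta>"
        unfolding sc[OF x] using c r \<delta>(1) by (simp add: c_def flip: r_def)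
      then have "enn2real (nrm (T (seq_scale (of_real c) x))) < 1"
        by (intro small tail_null_scale x)
      moreover have Tx: "T x \<in> tail_null N" using L x by blast
      ultimately have "c * enn2real (nrm (T x)) < 1"
        using c by (simp add: scale[OF x] sc[OF Tx])
      then have "enn2real (nrm (T x)) \<le> 2 / \<delta> * r"
        using r \<delta>(1) by (simp add: c_def field_simps)
      then have "ennreal (enn2real (nrm (T x))) \<le> ennreal (2 / \<delta>) * ennreal r"
        using \<delta>(1) r by (subst ennreal_mult[symmetric]) (auto intro: ennreal_leI)
      then show ?thesis using fin[OF Tx] fin[OF x] by (simp add: r_def)
    qed
    then have "bounded_op M N (2 / \<delta>) T"
      using L \<delta>(1) add scale by (auto simp: bounded_op_def)
    then show "\<exists>C. bounded_op M N C T" by blast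
  next
    assume "\<exists>C. bounded_op M N C T"
    then obtain C where C: "bounded_op M N C T" by blast
    then have into: "T x \<in> tail_null N" if "x \<in> tail_null M" for x
      using that by (rule bounded_opD)
    have C0: "0 \<le> C" using C by (rule bounded_opD)
    have lip: "norm_dist nrm (T a) (T x) \<le> C * norm_dist nrm a x" if "a \<in> tail_null M" "x \<in> tail_null M" for a x
    proof -
      have d: "a - x \<in> tail_null M" using tail_null_diff that by blast
      have "nrm (T (a - x)) \<le> ennreal (C * enn2real (nrm (a - x)))"
        using bounded_op_bound[OF C d, of "enn2real (nrm (a - x))"] fin[OF d] by simp
      then have "enn2real (nrm (T (a - x))) \<le> C * enn2real (nrm (a - x))"
        using C0 by (intro enn2real_leI) auto
      then show ?thesis by (simp only: norm_dist_def diff[OF that])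
    qed
    have "\<exists>\<delta>>0. \<forall>x. x \<in> tail_null M \<and> norm_dist nrm a x < \<delta> \<longrightarrow> norm_dist nrm (T a) (T x) < \<epsilon>"
      if "a \<in> tail_null M" "\<epsilon> > 0" for a \<epsilon>
    proof (intro exI[of _ "\<epsilon> / (C + 1)"] conjI allI impI)
      show "0 < \<epsilon> / (C + 1)" using that C0 by simp
      fix x assume x: "x \<in> tail_null M \<and> norm_dist nrm a x < \<epsilon> / (C + 1)"
      have "norm_dist nrm (T a) (T x) \<le> (C + 1) * norm_dist nrm a x"
        using lip[of a x] that x by (simp add: norm_dist_def distrib_right add_increasing2)
      also have "\<dots> < \<epsilon>" using x C0 by (simp add: field_simps)
      finally show "norm_dist nrm (T a) (T x) < \<epsilon>" .
    qed
    then show "T ` tail_null M \<subseteq> tail_null N \<and>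
          (\<forall>a\<in>tail_null M. \<forall>\<epsilon>>0. \<exists>\<delta>>0. \<forall>x. x \<in> tail_null M \<and> norm_dist nrm a x < \<delta> \<longrightarrow> norm_dist nrm (T a) (T x) < \<epsilon>)"
      using into by blast
  qed
qed

lemma bounded_op_mono: "bounded_op M N C T \<Longrightarrow> C \<le> D \<Longrightarrow> bounded_op M N D T"
  unfolding bounded_op_def by (auto intro: order_trans[OF _ mult_right_mono[OF ennreal_leI]])

lemma isomorphic_iff:
  assumes M: "M \<subseteq> {1..}" and N: "N \<subseteq> {1..}"
  shows "isomorphic_subspaces nrm (unit_subspace nrm M) (unit_subspace nrm N) \<longleftrightarrow>
    (\<exists>T S C. bounded_op M N C T \<and> bounded_op N M C S \<and>
       (\<forall>x\<in>tail_null M. S (T x) = x) \<and> (\<forall>y\<in>tail_null N. T (S y) = y))"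
proof -
  let ?X = "\<lambda>M. subtopology (space_topology nrm) (tail_null M)"
  have top: "topspace (?X L) = tail_null L" if "L \<subseteq> {1..}" for L
  proof -
    interpret X: Metric_space "tail_null L" "norm_dist nrm" by (rule metric_tail_null[OF that])
    show ?thesis unfolding metric_tail_null(2)[OF that] by simp
  qed
  show ?thesis
    unfolding isomorphic_subspaces_def unit_subspace_eq[OF M] unit_subspace_eq[OF N]
  proof
    assume "\<exists>T. (\<forall>x\<in>tail_null M. \<forall>y\<in>tail_null M. T (x + y) = T x + T y) \<and>
        (\<forall>c. \<forall>x\<in>tail_null M. T (seq_scale c x) = seq_scale c (T x)) \<and> homeomorphic_map (?X M) (?X N) T"
    then obtain T where add: "\<And>x y. x \<in> tail_null M \<Longrightarrow> y \<in> tail_null M \<Longrightarrow> T (x + y) = T x + T y"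
      and scale: "\<And>c x. x \<in> tail_null M \<Longrightarrow> T (seq_scale c x) = seq_scale c (T x)"
      and "homeomorphic_map (?X M) (?X N) T" by blast
    then obtain S where T: "continuous_map (?X M) (?X N) T" and S: "continuous_map (?X N) (?X M) S"
      and ST: "\<And>x. x \<in> tail_null M \<Longrightarrow> S (T x) = x" and TS: "\<And>y. y \<in> tail_null N \<Longrightarrow> T (S y) = y"
      unfolding homeomorphic_map_maps homeomorphic_maps_def top[OF M] top[OF N] by blast
    have intoS: "S y \<in> tail_null M" if "y \<in> tail_null N" for y
      using S that top[OF M] top[OF N] unfolding continuous_map_def by blast
    have addS: "S (x + y) = S x + S y" if "x \<in> tail_null N" "y \<in> tail_null N" for x y
      using ST[OF tail_null_add[OF intoS[OF that(1)] intoS[OF that(2)]]] that by (simp add: add intoS TS)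
    have scaleS: "S (seq_scale c x) = seq_scale c (S x)" if "x \<in> tail_null N" for c x
      using ST[OF tail_null_scale[OF intoS[OF that]]] that by (simp add: scale intoS TS)
    obtain C where "bounded_op M N C T" using T bounded_op_iff_continuous[OF M N add scale] by blast
    moreover obtain D where "bounded_op N M D S" using S bounded_op_iff_continuous[OF N M addS scaleS] by blast
    ultimately have "bounded_op M N (max C D) T" "bounded_op N M (max C D) S"
      by (auto intro: bounded_op_mono)
    then show "\<exists>T S C. bounded_op M N C T \<and> bounded_op N M C S \<and>
       (\<forall>x\<in>tail_null M. S (T x) = x) \<and> (\<forall>y\<in>tail_null N. T (S y) = y)" using ST TS by blast
  next
    assume "\<exists>T S C. bounded_op M N C T \<and> bounded_op N M C S \<and>
       (\<forall>x\<in>tail_null M. S (T x) = x) \<and> (\<forall>y\<in>tail_null N. T (S y) = y)"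
    then obtain T S C where T: "bounded_op M N C T" and S: "bounded_op N M C S"
      and inv: "\<forall>x\<in>tail_null M. S (T x) = x" "\<forall>y\<in>tail_null N. T (S y) = y" by blast
    have "continuous_map (?X M) (?X N) T"
      using T by (subst bounded_op_iff_continuous[OF M N]) (auto simp: bounded_op_def)
    moreover have "continuous_map (?X N) (?X M) S"
      using S by (subst bounded_op_iff_continuous[OF N M]) (auto simp: bounded_op_def)
    ultimately have "homeomorphic_map (?X M) (?X N) T"
      using inv unfolding homeomorphic_map_maps homeomorphic_maps_def top[OF M] top[OF N] by blast
    then show "\<exists>T. (\<forall>x\<in>tail_null M. \<forall>y\<in>tail_null M. T (x + y) = T x + T y) \<and>
        (\<forall>c. \<forall>x\<in>tail_null M. T (seq_scale c x) = seq_scale c (T x)) \<and> homeomorphic_map (?X M) (?X N) T"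
      using T unfolding bounded_op_def by blast
  qed
qed

section \<open>Sums of far and flat vectors\<close>

text \<open>
  If a supply of vectors of norm at most \<open>C\<close> contains arbitrarily far and arbitrarily flat ones, then \<open>r\<close> of them can be
  chosen whose signed sums have norm close to \<open>C r\<^bsup>1/P\<^esup>\<close>. They are picked one after another: the previous ones are cut
  off at some \<open>d\<close> beyond which they are negligible, and the next one lives beyond \<open>d\<close> and is so flat
  that the error \<open>d \<delta>\<close> is small too. The index \<open>m\<close> attached to each vector is carried along and kept distinct.
\<close>

lemma flat_vectors_sum:
  fixes C \<eta> :: real and Y :: "(nat \<times> (nat \<Rightarrow> 'k)) set" and r R :: nat
  assumes "0 \<le> C" "0 < \<eta>"
    and Y: "\<And>m y. (m, y) \<in> Y \<Longrightarrow> y \<in> tail_null N \<and> nrm y \<le> ennreal C"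
    and avail: "\<And>d \<delta>. \<delta> > 0 \<Longrightarrow> \<exists>m y. (m, y) \<in> Y \<and> d < m \<and> (\<forall>n\<le>d. y n = 0) \<and> (\<forall>n. norm (y n) \<le> \<delta>)"
  shows "\<exists>m y. (\<forall>i<r. (m i, y i) \<in> Y \<and> R \<le> m i) \<and> inj_on m {..<r} \<and>
    (\<forall>\<beta>. (\<forall>i<r. norm (\<beta> i) \<le> 1) \<longrightarrow>
       nrm (\<Sum>i<r. seq_scale (\<beta> i) (y i)) \<le> ennreal (C * real r powr (1 / P) + r * \<eta>))"
proof (induction r)
  case 0
  show ?case by (simp only: lessThan_0 sum.empty nrm_zero) simp
next
  case (Suc r)
  have P: "P > 1" using s_ge_1 s_less_P by simp
  obtain m y where my: "\<And>i. i < r \<Longrightarrow> (m i, y i) \<in> Y" "\<And>i. i < r \<Longrightarrow> R \<le> m i" "inj_on m {..<r}"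
    and bound: "\<And>\<beta>. (\<And>i. i < r \<Longrightarrow> norm (\<beta> i) \<le> 1) \<Longrightarrow>
       nrm (\<Sum>i<r. seq_scale (\<beta> i) (y i)) \<le> ennreal (C * real r powr (1 / P) + r * \<eta>)"
    using Suc.IH by blast
  define \<epsilon> where "\<epsilon> = \<eta> / (2 * (real r + 1))"
  have \<epsilon>: "\<epsilon> > 0" using assms(2) by (simp add: \<epsilon>_def)
  have "\<exists>b. nrm (tail b (y i)) \<le> ennreal \<epsilon>" if "i < r" for i
    using Y[OF my(1)[OF that]] \<epsilon> by (simp add: tail_null_def)
  then obtain b where b: "\<And>i. i < r \<Longrightarrow> nrm (tail (b i) (y i)) \<le> ennreal \<epsilon>" by metis
  \<comment> \<open>the sum serves as a common upper bound of the cut-off points, the used indices and \<open>R\<close>\<close>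
  define d where "d = (\<Sum>i<r. b i + m i) + R"
  have d: "b i \<le> d" "m i \<le> d" if "i < r" for i
    using member_le_sum[of i "{..<r}" "\<lambda>i. b i + m i"] that by (auto simp: d_def)
  \<comment> \<open>half of the additional error \<open>\<eta>\<close> goes to the tails, the other half to \<open>d \<delta>\<close>\<close>
  define \<delta> where "\<delta> = \<eta> / (2 * (real d + 1))"
  have \<delta>: "\<delta> > 0" "d * \<delta> \<le> \<eta> / 2" using assms(2) by (auto simp: \<delta>_def divide_simps)
  obtain m' y' where y': "(m', y') \<in> Y" "d < m'" "\<And>n. n \<le> d \<Longrightarrow> y' n = 0" "\<And>n. norm (y' n) \<le> \<delta>"
    using avail[OF \<delta>(1), of d] by blast
  define m2 where "m2 = m(r := m')"
  define y2 where "y2 = y(r := y')"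
  have "inj_on m2 {..<Suc r}"
    using my(3) d(2) y'(2) by (auto simp: m2_def inj_on_def lessThan_Suc) (metis leD)+
  moreover have "(m2 i, y2 i) \<in> Y" "R \<le> m2 i" if "i < Suc r" for i
    using my y'(1,2) that by (auto simp: m2_def y2_def less_Suc_eq d_def)
  moreover have "nrm (\<Sum>i<Suc r. seq_scale (\<beta> i) (y2 i)) \<le> ennreal (C * real (Suc r) powr (1 / P) + Suc r * \<eta>)"
    if \<beta>: "\<And>i. i < Suc r \<Longrightarrow> norm (\<beta> i) \<le> 1" for \<beta>
  proof -
    define x where "x = (\<Sum>i<r. seq_scale (\<beta> i) (y i))"
    define v where "v = seq_scale (\<beta> r) y'"
    define K where "K = C * real r powr (1 / P) + r * \<eta>"
    have K: "0 \<le> K" using assms by (simp add: K_def)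
    have "nrm x \<le> ennreal K" unfolding x_def K_def using \<beta> by (intro bound) auto
    then have head_x: "nrm (head (Suc d) x) \<le> ennreal K" using nrm_head_le order_trans by blast
    have v_le: "norm (v n) \<le> norm (y' n)" for n
      using \<beta>[of r] by (simp add: v_def seq_scale_def norm_mult mult_left_le_one_le)
    then have v: "nrm v \<le> ennreal C" using nrm_mono[of v y'] Y[OF y'(1)] by (meson order_trans)
    have low: "head (Suc d) x n = 0" if "d < n" for n using that by (simp add: head_def)
    have high: "v n = 0" if "n \<le> d" for n using y'(3)[OF that] by (simp add: v_def seq_scale_def)
    have small: "norm (v n) \<le> \<delta>" for n using v_le y'(4) order_trans by blast
    have "nrm (head (Suc d) x + v) \<le> ennreal ((K powr P + C powr P) powr (1 / P) + d * \<delta>)"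
      by (rule split_upper[OF head_x v K assms(1) low high small])
    also have "\<dots> \<le> ennreal (C * real (Suc r) powr (1 / P) + r * \<eta> + \<eta> / 2)"
    proof (rule ennreal_leI, rule add_mono[OF _ \<delta>(2)])
      have "(K powr P + C powr P) powr (1 / P) \<le>
          ((C * real r powr (1 / P)) powr P + C powr P) powr (1 / P) + r * \<eta>"
        using minkowski_sum[of P "{0, 1 :: nat}" "\<lambda>i. if i = 0 then C * real r powr (1 / P) else C"
            "\<lambda>i. if i = 0 then r * \<eta> else 0"] P assms(1,2) by (simp add: K_def powr_powr)
      also have "(C * real r powr (1 / P)) powr P + C powr P = C powr P * real (Suc r)"
        using P assms(1) by (simp add: powr_mult powr_powr distrib_left)
      also have "\<dots> powr (1 / P) = C * real (Suc r) powr (1 / P)"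
        using P assms(1) by (simp add: powr_mult powr_powr)
      finally show "(K powr P + C powr P) powr (1 / P) \<le> C * real (Suc r) powr (1 / P) + r * \<eta>" .
    qed
    finally have 1: "nrm (head (Suc d) x + v) \<le> ennreal (C * real (Suc r) powr (1 / P) + r * \<eta> + \<eta> / 2)" .
    have "tail (Suc d) x = (\<Sum>i<r. tail (Suc d) (seq_scale (\<beta> i) (y i)))"
      by (rule ext) (simp add: x_def tail_def sum_fun_apply)
    then have "nrm (tail (Suc d) x) \<le> (\<Sum>i<r. nrm (tail (Suc d) (seq_scale (\<beta> i) (y i))))"
      using nrm_sum[of "\<lambda>i. tail (Suc d) (seq_scale (\<beta> i) (y i))" "{..<r}"] by (simp only:)
    also have "\<dots> \<le> (\<Sum>i<r. ennreal \<epsilon>)"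
    proof (rule sum_mono)
      fix i assume i: "i \<in> {..<r}"
      have "nrm (tail (Suc d) (seq_scale (\<beta> i) (y i))) \<le> nrm (tail (b i) (y i))"
        using d[of i] i \<beta>[of i]
        by (intro nrm_mono) (auto simp: tail_def seq_scale_def norm_mult mult_left_le_one_le)
      then show "nrm (tail (Suc d) (seq_scale (\<beta> i) (y i))) \<le> ennreal \<epsilon>" using b[of i] i by simp
    qed
    also have "\<dots> = ennreal (r * \<epsilon>)" using \<epsilon> by (simp add: ennreal_of_nat_eq_real_of_nat ennreal_mult)
    also have "\<dots> \<le> ennreal (\<eta> / 2)"
      using assms(2) by (intro ennreal_leI) (simp add: \<epsilon>_def divide_simps)
    finally have 2: "nrm (tail (Suc d) x) \<le> ennreal (\<eta> / 2)" .
    have "(\<Sum>i<Suc r. seq_scale (\<beta> i) (y2 i)) = x + v"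
      unfolding sum.lessThan_Suc by (auto simp: x_def v_def y2_def intro!: arg_cong2[where f = "(+)"] sum.cong)
    also have "\<dots> = (head (Suc d) x + v) + tail (Suc d) x"
      using head_plus_tail[of "Suc d" x] by (simp add: add_ac)
    finally have "nrm (\<Sum>i<Suc r. seq_scale (\<beta> i) (y2 i)) \<le> nrm (head (Suc d) x + v) + nrm (tail (Suc d) x)"
      using nrm_add by simp
    also have "\<dots> \<le> ennreal (C * real (Suc r) powr (1 / P) + r * \<eta> + \<eta> / 2) + ennreal (\<eta> / 2)"
      using 1 2 by (rule add_mono)
    also have "\<dots> = ennreal (C * real (Suc r) powr (1 / P) + Suc r * \<eta>)"
      using assms(1,2) by (subst ennreal_plus[symmetric]) (auto simp: algebra_simps)
    finally show ?thesis .
  qed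
  ultimately show ?case by (intro exI[of _ m2] exI[of _ y2]) blast
qed

end

section \<open>From isomorphisms to finite Gasparis--Leung indices\<close>

lemma nth_elem_mem: "infinite M \<Longrightarrow> nth_elem M j \<in> M"
  by (simp add: nth_elem_def enumerate_in_set)

lemma nth_elem_less: "infinite M \<Longrightarrow> 1 \<le> i \<Longrightarrow> i < j \<Longrightarrow> nth_elem M i < nth_elem M j"
  by (simp add: nth_elem_def)

lemma nth_elem_le_iff: "infinite M \<Longrightarrow> 1 \<le> i \<Longrightarrow> 1 \<le> j \<Longrightarrow> nth_elem M i \<le> nth_elem M j \<longleftrightarrow> i \<le> j"
  by (auto simp: nth_elem_def)

lemma nth_elem_less_iff: "infinite M \<Longrightarrow> 1 \<le> i \<Longrightarrow> 1 \<le> j \<Longrightarrow> nth_elem M i < nth_elem M j \<longleftrightarrow> i < j"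
  by (auto simp: nth_elem_def)

lemma inj_on_nth_elem: "infinite M \<Longrightarrow> inj_on (nth_elem M) {1..}"
  by (rule inj_onI) (metis atLeast_iff le_antisym nth_elem_le_iff order_refl)

lemma nth_elem_surj:
  assumes "infinite M" "n \<in> M"
  obtains j where "1 \<le> j" "nth_elem M j = n"
proof -
  obtain i where "enumerate M i = n" using enumerate_Ex assms by metis
  then show ?thesis using that[of "Suc i"] by (simp add: nth_elem_def)
qed

lemma le_nth_elem:
  assumes "infinite M" "M \<subseteq> {1..}" "1 \<le> j"
  shows "j \<le> nth_elem M j"
  using assms(3)
proof (induction j rule: nat_induct_at_least)
  case base
  then show ?case using nth_elem_mem[OF assms(1), of 1] assms(2) by auto
next
  case (Suc j)
  then show ?case using nth_elem_less[OF assms(1), of j "Suc j"] by simp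
qed

lemma card_below_nth_elem:
  assumes "infinite M" "1 \<le> j"
  shows "card {n\<in>M. n < nth_elem M j} = j - 1"
proof -
  have "{n\<in>M. n < nth_elem M j} = nth_elem M ` {1..<j}"
  proof (intro equalityI subsetI)
    fix n assume n: "n \<in> {n\<in>M. n < nth_elem M j}"
    then obtain i where i: "1 \<le> i" "nth_elem M i = n" using nth_elem_surj[OF assms(1)] by blast
    then have "i < j" using n nth_elem_less_iff[OF assms(1) i(1) assms(2)] by simp
    then show "n \<in> nth_elem M ` {1..<j}" using i by auto
  next
    fix n assume "n \<in> nth_elem M ` {1..<j}"
    then show "n \<in> {n\<in>M. n < nth_elem M j}" using nth_elem_mem nth_elem_less assms by auto
  qed
  moreover have "inj_on (nth_elem M) {1..<j}"
    using inj_on_nth_elem[OF assms(1)] by (rule inj_on_subset) auto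
  ultimately show ?thesis by (simp add: card_image)
qed

lemma GL_index_finiteI:
  assumes "\<And>J. J \<subseteq> {1..} \<Longrightarrow> finite J \<Longrightarrow> J \<noteq> {} \<Longrightarrow> nth_elem N ` J \<in> schreier \<Longrightarrow>
             schreier_cover (nth_elem M ` J) \<le> K"
  shows "GL_index M N \<noteq> \<infinity>"
proof -
  have "schreier_cover (nth_elem M ` J) \<le> K"
    if "J \<subseteq> {1..}" "finite J" "nth_elem N ` J \<in> schreier" for J
    using assms[of J] that by (cases "J = {}") (auto simp: schreier_cover_def)
  then have "GL_index M N \<le> enat K"
    unfolding GL_index_def by (intro SUP_least) auto
  then show ?thesis using enat_ile by force
qed

text \<open>
  Every upper bound obtained below has the smaller power \<open>1 / P\<close> and every lower bound the larger power \<open>1 / s\<close>.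
\<close>

lemma power_gap:
  fixes s P K :: real
  assumes "1 \<le> s" "s < P"
  obtains B where "\<And>W. 1 \<le> W \<Longrightarrow> W powr (1 / s) \<le> K * W powr (1 / P) \<Longrightarrow> W \<le> B"
proof
  define g where "g = 1 / s - 1 / P"
  have g: "g > 0" using assms by (simp add: g_def field_simps)
  fix W :: real assume W: "1 \<le> W" "W powr (1 / s) \<le> K * W powr (1 / P)"
  have "W powr g * W powr (1 / P) = W powr (1 / s)" by (simp add: g_def flip: powr_add)
  then have "W powr g * W powr (1 / P) \<le> K * W powr (1 / P)" using W(2) by simp
  then have "W powr g \<le> K" by (rule mult_right_le_imp_le) (use W(1) in simp)
  then have "(W powr g) powr (1 / g) \<le> K powr (1 / g)" using g by (intro powr_mono2) auto
  then show "W \<le> K powr (1 / g)" using g W by (simp add: powr_powr)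
qed

definition phase :: "'k::real_normed_field \<Rightarrow> 'k" where
  "phase z = (if z = 0 then 1 else of_real (norm z) / z)"

lemma norm_phase: "norm (phase z) = 1"
  by (simp add: phase_def norm_divide)

lemma phase_mult: "phase z * z = of_real (norm z)"
  by (simp add: phase_def)

text \<open>
  An isomorphism \<open>T\<close> with inverse \<open>S\<close>. The identity \<open>S T = id\<close> controls the index of \<open>M\<close> with
  respect to \<open>N\<close>; exchanging the roles of \<open>T\<close> and \<open>S\<close> gives the other index.
\<close>

locale isomorphism = schreier_type nrm I q s P
  for nrm :: "(nat \<Rightarrow> 'k::{real_normed_field,banach}) \<Rightarrow> ennreal" and I :: "'i set" and q s P +
  fixes M N :: "nat set" and C :: real and T S :: "(nat \<Rightarrow> 'k) \<Rightarrow> nat \<Rightarrow> 'k"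
  assumes M: "M \<subseteq> {1..}" and N: "N \<subseteq> {1..}"
    and T: "bounded_op M N C T" and S: "bounded_op N M C S"
    and ST: "x \<in> tail_null M \<Longrightarrow> S (T x) = x"
begin

lemma C_nonneg: "0 \<le> C" using bounded_opD(1)[OF T] .

lemma unit_M: "m \<in> M \<Longrightarrow> unit_vec m \<in> tail_null M" and unit_N: "n \<in> N \<Longrightarrow> unit_vec n \<in> tail_null N"
  using M N by (auto intro!: tail_null_unit)

lemma T_unit: "m \<in> M \<Longrightarrow> T (unit_vec m) \<in> tail_null N \<and> nrm (T (unit_vec m)) \<le> ennreal C"
  using bounded_opD(2)[OF T unit_M] bounded_op_bound[OF T unit_M, of m 1] nrm_unit[of m] by simp

lemma S_unit: "n \<in> N \<Longrightarrow> S (unit_vec n) \<in> tail_null M \<and> nrm (S (unit_vec n)) \<le> ennreal C"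
  using bounded_opD(2)[OF S unit_N] bounded_op_bound[OF S unit_N, of n 1] nrm_unit[of n] by simp

text \<open>
  Otherwise there are far and ever flatter tails \<open>y\<close> of images \<open>T e\<^sub>m\<close> with \<open>|(S y)(m)| \<ge> 1/2\<close>. Choose \<open>r\<close> of them by
  \<open>flat_vectors_sum\<close>, with distinct \<open>m \<ge> r\<close>. Their signed sums have norm of order \<open>r\<^bsup>1/P\<^esup>\<close>, hence so do the
  images under \<open>S\<close>, and by \<open>diagonal_bound\<close> so does the vector of the entries \<open>(S y)(m)\<close>. As these \<open>r\<close> positions form
  a Schreier set, that vector has norm at least \<open>r\<^bsup>1/s\<^esup> / 2\<close>, which is impossible for large \<open>r\<close>.
\<close>

lemma large_coordinate:
  "\<exists>\<delta>>0. \<exists>a. \<forall>b m. m \<in> M \<longrightarrow> a \<le> m \<longrightarrow> a \<le> b \<longrightarrow> 1 / 2 \<le> norm (S (tail b (T (unit_vec m))) m) \<longrightarrow>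
     (\<exists>n\<in>N. b \<le> n \<and> \<delta> \<le> norm (T (unit_vec m) n))"
proof (rule ccontr)
  assume contra: "\<not> ?thesis"
  define Y where "Y = {(m, y). m \<in> M \<and> (\<exists>b. y = tail b (T (unit_vec m))) \<and> 1 / 2 \<le> norm (S y m)}"
  have Y: "y \<in> tail_null N \<and> nrm y \<le> ennreal C" if my: "(m, y) \<in> Y" for m y
  proof -
    obtain b where "m \<in> M" "y = tail b (T (unit_vec m))" using my unfolding Y_def by blast
    then show ?thesis
      using T_unit[of m] tail_null_tail[OF _ N] nrm_tail_le[of b "T (unit_vec m)"] by (auto intro: order_trans)
  qed
  have avail: "\<exists>m y. (m, y) \<in> Y \<and> d < m \<and> (\<forall>n\<le>d. y n = 0) \<and> (\<forall>n. norm (y n) \<le> \<delta>)"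
    if \<delta>: "\<delta> > 0" for d :: nat and \<delta> :: real
  proof -
    obtain b m where bm: "m \<in> M" "Suc d \<le> m" "Suc d \<le> b" "1 / 2 \<le> norm (S (tail b (T (unit_vec m))) m)"
      "\<And>n. n \<in> N \<Longrightarrow> b \<le> n \<Longrightarrow> norm (T (unit_vec m) n) < \<delta>"
      using contra \<delta> by (meson not_less)
    have "T (unit_vec m) n = 0" if "n \<notin> N" for n
      using T_unit[OF bm(1)] that by (simp add: tail_null_def)
    then have "norm (tail b (T (unit_vec m)) n) \<le> \<delta>" for n
      using bm(5)[of n] \<delta> by (cases "n \<in> N") (auto simp: tail_def intro: less_imp_le)
    moreover have "tail b (T (unit_vec m)) n = 0" if "n \<le> d" for n
      using that bm(3) by (simp add: tail_def)
    ultimately show ?thesis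
      using bm by (intro exI[of _ m] exI[of _ "tail b (T (unit_vec m))"]) (auto simp: Y_def)
  qed
  have growth: "real r powr (1 / s) \<le> 2 * C * (C + 1) * real r powr (1 / P)" if r: "1 \<le> r" for r :: nat
  proof -
    define K where "K = C * real r powr (1 / P) + 1"
    have K: "0 \<le> K" using C_nonneg by (simp add: K_def)
    obtain m y where my: "\<And>i. i < r \<Longrightarrow> (m i, y i) \<in> Y" "\<And>i. i < r \<Longrightarrow> r \<le> m i" "inj_on m {..<r}"
      and sum_le: "\<And>\<beta>. (\<And>i. i < r \<Longrightarrow> norm (\<beta> i) \<le> 1) \<Longrightarrow> nrm (\<Sum>i<r. seq_scale (\<beta> i) (y i)) \<le> ennreal K"
    proof -
      have "\<exists>m y. (\<forall>i<r. (m i, y i) \<in> Y \<and> r \<le> m i) \<and> inj_on m {..<r} \<and>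
        (\<forall>\<beta>. (\<forall>i<r. norm (\<beta> i) \<le> 1) \<longrightarrow>
          nrm (\<Sum>i<r. seq_scale (\<beta> i) (y i)) \<le> ennreal (C * real r powr (1 / P) + r * (1 / r)))"
        by (rule flat_vectors_sum[OF C_nonneg _ Y avail]) (use r in auto)
      moreover have "C * real r powr (1 / P) + r * (1 / r) = K" using r by (simp add: K_def)
      ultimately show ?thesis using that by metis
    qed
    have yN: "y i \<in> tail_null N" if "i \<in> {..<r}" for i using Y my(1) that by blast
    define x where "x = (\<lambda>n. \<Sum>i\<in>{i\<in>{..<r}. m i = n}. 1 * S (y i) n)"
    have x_le: "nrm x \<le> ennreal (C * K)"
      unfolding x_def
    proof (rule diagonal_bound)
      fix \<beta> :: "nat \<Rightarrow> 'k" assume "\<And>i. i \<in> {..<r} \<Longrightarrow> norm (\<beta> i) \<le> norm (1 :: 'k)"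
      then have "nrm (S (\<Sum>i<r. seq_scale (\<beta> i) (y i))) \<le> ennreal (C * K)"
        using yN K by (intro bounded_op_bound[OF S] tail_null_sum tail_null_scale sum_le) auto
      then show "nrm (\<Sum>i<r. seq_scale (\<beta> i) (S (y i))) \<le> ennreal (C * K)"
        by (simp only: bounded_op_sum[OF S yN])
    qed (use C_nonneg K in auto)
    have "m ` {..<r} \<in> schreier"
      using r my(2) card_image_le[of "{..<r}" m] by (intro schreierI[of _ r]) auto
    then have "(\<Sum>n\<in>m ` {..<r}. norm (x n) powr s) powr (1 / s) \<le> C * K"
      using x_le C_nonneg K by (intro schreier_lower) auto
    moreover have "(\<Sum>n\<in>m ` {..<r}. norm (x n) powr s) \<ge> r * (1 / 2) powr s"
    proof -
      have half: "1 / 2 \<le> norm (x (m i))" if i: "i < r" for i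
      proof -
        have "{k\<in>{..<r}. m k = m i} = {i}" using my(3) i by (auto simp: inj_on_def)
        then have "x (m i) = S (y i) (m i)" by (simp only: x_def) simp
        then show ?thesis using my(1)[OF i] by (simp add: Y_def)
      qed
      have "(\<Sum>i<r. (1 / 2) powr s) \<le> (\<Sum>i<r. norm (x (m i)) powr s)"
        using half s_ge_1 by (intro sum_mono powr_mono2) auto
      then show ?thesis using my(3) by (simp add: sum.reindex)
    qed
    then have "(r * (1 / 2) powr s) powr (1 / s) \<le> (\<Sum>n\<in>m ` {..<r}. norm (x n) powr s) powr (1 / s)"
      using s_ge_1 by (intro powr_mono2) auto
    moreover have "(r * (1 / 2) powr s) powr (1 / s) = real r powr (1 / s) / 2"
      using s_ge_1 by (simp add: powr_mult powr_powr)
    moreover have "C * K \<le> C * (C + 1) * real r powr (1 / P)"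
    proof -
      have "1 \<le> real r powr (1 / P)" using r s_ge_1 s_less_P by (intro ge_one_powr_ge_zero) auto
      then have "K \<le> (C + 1) * real r powr (1 / P)" by (simp add: K_def distrib_right)
      then show ?thesis using C_nonneg by (simp add: mult.assoc mult_left_mono)
    qed
    ultimately show ?thesis by simp
  qed
  obtain B where B: "\<And>W. 1 \<le> W \<Longrightarrow> W powr (1 / s) \<le> 2 * C * (C + 1) * W powr (1 / P) \<Longrightarrow> W \<le> B"
    using power_gap[OF s_ge_1 s_less_P] by blast
  obtain r :: nat where "max 1 B < real r" using reals_Archimedean2 by blast
  then show False using B[of "real r"] growth[of r] by simp
qed

text \<open>
  Multiply the coordinates of \<open>S e\<^sub>n\<close> in \<open>G\<close> by scalars of modulus 1 that make every term of \<open>(T S e\<^sub>n)(n)\<close>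
  positive, and drop the other coordinates. The norm does not grow, and the coordinate \<open>n\<close> of the image under \<open>T\<close> is the
  sum in question.
\<close>

lemma coordinate_mass:
  assumes n: "n \<in> N" and G: "finite G" "G \<subseteq> M"
  shows "(\<Sum>m\<in>G. norm (T (unit_vec m) n) * norm (S (unit_vec n) m)) \<le> C * C"
proof -
  define c where "c m = phase (S (unit_vec n) m * T (unit_vec m) n) * S (unit_vec n) m" for m
  define x where "x = (\<Sum>m\<in>G. seq_scale (c m) (unit_vec m))"
  have "x k = (if k \<in> G then c k else 0)" for k
  proof -
    have "x k = (\<Sum>m\<in>G. if m = k then c k else 0)"
      unfolding x_def sum_fun_apply by (intro sum.cong) (auto simp: seq_scale_def unit_vec_def)
    then show ?thesis using G by simp
  qed
  then have "nrm x \<le> nrm (S (unit_vec n))"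
    by (intro nrm_mono) (simp add: c_def norm_mult norm_phase)
  then have "nrm x \<le> ennreal C" using S_unit[OF n] by auto
  moreover have xM: "x \<in> tail_null M"
    unfolding x_def using G unit_M by (intro tail_null_sum tail_null_scale) auto
  ultimately have "nrm (T x) \<le> ennreal (C * C)" by (intro bounded_op_bound[OF T] C_nonneg)
  then have "norm (T x n) \<le> C * C" using n N C_nonneg by (intro coord_bound) auto
  also have "T x n = of_real (\<Sum>m\<in>G. norm (T (unit_vec m) n) * norm (S (unit_vec n) m))"
  proof -
    have "T x = (\<Sum>m\<in>G. seq_scale (c m) (T (unit_vec m)))"
      unfolding x_def using G unit_M by (intro bounded_op_sum[OF T]) auto
    then have "T x n = (\<Sum>m\<in>G. phase (S (unit_vec n) m * T (unit_vec m) n) * (S (unit_vec n) m * T (unit_vec m) n))"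
      by (simp add: sum_fun_apply seq_scale_def c_def mult.assoc)
    also have "\<dots> = of_real (\<Sum>m\<in>G. norm (S (unit_vec n) m * T (unit_vec m) n))"
      by (simp only: phase_mult of_real_sum)
    finally show ?thesis by (simp only: norm_mult mult.commute)
  qed
  finally show ?thesis by (simp only: norm_of_real abs_of_nonneg sum_nonneg mult_nonneg_nonneg norm_ge_zero)
qed

text \<open>
  This bounds the number of \<open>m\<close> for which the coordinates of \<open>T e\<^sub>m\<close> below \<open>b\<close> account for at least half of
  \<open>(S T e\<^sub>m)(m) = 1\<close>.
\<close>

lemma head_mass:
  assumes G: "finite G" "G \<subseteq> M"
  shows "(\<Sum>m\<in>G. norm (S (head b (T (unit_vec m))) m)) \<le> C * C * card {n\<in>N. n < b}"
proof -
  have eq: "S (head b (T (unit_vec m))) = (\<Sum>n\<in>{n\<in>N. n < b}. seq_scale (T (unit_vec m) n) (S (unit_vec n)))"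
    if "m \<in> M" for m
  proof -
    have "T (unit_vec m) \<in> tail_null N" using T_unit[OF that] by simp
    then have "head b (T (unit_vec m)) = (\<Sum>n\<in>{n\<in>N. n < b}. seq_scale (T (unit_vec m) n) (unit_vec n))"
      by (intro head_eq_sum tail_nullD)
    then show ?thesis
      by (simp only:) (rule bounded_op_sum[OF S], use unit_N in auto)
  qed
  have "(\<Sum>m\<in>G. norm (S (head b (T (unit_vec m))) m))
      \<le> (\<Sum>m\<in>G. \<Sum>n\<in>{n\<in>N. n < b}. norm (T (unit_vec m) n) * norm (S (unit_vec n) m))"
  proof (rule sum_mono)
    fix m assume "m \<in> G"
    then have "m \<in> M" using G by blast
    show "norm (S (head b (T (unit_vec m))) m)
      \<le> (\<Sum>n\<in>{n\<in>N. n < b}. norm (T (unit_vec m) n) * norm (S (unit_vec n) m))"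
      unfolding eq[OF \<open>m \<in> M\<close>] sum_fun_apply seq_scale_def norm_mult[symmetric] by (rule norm_sum)
  qed
  also have "\<dots> = (\<Sum>n\<in>{n\<in>N. n < b}. \<Sum>m\<in>G. norm (T (unit_vec m) n) * norm (S (unit_vec n) m))"
    by (rule sum.swap)
  also have "\<dots> \<le> (\<Sum>n\<in>{n\<in>N. n < b}. C * C)" using coordinate_mass G by (intro sum_mono) auto
  finally show ?thesis by (simp add: mult.commute)
qed

text \<open>
  The heart of the argument. \<open>A\<close> stands for \<open>M(J)\<close> and \<open>b\<close> for the least element of the Schreier set \<open>N(J)\<close>: then \<open>A\<close>
  has at most \<open>b\<close> elements, and the number of elements of \<open>N\<close> below \<open>b\<close> is less than \<open>min J \<le> min A\<close>.
  The indices of \<open>A\<close> for which the tail of \<open>T e\<^sub>m\<close> matters are \<open>good\<close>; their weight \<open>W\<close> satisfies \<open>\<delta> W\<^bsup>1/s\<^esup> \<le> 2 C W\<^bsup>1/P\<^esup>\<close>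
  unless \<open>W < 1\<close>, and all others together have weight at most \<open>2 C\<^sup>2\<close>.
\<close>

lemma cover_bounded:
  "\<exists>K a. \<forall>A b. finite A \<longrightarrow> A \<noteq> {} \<longrightarrow> A \<subseteq> M \<longrightarrow> a \<le> Min A \<longrightarrow> a \<le> b \<longrightarrow> 1 \<le> b \<longrightarrow> card A \<le> b \<longrightarrow>
     card {n\<in>N. n < b} \<le> Min A \<longrightarrow> real (schreier_cover A) \<le> K"
proof -
  obtain \<delta> a where \<delta>: "\<delta> > 0" and large: "\<And>b m. m \<in> M \<Longrightarrow> a \<le> m \<Longrightarrow> a \<le> b \<Longrightarrow>
      1 / 2 \<le> norm (S (tail b (T (unit_vec m))) m) \<Longrightarrow> \<exists>n\<in>N. b \<le> n \<and> \<delta> \<le> norm (T (unit_vec m) n)"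
    using large_coordinate by blast
  obtain B where B: "\<And>W. 1 \<le> W \<Longrightarrow> W powr (1 / s) \<le> 2 * C / \<delta> * W powr (1 / P) \<Longrightarrow> W \<le> B"
    using power_gap[OF s_ge_1 s_less_P] by blast
  have "real (schreier_cover A) \<le> 1 + max 1 B + 2 * C * C"
    if A: "finite A" "A \<noteq> {}" "A \<subseteq> M" and ab: "a \<le> Min A" "a \<le> b" "1 \<le> b" "card A \<le> b"
      and below: "card {n\<in>N. n < b} \<le> Min A" for A b
  proof -
    have minA: "1 \<le> Min A" using A M by auto
    obtain w :: "nat \<Rightarrow> real" where w: "\<And>n. 0 \<le> w n" "\<And>n. n \<notin> A \<Longrightarrow> w n = 0" "\<And>n. w n \<le> 1 / Min A"
      "\<And>F. F \<in> schreier \<Longrightarrow> sum w F \<le> 2" "real (schreier_cover A) - 1 \<le> sum w A"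
      using greedy_weight[of A] A M by blast
    define good where "good = {m\<in>A. 1 / 2 \<le> norm (S (tail b (T (unit_vec m))) m)}"
    define W where "W = sum w good"
    have fin: "finite good" "good \<subseteq> A" using A by (auto simp: good_def)
    have "sum w (A - good) \<le> 2 * C * C"
    proof -
      have half: "1 / 2 \<le> norm (S (head b (T (unit_vec m))) m)" if m: "m \<in> A - good" for m
      proof -
        have mM: "m \<in> M" using m A by blast
        have u: "T (unit_vec m) \<in> tail_null N" using T_unit[OF mM] by simp
        have "unit_vec m = S (head b (T (unit_vec m)) + tail b (T (unit_vec m)))"
          by (simp only: head_plus_tail ST[OF unit_M[OF mM]])
        also have "\<dots> = S (head b (T (unit_vec m))) + S (tail b (T (unit_vec m)))"
          by (intro bounded_opD(3)[OF S] tail_null_head tail_null_tail u N)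
        finally have split: "unit_vec m = S (head b (T (unit_vec m))) + S (tail b (T (unit_vec m)))" .
        have "(1 :: 'k) = S (head b (T (unit_vec m))) m + S (tail b (T (unit_vec m))) m"
          using fun_cong[OF split, of m] by (simp only: plus_fun_apply) (simp only: unit_vec_def if_True simp_thms)
        then have "1 \<le> norm (S (head b (T (unit_vec m))) m) + norm (S (tail b (T (unit_vec m))) m)"
          by (metis norm_one norm_triangle_ineq)
        moreover have "norm (S (tail b (T (unit_vec m))) m) < 1 / 2" using m by (auto simp: good_def)
        ultimately show ?thesis by linarith
      qed
      have "card (A - good) * (1 / 2) \<le> (\<Sum>m\<in>A - good. norm (S (head b (T (unit_vec m))) m))"
        using half by (intro sum_bounded_below)
      also have "\<dots> \<le> C * C * card {n\<in>N. n < b}" using A by (intro head_mass) auto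
      also have "\<dots> \<le> C * C * Min A" using below C_nonneg by (intro mult_left_mono) auto
      finally have "real (card (A - good)) \<le> 2 * C * C * Min A" by simp
      moreover have "sum w (A - good) \<le> card (A - good) * (1 / Min A)"
        using w(3) by (intro sum_bounded_above)
      moreover have "card (A - good) * (1 / Min A) \<le> (2 * C * C * Min A) * (1 / real (Min A))"
        using calculation(1) by (rule mult_right_mono) simp
      ultimately have "sum w (A - good) \<le> (2 * C * C * Min A) * (1 / real (Min A))" by linarith
      then show ?thesis using minA by simp
    qed
    moreover have "sum w A = W + sum w (A - good)"
      using A fin unfolding W_def by (simp add: sum.subset_diff add.commute)
    moreover have "W \<le> max 1 B"
    proof (cases "1 \<le> W")
      case True
      define v where "v n = (if n \<in> good then w n else 0)" for n
      define \<sigma> where "\<sigma> m = (SOME n. n \<in> N \<and> b \<le> n \<and> \<delta> \<le> norm (T (unit_vec m) n))" for m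
      have \<sigma>: "\<sigma> m \<in> N" "b \<le> \<sigma> m" "\<delta> \<le> norm (T (unit_vec m) (\<sigma> m))" if m: "m \<in> good" for m
      proof -
        have "m \<in> M" "a \<le> m" using m fin A ab by auto
        then have "\<exists>n. n \<in> N \<and> b \<le> n \<and> \<delta> \<le> norm (T (unit_vec m) n)"
          using large[of m b] m ab by (auto simp: good_def)
        then have "\<sigma> m \<in> N \<and> b \<le> \<sigma> m \<and> \<delta> \<le> norm (T (unit_vec m) (\<sigma> m))"
          unfolding \<sigma>_def by (rule someI_ex)
        then show "\<sigma> m \<in> N" "b \<le> \<sigma> m" "\<delta> \<le> norm (T (unit_vec m) (\<sigma> m))" by auto
      qed
      have vW: "sum v good = W" by (simp add: v_def W_def)
      have v0: "0 \<le> v n" for n using w(1) by (simp add: v_def)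
      define h where "h n = v n powr (1 / s)" for n
      have h0: "0 \<le> h n" for n by (simp add: h_def)
      have "nrm (\<lambda>n. of_real (h n)) \<le> ennreal (2 * W powr (1 / P))"
        unfolding h_def vW[symmetric]
      proof (rule weight_upper)
        fix F assume F: "F \<in> schreier"
        have "sum v F \<le> sum w F" using w(1) by (intro sum_mono) (simp add: v_def)
        then show "sum v F \<le> 2" using w(4)[OF F] by simp
      qed (use v0 fin True vW in \<open>auto simp: v_def\<close>)
      note h_le = this
      \<comment> \<open>the phases make the entries meeting in one coordinate \<open>\<sigma> m\<close> add up without cancellation; there
        \<open>\<ell>\<^sub>1\<close> sums dominate the \<open>\<ell>\<^sub>s\<close> sums that are wanted\<close>
      define \<alpha> where "\<alpha> m = phase (T (unit_vec m) (\<sigma> m)) * of_real (h m)" for m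
      define y where "y = (\<lambda>n. \<Sum>m\<in>{m\<in>good. \<sigma> m = n}. \<alpha> m * T (unit_vec m) n)"
      have y_le: "nrm y \<le> ennreal (C * (2 * W powr (1 / P)))"
        unfolding y_def
      proof (rule diagonal_bound)
        fix \<beta> :: "nat \<Rightarrow> 'k" assume \<beta>: "\<And>m. m \<in> good \<Longrightarrow> norm (\<beta> m) \<le> norm (\<alpha> m)"
        define x where "x = (\<Sum>m\<in>good. seq_scale (\<beta> m) (unit_vec m))"
        have "norm (x k) \<le> norm (of_real (h k) :: 'k)" for k
        proof -
          have "x k = (\<Sum>m\<in>good. if m = k then \<beta> k else 0)"
            unfolding x_def sum_fun_apply by (intro sum.cong) (auto simp: seq_scale_def unit_vec_def)
          then have "x k = (if k \<in> good then \<beta> k else 0)" using fin by simp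
          moreover have "norm (\<beta> k) \<le> norm (of_real (h k) :: 'k)" if "k \<in> good"
            using \<beta>[OF that] by (simp only: \<alpha>_def norm_mult norm_phase mult_1_left)
          ultimately show ?thesis by simp
        qed
        then have "nrm x \<le> nrm (\<lambda>n. of_real (h n))" by (rule nrm_mono)
        then have "nrm x \<le> ennreal (2 * W powr (1 / P))" using h_le by (rule order_trans)
        moreover have "x \<in> tail_null M"
          unfolding x_def using fin A unit_M by (intro tail_null_sum tail_null_scale) auto
        ultimately have "nrm (T x) \<le> ennreal (C * (2 * W powr (1 / P)))"
          by (intro bounded_op_bound[OF T]) auto
        moreover have "T x = (\<Sum>m\<in>good. seq_scale (\<beta> m) (T (unit_vec m)))"
          unfolding x_def using fin A unit_M by (intro bounded_op_sum[OF T]) auto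
        ultimately show "nrm (\<Sum>m\<in>good. seq_scale (\<beta> m) (T (unit_vec m))) \<le> ennreal (C * (2 * W powr (1 / P)))"
          by (simp only:)
      qed (use fin C_nonneg in auto)
      have y_eq: "norm (y n) = (\<Sum>m\<in>{m\<in>good. \<sigma> m = n}. h m * norm (T (unit_vec m) (\<sigma> m)))" for n
      proof -
        have "y n = (\<Sum>m\<in>{m\<in>good. \<sigma> m = n}. of_real (h m * norm (T (unit_vec m) (\<sigma> m))))"
          unfolding y_def
        proof (rule sum.cong)
          fix m assume "m \<in> {m\<in>good. \<sigma> m = n}"
          then have "\<alpha> m * T (unit_vec m) n
              = of_real (h m) * (phase (T (unit_vec m) (\<sigma> m)) * T (unit_vec m) (\<sigma> m))"
            by (simp add: \<alpha>_def mult_ac)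
          then show "\<alpha> m * T (unit_vec m) n = of_real (h m * norm (T (unit_vec m) (\<sigma> m)))"
            by (simp add: phase_mult)
        qed simp
        also have "\<dots> = of_real (\<Sum>m\<in>{m\<in>good. \<sigma> m = n}. h m * norm (T (unit_vec m) (\<sigma> m)))"
          by simp
        finally show ?thesis using h0 by (simp only: norm_of_real) (simp add: sum_nonneg)
      qed
      have y_ge: "\<delta> powr s * (\<Sum>m\<in>{m\<in>good. \<sigma> m = n}. v m) \<le> norm (y n) powr s" for n
      proof -
        let ?H = "{m\<in>good. \<sigma> m = n}"
        have "(\<Sum>m\<in>?H. v m) = (\<Sum>m\<in>?H. h m powr s)"
          using s_ge_1 v0 by (simp add: h_def powr_powr)
        also have "\<dots> = ((\<Sum>m\<in>?H. h m powr s) powr (1 / s)) powr s"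
          using s_ge_1 by (simp add: powr_powr sum_nonneg)
        also have "\<dots> \<le> (\<Sum>m\<in>?H. h m) powr s"
          using s_ge_1 fin h0 by (intro powr_mono2 lp_le_l1) auto
        finally have "\<delta> powr s * (\<Sum>m\<in>?H. v m) \<le> \<delta> powr s * (\<Sum>m\<in>?H. h m) powr s"
          by (rule mult_left_mono) simp
        also have "\<dots> = (\<Sum>m\<in>?H. h m * \<delta>) powr s"
          using \<delta> h0 unfolding sum_distrib_right[symmetric]
          by (subst powr_mult) (auto simp: sum_nonneg mult.commute)
        also have "\<dots> \<le> norm (y n) powr s"
          unfolding y_eq using \<delta> h0 \<sigma>(3) s_ge_1
          by (intro powr_mono2 sum_mono mult_left_mono sum_nonneg) auto
        finally show ?thesis .
      qed
      have "\<sigma> ` good \<in> schreier"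
        using \<sigma>(2) ab fin A card_image_le[OF fin(1), of \<sigma>] card_mono[OF A(1) fin(2)]
        by (intro schreierI[of _ b]) auto
      then have "(\<Sum>n\<in>\<sigma> ` good. norm (y n) powr s) powr (1 / s) \<le> C * (2 * W powr (1 / P))"
        using y_le C_nonneg by (intro schreier_lower) auto
      moreover have "\<delta> powr s * W \<le> (\<Sum>n\<in>\<sigma> ` good. norm (y n) powr s)"
      proof -
        have "W = (\<Sum>n\<in>\<sigma> ` good. \<Sum>m\<in>{m\<in>good. \<sigma> m = n}. v m)"
          unfolding vW[symmetric] using fin(1) by (rule sum.image_gen)
        then show ?thesis using y_ge by (simp add: sum_distrib_left sum_mono)
      qed
      then have "(\<delta> powr s * W) powr (1 / s) \<le> (\<Sum>n\<in>\<sigma> ` good. norm (y n) powr s) powr (1 / s)"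
        using s_ge_1 True by (intro powr_mono2) auto
      moreover have "(\<delta> powr s * W) powr (1 / s) = \<delta> * W powr (1 / s)"
        using s_ge_1 \<delta> True by (simp add: powr_mult powr_powr)
      ultimately have "\<delta> * W powr (1 / s) \<le> 2 * C * W powr (1 / P)" by simp
      then have "W powr (1 / s) \<le> 2 * C / \<delta> * W powr (1 / P)" using \<delta> by (simp add: field_simps)
      then show ?thesis using B[OF True] by simp
    qed simp
    ultimately show ?thesis using w(5) by linarith
  qed
  then show ?thesis by blast
qed

text \<open>
  \<open>cover_bounded\<close> needs \<open>min J\<close> to be large. For the finitely many small values the set \<open>J\<close> has at most \<open>N(min J)\<close>
  elements, so its size already bounds the covering number.
\<close>

lemma GL_index_finite:
  assumes "infinite M" "infinite N"
  shows "GL_index M N \<noteq> \<infinity>"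
proof -
  obtain K a where bound: "\<And>A b. finite A \<Longrightarrow> A \<noteq> {} \<Longrightarrow> A \<subseteq> M \<Longrightarrow> a \<le> Min A \<Longrightarrow> a \<le> b \<Longrightarrow> 1 \<le> b \<Longrightarrow>
      card A \<le> b \<Longrightarrow> card {n\<in>N. n < b} \<le> Min A \<Longrightarrow> real (schreier_cover A) \<le> K"
    using cover_bounded by blast
  show ?thesis
  proof (rule GL_index_finiteI[of _ _ "max (nat \<lceil>K\<rceil>) (1 + nth_elem N (Suc a))"])
    fix J assume J: "J \<subseteq> {1..}" "finite J" "J \<noteq> {}" "nth_elem N ` J \<in> schreier"
    define A where "A = nth_elem M ` J"
    define j where "j = Min J"
    define b where "b = nth_elem N j"
    have j: "j \<in> J" "1 \<le> j" using J by (auto simp: j_def)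
    have A: "finite A" "A \<noteq> {}" "A \<subseteq> M" using J nth_elem_mem[OF assms(1)] by (auto simp: A_def)
    have minA: "j \<le> Min A"
    proof -
      have "Min A \<in> A" using A by simp
      then obtain i where i: "i \<in> J" "Min A = nth_elem M i" by (auto simp: A_def)
      then have "j \<le> i" using J by (simp add: j_def)
      moreover have "i \<le> nth_elem M i" using i J by (intro le_nth_elem[OF assms(1) M]) auto
      ultimately show ?thesis using i by simp
    qed
    have "card (nth_elem N ` J) \<le> b"
      using J j by (intro schreier_card_le) (auto simp: b_def)
    moreover have "card (nth_elem N ` J) = card J"
      by (intro card_image inj_on_subset[OF inj_on_nth_elem[OF assms(2)] J(1)])
    moreover have "card A \<le> card J" unfolding A_def by (rule card_image_le[OF J(2)])
    ultimately have cA: "card A \<le> b" by simp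
    show "schreier_cover (nth_elem M ` J) \<le> max (nat \<lceil>K\<rceil>) (1 + nth_elem N (Suc a))"
    proof (cases "a \<le> j")
      case True
      have "j \<le> b" unfolding b_def by (rule le_nth_elem[OF assms(2) N j(2)])
      moreover have "card {n\<in>N. n < b} \<le> Min A"
        unfolding b_def card_below_nth_elem[OF assms(2) j(2)] using minA by simp
      ultimately have "real (schreier_cover A) \<le> K"
        using True minA j cA A by (intro bound[of A b]) auto
      then show ?thesis unfolding A_def by linarith
    next
      case False
      obtain w :: "nat \<Rightarrow> real" where w: "\<And>n. w n \<le> 1 / Min A" "real (schreier_cover A) - 1 \<le> sum w A"
        using greedy_weight[of A] A M by blast
      have "sum w A \<le> card A * (1 / Min A)" using w(1) by (intro sum_bounded_above)
      also have "\<dots> \<le> real (card A) * 1" using minA j by (intro mult_left_mono) auto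
      finally have "schreier_cover A \<le> 1 + card A" using w(2) by linarith
      also have "\<dots> \<le> 1 + nth_elem N (Suc a)"
        using cA False j nth_elem_less[OF assms(2), of j "Suc a"] by (simp add: b_def)
      finally show ?thesis unfolding A_def by simp
    qed
  qed
qed

end

section \<open>From equivalent bases to isomorphic subspaces\<close>

text \<open>
  The map sending \<open>e\<close> at the \<open>j\<close>-th element of \<open>M\<close> to \<open>e\<close> at the \<open>j\<close>-th element of \<open>N\<close>.
\<close>

definition relabel :: "nat set \<Rightarrow> nat set \<Rightarrow> (nat \<Rightarrow> 'k::zero) \<Rightarrow> nat \<Rightarrow> 'k" where
  "relabel M N x n = (if n \<in> N then x (nth_elem M (inv_into {1..} (nth_elem N) n)) else 0)"

lemma relabel_nth_elem: "infinite N \<Longrightarrow> 1 \<le> j \<Longrightarrow> relabel M N x (nth_elem N j) = x (nth_elem M j)"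
  using inv_into_f_f[OF inj_on_nth_elem, of N j] by (simp add: relabel_def nth_elem_mem)

lemma relabel_outside: "n \<notin> N \<Longrightarrow> relabel M N x n = 0"
  by (simp add: relabel_def)

lemma relabel_inverse:
  assumes "infinite M" "infinite N" "\<And>n. n \<notin> M \<Longrightarrow> x n = 0"
  shows "relabel N M (relabel M N x) = x"
proof
  fix n
  show "relabel N M (relabel M N x) n = x n"
  proof (cases "n \<in> M")
    case True
    then obtain j where "1 \<le> j" "nth_elem M j = n" using nth_elem_surj[OF assms(1)] by blast
    then show ?thesis using relabel_nth_elem assms(1,2) by metis
  qed (simp add: relabel_outside assms(3))
qed

context schreier_type
begin

lemma head_nth_elem:
  fixes x :: "nat \<Rightarrow> 'k"
  assumes "infinite M" "1 \<le> m" "\<And>n. n \<notin> M \<Longrightarrow> x n = 0"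
  shows "head (Suc (nth_elem M m)) x = (\<Sum>j=1..m. seq_scale (x (nth_elem M j)) (unit_vec (nth_elem M j)))"
proof -
  have "{n\<in>M. n < Suc (nth_elem M m)} = nth_elem M ` {1..m}"
  proof (intro equalityI subsetI)
    fix n assume n: "n \<in> {n\<in>M. n < Suc (nth_elem M m)}"
    then obtain j where j: "1 \<le> j" "nth_elem M j = n" using nth_elem_surj[OF assms(1)] by blast
    then have "j \<le> m" using n nth_elem_le_iff[OF assms(1) j(1) assms(2)] by simp
    then show "n \<in> nth_elem M ` {1..m}" using j by auto
  next
    fix n assume "n \<in> nth_elem M ` {1..m}"
    then show "n \<in> {n\<in>M. n < Suc (nth_elem M m)}"
      using nth_elem_mem nth_elem_le_iff assms by (auto simp: less_Suc_eq_le)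
  qed
  moreover have "inj_on (nth_elem M) {1..m}"
    using inj_on_nth_elem[OF assms(1)] by (rule inj_on_subset) auto
  moreover have "head (Suc (nth_elem M m)) x = (\<Sum>n\<in>{n\<in>M. n < Suc (nth_elem M m)}. seq_scale (x n) (unit_vec n))"
    by (rule head_eq_sum) (rule assms(3))
  ultimately show ?thesis by (simp add: sum.reindex)
qed

text \<open>
  Domination speaks about finite combinations only. It extends to all sequences since the norm of a sequence is
  determined by its heads.
\<close>

lemma relabel_bound:
  assumes M: "infinite M" and N: "infinite N" "N \<subseteq> {1..}" and "0 \<le> C"
    and dom: "\<And>m \<alpha>. 1 \<le> m \<Longrightarrow> nrm (\<Sum>n=1..m. seq_scale (\<alpha> n) (unit_vec (nth_elem N n)))
                \<le> ennreal C * nrm (\<Sum>n=1..m. seq_scale (\<alpha> n) (unit_vec (nth_elem M n)))"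
    and x: "\<And>n. n \<notin> M \<Longrightarrow> x n = 0" "nrm x \<le> ennreal B" "0 \<le> B"
  shows "nrm (relabel M N x) \<le> ennreal (C * B)"
proof (rule nrm_le_of_heads)
  fix b
  define m where "m = Suc b"
  have m: "1 \<le> m" "b \<le> nth_elem N m" using le_nth_elem[OF N, of m] by (auto simp: m_def)
  have "nrm (head b (relabel M N x)) \<le> nrm (head (Suc (nth_elem N m)) (relabel M N x))"
    using m by (intro nrm_mono) (simp add: head_def)
  also have "head (Suc (nth_elem N m)) (relabel M N x)
      = (\<Sum>j=1..m. seq_scale (x (nth_elem M j)) (unit_vec (nth_elem N j)))"
  proof -
    have "head (Suc (nth_elem N m)) (relabel M N x)
        = (\<Sum>j=1..m. seq_scale (relabel M N x (nth_elem N j)) (unit_vec (nth_elem N j)))"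
      by (rule head_nth_elem[OF N(1) m(1)]) (rule relabel_outside)
    also have "\<dots> = (\<Sum>j=1..m. seq_scale (x (nth_elem M j)) (unit_vec (nth_elem N j)))"
      by (rule sum.cong[OF refl]) (simp only: relabel_nth_elem[OF N(1)] atLeastAtMost_iff)
    finally show ?thesis .
  qed
  also have "nrm \<dots> \<le> ennreal C * nrm (\<Sum>j=1..m. seq_scale (x (nth_elem M j)) (unit_vec (nth_elem M j)))"
    by (rule dom[OF m(1)])
  also have "(\<Sum>j=1..m. seq_scale (x (nth_elem M j)) (unit_vec (nth_elem M j))) = head (Suc (nth_elem M m)) x"
    by (rule head_nth_elem[OF M m(1), symmetric]) (rule x(1))
  also have "ennreal C * nrm (head (Suc (nth_elem M m)) x) \<le> ennreal C * ennreal B"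
    by (intro mult_left_mono order_trans[OF nrm_head_le x(2)]) simp
  finally show "nrm (head b (relabel M N x)) \<le> ennreal (C * B)"
    using assms by (simp add: ennreal_mult)
qed (use assms in simp)

lemma bounded_op_relabel:
  assumes M: "infinite M" "M \<subseteq> {1..}" and N: "infinite N" "N \<subseteq> {1..}"
    and dom: "dominates nrm (\<lambda>j. unit_vec (nth_elem M j)) (\<lambda>j. unit_vec (nth_elem N j))"
  shows "\<exists>C. bounded_op M N C (relabel M N)"
proof -
  obtain C where C: "C > 0" and le: "\<And>m \<alpha>. 1 \<le> m \<Longrightarrow>
      nrm (\<Sum>n=1..m. seq_scale (\<alpha> n) (unit_vec (nth_elem N n)))
         \<le> ennreal C * nrm (\<Sum>n=1..m. seq_scale (\<alpha> n) (unit_vec (nth_elem M n)))"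
    using dom unfolding dominates_def by blast
  have bound: "nrm (relabel M N x) \<le> ennreal (C * B)"
    if "\<And>n. n \<notin> M \<Longrightarrow> x n = 0" "nrm x \<le> ennreal B" "0 \<le> B" for x B
    using relabel_bound[OF M(1) N _ le that] C by simp
  have "relabel M N x \<in> tail_null N \<and> nrm (relabel M N x) \<le> ennreal C * nrm x"
    if x: "x \<in> tail_null M" for x
  proof -
    define B where "B = enn2real (nrm x)"
    have B: "nrm x = ennreal B" "0 \<le> B" using x by (auto simp: B_def tail_null_def)
    have le: "nrm (relabel M N x) \<le> ennreal (C * B)"
      using B by (intro bound tail_nullD[OF x]) auto
    have "\<exists>b. nrm (tail b (relabel M N x)) \<le> ennreal e" if e: "e > 0" for e
    proof -
      obtain b where b: "nrm (tail b x) \<le> ennreal (e / C)"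
        using x e C unfolding tail_null_def mem_Collect_eq by (meson divide_pos_pos)
      define m where "m = Suc b"
      have m: "1 \<le> m" "b \<le> nth_elem M m" using le_nth_elem[OF M, of m] by (auto simp: m_def)
      have "nrm (tail (nth_elem M m) x) \<le> ennreal (e / C)"
        using nrm_tail_antimono[OF m(2)] b order_trans by blast
      then have "nrm (relabel M N (tail (nth_elem M m) x)) \<le> ennreal (C * (e / C))"
        using tail_nullD[OF x] e C by (intro bound) (auto simp: tail_def)
      moreover have "relabel M N (tail (nth_elem M m) x) = tail (nth_elem N m) (relabel M N x)"
      proof
        fix n
        show "relabel M N (tail (nth_elem M m) x) n = tail (nth_elem N m) (relabel M N x) n"
        proof (cases "n \<in> N")
          case True
          then obtain j where j: "1 \<le> j" "n = nth_elem N j" using nth_elem_surj[OF N(1)] by metis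
          then show ?thesis
            using nth_elem_less_iff[OF M(1) j(1) m(1)] nth_elem_less_iff[OF N(1) j(1) m(1)]
            by (simp add: tail_def relabel_nth_elem[OF N(1)])
        qed (simp add: relabel_outside tail_def)
      qed
      ultimately show ?thesis using C by auto
    qed
    then have "relabel M N x \<in> tail_null N"
      using le relabel_outside by (auto simp: tail_null_def intro: le_less_trans)
    then show ?thesis using le B C by (simp add: ennreal_mult)
  qed
  moreover have "relabel M N (x + y) = relabel M N x + relabel M N y"
    "relabel M N (seq_scale c x) = seq_scale c (relabel M N x)" for c and x y :: "nat \<Rightarrow> 'k"
    by (auto simp: relabel_def seq_scale_def)
  ultimately have "bounded_op M N C (relabel M N)"
    using C by (simp add: bounded_op_def)
  then show ?thesis by blast
qed

lemma equivalent_imp_isomorphic: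
  assumes M: "infinite M" "M \<subseteq> {1..}" and N: "infinite N" "N \<subseteq> {1..}"
    and eq: "equivalent_seqs nrm (\<lambda>j. unit_vec (nth_elem M j)) (\<lambda>j. unit_vec (nth_elem N j))"
  shows "isomorphic_subspaces nrm (unit_subspace nrm M) (unit_subspace nrm N)"
proof -
  obtain C D where "bounded_op M N C (relabel M N)" "bounded_op N M D (relabel N M)"
    using eq bounded_op_relabel[OF M N] bounded_op_relabel[OF N M] unfolding equivalent_seqs_def by blast
  then have "bounded_op M N (max C D) (relabel M N)" "bounded_op N M (max C D) (relabel N M)"
    by (auto intro: bounded_op_mono)
  moreover have "relabel N M (relabel M N x) = x" if "x \<in> tail_null M" for x
    by (rule relabel_inverse[OF M(1) N(1)]) (rule tail_nullD[OF that])
  moreover have "relabel M N (relabel N M y) = y" if "y \<in> tail_null N" for y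
    by (rule relabel_inverse[OF N(1) M(1)]) (rule tail_nullD[OF that])
  ultimately show ?thesis
    unfolding isomorphic_iff[OF M(2) N(2)] by blast
qed

lemma isomorphic_imp_GL_finite:
  assumes M: "infinite M" "M \<subseteq> {1..}" and N: "infinite N" "N \<subseteq> {1..}"
    and iso: "isomorphic_subspaces nrm (unit_subspace nrm M) (unit_subspace nrm N)"
  shows "GL_index M N \<noteq> \<infinity> \<and> GL_index N M \<noteq> \<infinity>"
proof -
  obtain T S C where op: "bounded_op M N C T" "bounded_op N M C S"
    and inv: "\<And>x. x \<in> tail_null M \<Longrightarrow> S (T x) = x" "\<And>y. y \<in> tail_null N \<Longrightarrow> T (S y) = y"
    using iso unfolding isomorphic_iff[OF M(2) N(2)] by blast
  interpret MN: isomorphism nrm I q s P M N C T S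
    using op inv M N by unfold_locales auto
  interpret NM: isomorphism nrm I q s P N M C S T
    using op inv M N by unfold_locales auto
  show ?thesis using MN.GL_index_finite[OF M(1) N(1)] NM.GL_index_finite[OF N(1) M(1)] ..
qed

end

section \<open>The Schreier and Baernstein norms\<close>

lemma schreier_norm_le_iff:
  assumes "0 \<le> B"
  shows "schreier_norm p x \<le> ennreal B \<longleftrightarrow> (\<forall>F\<in>schreier. (\<Sum>n\<in>F. norm (x n) powr p) powr (1 / p) \<le> B)"
  using assms by (auto simp: schreier_norm_def SUP_le_iff)

text \<open>
  The supremum norm over Schreier sets even satisfies the split estimate with a maximum in place of the \<open>\<ell>\<^sub>P\<close> sum, and
  the weighted vectors stay bounded. So any \<open>P > p\<close> would serve; \<open>p + 1\<close> is one choice.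
\<close>

lemma schreier_type_schreier:
  assumes "1 \<le> p"
  shows "schreier_type (schreier_norm p :: (nat \<Rightarrow> 'k::{real_normed_field,banach}) \<Rightarrow> ennreal) (schreier - {{}})
           (\<lambda>F x. (\<Sum>n\<in>F. norm (x n) powr p) powr (1 / p)) p (p + 1)"
proof (rule schreier_type.intro[OF sup_norm_schreier[OF assms]], unfold_locales)
  fix x y :: "nat \<Rightarrow> 'k" assume "\<And>n. norm (x n) \<le> norm (y n)"
  then show "schreier_norm p x \<le> schreier_norm p y"
    unfolding schreier_norm_def using assms
    by (intro SUP_mono' ennreal_leI powr_mono2 sum_mono sum_nonneg) auto
next
  fix k
  have "(\<Sum>n\<in>F. norm (unit_vec k n :: 'k) powr p) \<le> 1" if "F \<in> schreier" for F
  proof -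
    have "(\<Sum>n\<in>F. norm (unit_vec k n :: 'k) powr p) = (\<Sum>n\<in>F. if n = k then 1 else 0)"
      by (intro sum.cong) (auto simp: unit_vec_def)
    then show ?thesis using schreier_finite[OF that] by simp
  qed
  then have "(\<Sum>n\<in>F. norm (unit_vec k n :: 'k) powr p) powr (1 / p) \<le> 1" if "F \<in> schreier" for F
    using powr_mono2[of "1 / p" "\<Sum>n\<in>F. norm (unit_vec k n :: 'k) powr p" 1] that assms by (simp add: sum_nonneg)
  then show "schreier_norm p (unit_vec k :: nat \<Rightarrow> 'k) \<le> 1"
    using schreier_norm_le_iff[of 1 p "unit_vec k :: nat \<Rightarrow> 'k"] by simp
next
  fix F and x :: "nat \<Rightarrow> 'k" and B :: real
  assume "F \<in> schreier" "schreier_norm p x \<le> ennreal B" "0 \<le> B"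
  then show "(\<Sum>n\<in>F. norm (x n) powr p) powr (1 / p) \<le> B" by (simp add: schreier_norm_le_iff)
next
  fix A and w :: "nat \<Rightarrow> real"
  assume w: "finite A" "\<And>n. 0 \<le> w n" "\<And>n. n \<notin> A \<Longrightarrow> w n = 0" "\<And>F. F \<in> schreier \<Longrightarrow> sum w F \<le> 2" "1 \<le> sum w A"
  have "(\<Sum>n\<in>F. norm (of_real (w n powr (1 / p)) :: 'k) powr p) powr (1 / p) \<le> 2 * sum w A powr (1 / (p + 1))"
    if F: "F \<in> schreier" for F
  proof -
    have "(\<Sum>n\<in>F. norm (of_real (w n powr (1 / p)) :: 'k) powr p) = sum w F"
      using assms w(2) by (simp add: powr_powr)
    also have "\<dots> powr (1 / p) \<le> 2 powr (1 / p)"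
      using assms w(2) w(4)[OF F] by (intro powr_mono2) (auto intro: sum_nonneg)
    also have "\<dots> \<le> 2 powr 1" using assms by (intro powr_mono) auto
    also have "\<dots> \<le> 2 * sum w A powr (1 / (p + 1))"
      using assms w(5) ge_one_powr_ge_zero[of "sum w A" "1 / (p + 1)"] by simp
    finally show ?thesis .
  qed
  then show "schreier_norm p (\<lambda>n. of_real (w n powr (1 / p)) :: 'k) \<le> ennreal (2 * sum w A powr (1 / (p + 1)))"
    by (subst schreier_norm_le_iff) auto
next
  fix z y :: "nat \<Rightarrow> 'k" and C D \<delta> :: real and d :: nat
  assume z: "schreier_norm p z \<le> ennreal C" "0 \<le> C" and y: "schreier_norm p y \<le> ennreal D" "0 \<le> D"
    and supp: "\<And>n. d < n \<Longrightarrow> z n = 0" "\<And>n. n \<le> d \<Longrightarrow> y n = 0" and small: "\<And>n. norm (y n) \<le> \<delta>"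
  let ?R = "(C powr (p + 1) + D powr (p + 1)) powr (1 / (p + 1))"
  have \<delta>: "0 \<le> \<delta>" using small[of 0] norm_ge_zero order_trans by blast
  have R: "C \<le> ?R" "D \<le> ?R"
  proof -
    have "C = (C powr (p + 1)) powr (1 / (p + 1))" "D = (D powr (p + 1)) powr (1 / (p + 1))"
      using assms z y by (auto simp: powr_powr)
    then show "C \<le> ?R" "D \<le> ?R"
      using assms powr_mono2[of "1 / (p + 1)" "C powr (p + 1)" "C powr (p + 1) + D powr (p + 1)"]
        powr_mono2[of "1 / (p + 1)" "D powr (p + 1)" "C powr (p + 1) + D powr (p + 1)"] by auto
  qed
  have "(\<Sum>n\<in>F. norm ((z + y) n) powr p) powr (1 / p) \<le> ?R + d * \<delta>" if F: "F \<in> schreier" for F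
  proof (cases "\<exists>n\<in>F. n \<le> d")
    case False
    then have "(\<Sum>n\<in>F. norm ((z + y) n) powr p) = (\<Sum>n\<in>F. norm (y n) powr p)"
      using supp(1) by (intro sum.cong) auto
    then have "(\<Sum>n\<in>F. norm ((z + y) n) powr p) powr (1 / p) \<le> D"
      using y F by (simp add: schreier_norm_le_iff)
    then show ?thesis using R \<delta> by (simp add: add_increasing2)
  next
    case True
    then have card: "card F \<le> d" using schreier_card_le[OF F] order_trans by blast
    have fin: "finite F" using F by (rule schreier_finite)
    have "(\<Sum>n\<in>F. norm ((z + y) n) powr p) powr (1 / p) \<le> (\<Sum>n\<in>F. (norm (z n) + norm (y n)) powr p) powr (1 / p)"
      using assms by (intro powr_mono2 sum_mono sum_nonneg) (auto intro: norm_triangle_ineq)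
    also have "\<dots> \<le> (\<Sum>n\<in>F. norm (z n) powr p) powr (1 / p) + (\<Sum>n\<in>F. norm (y n) powr p) powr (1 / p)"
      using fin assms by (intro minkowski_sum) auto
    also have "(\<Sum>n\<in>F. norm (z n) powr p) powr (1 / p) \<le> C" using z F by (simp add: schreier_norm_le_iff)
    also have "(\<Sum>n\<in>F. norm (y n) powr p) powr (1 / p) \<le> (\<Sum>n\<in>F. norm (y n))"
      using fin assms by (intro lp_le_l1) auto
    also have "\<dots> \<le> card F * \<delta>" using small by (intro sum_bounded_above)
    also have "\<dots> \<le> d * \<delta>" using card \<delta> by (simp add: mult_right_mono)
    finally show ?thesis using R by simp
  qed
  then show "schreier_norm p (z + y) \<le> ennreal (?R + d * \<delta>)"
    using R z \<delta> by (subst schreier_norm_le_iff) auto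
qed (use assms in auto)

lemma chain_elements_less:
  assumes "schreier_chain m F" "1 \<le> i" "i < j" "j \<le> m" "a \<in> F i" "b \<in> F j"
  shows "a < b"
proof -
  have "finite (F i)" "finite (F j)" using chain_finite[OF assms(1)] assms by auto
  then have "a \<le> Max (F i)" "Min (F j) \<le> b" using assms by auto
  then show ?thesis using chain_less[OF assms(1-4)] by linarith
qed

text \<open>
  Cutting a chain of Schreier sets into pieces produces empty sets, which a chain must not contain. The
  function \<open>g\<close> is the summand of the norm, which vanishes on them.
\<close>

lemma drop_empty_sets:
  fixes H :: "nat \<Rightarrow> nat set"
  assumes "\<And>j. j \<in> {1..m} \<Longrightarrow> H j \<in> schreier"
    and "\<And>i j a b. 1 \<le> i \<Longrightarrow> i < j \<Longrightarrow> j \<le> m \<Longrightarrow> a \<in> H i \<Longrightarrow> b \<in> H j \<Longrightarrow> a < b"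
    and "g {} = (0 :: real)"
  shows "\<exists>k F. schreier_chain k F \<and> (\<Union>j\<in>{1..k}. F j) \<subseteq> (\<Union>j\<in>{1..m}. H j) \<and>
           (\<Sum>j=1..k. g (F j)) = (\<Sum>j=1..m. g (H j))"
  using assms(1,2)
proof (induction m)
  case 0
  then show ?case by (intro exI[of _ 0]) (auto simp: schreier_chain_def)
next
  case (Suc m)
  obtain k F where F: "schreier_chain k F" "(\<Union>j\<in>{1..k}. F j) \<subseteq> (\<Union>j\<in>{1..m}. H j)"
    "(\<Sum>j=1..k. g (F j)) = (\<Sum>j=1..m. g (H j))"
  proof -
    have "\<exists>k F. schreier_chain k F \<and> (\<Union>j\<in>{1..k}. F j) \<subseteq> (\<Union>j\<in>{1..m}. H j) \<and>
           (\<Sum>j=1..k. g (F j)) = (\<Sum>j=1..m. g (H j))"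
      by (rule Suc.IH) (use Suc.prems in auto)
    then show ?thesis using that by blast
  qed
  show ?case
  proof (cases "H (Suc m) = {}")
    case True
    then show ?thesis using F assms(3) by (intro exI[of _ k] exI[of _ F]) (auto simp: atLeastAtMostSuc_conv)
  next
    case False
    define G where "G = F(Suc k := H (Suc m))"
    have "schreier_chain (Suc k) G"
      unfolding schreier_chain_def
    proof (intro conjI ballI)
      fix j assume "j \<in> {1..Suc k}"
      then show "G j \<in> schreier - {{}}"
        using F(1) Suc.prems(1) False by (auto simp: G_def schreier_chain_def)
    next
      fix j assume j: "j \<in> {1..<Suc k}"
      show "Max (G j) < Min (G (Suc j))"
      proof (cases "j = k")
        case True
        have Fk: "finite (F k)" "F k \<noteq> {}" using F(1) j True by (auto simp: schreier_chain_def schreier_def)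
        then have "Max (F k) \<in> (\<Union>j\<in>{1..m}. H j)" using F(2) j True Max_in by fastforce
        then obtain i where "i \<in> {1..m}" "Max (F k) \<in> H i" by blast
        moreover have "Min (H (Suc m)) \<in> H (Suc m)"
          using False Suc.prems(1) by (intro Min_in) (auto intro: schreier_finite)
        ultimately have "Max (F k) < Min (H (Suc m))" using Suc.prems(2)[of i "Suc m"] by auto
        then show ?thesis using True by (simp add: G_def)
      next
        case False
        then show ?thesis using F(1) j by (auto simp: G_def schreier_chain_def)
      qed
    qed
    moreover have "(\<Union>j\<in>{1..Suc k}. G j) \<subseteq> (\<Union>j\<in>{1..Suc m}. H j)"
    proof -
      have "(\<Union>j\<in>{1..Suc k}. G j) = (\<Union>j\<in>{1..k}. F j) \<union> H (Suc m)"
        by (auto simp: G_def atLeastAtMostSuc_conv)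
      then show ?thesis using F(2) by (auto simp: atLeastAtMostSuc_conv)
    qed
    moreover have "(\<Sum>j=1..Suc k. g (G j)) = (\<Sum>j=1..Suc m. g (H j))"
      using F(3) by (simp add: G_def)
    ultimately show ?thesis by blast
  qed
qed

lemma baernstein_norm_le_iff:
  assumes "0 \<le> B" "1 < p"
  shows "baernstein_norm p x \<le> ennreal B \<longleftrightarrow>
    (\<forall>m F. 1 \<le> m \<longrightarrow> schreier_chain m F \<longrightarrow> (\<Sum>j=1..m. (\<Sum>n\<in>F j. norm (x n)) powr p) powr (1 / p) \<le> B)"
  using assms by (auto simp: baernstein_norm_def SUP_le_iff)

lemma baernstein_sum_le:
  fixes H :: "nat \<Rightarrow> nat set"
  assumes "1 < p" "0 \<le> B" "baernstein_norm p x \<le> ennreal B"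
    and "\<And>j. j \<in> {1..m} \<Longrightarrow> H j \<in> schreier"
    and "\<And>i j a b. 1 \<le> i \<Longrightarrow> i < j \<Longrightarrow> j \<le> m \<Longrightarrow> a \<in> H i \<Longrightarrow> b \<in> H j \<Longrightarrow> a < b"
  shows "(\<Sum>j=1..m. (\<Sum>n\<in>H j. norm (x n)) powr p) powr (1 / p) \<le> B"
proof -
  obtain k F where F: "schreier_chain k F"
    "(\<Sum>j=1..k. (\<Sum>n\<in>F j. norm (x n)) powr p) = (\<Sum>j=1..m. (\<Sum>n\<in>H j. norm (x n)) powr p)"
  proof -
    have "\<exists>k F. schreier_chain k F \<and> (\<Union>j\<in>{1..k}. F j) \<subseteq> (\<Union>j\<in>{1..m}. H j) \<and>
        (\<Sum>j=1..k. (\<Sum>n\<in>F j. norm (x n)) powr p) = (\<Sum>j=1..m. (\<Sum>n\<in>H j. norm (x n)) powr p)"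
      by (rule drop_empty_sets[OF assms(4,5)]) (use assms(1) in auto)
    then show ?thesis using that by blast
  qed
  show ?thesis
  proof (cases "k = 0")
    case True
    then show ?thesis using F(2) assms by simp
  next
    case False
    then have "1 \<le> k" by simp
    then show ?thesis using baernstein_norm_le_iff[OF assms(2,1)] assms(3) F by metis
  qed
qed

text \<open>
  In the weight estimate each Schreier set has mass at most 2, so the \<open>p\<close>-th powers of the masses are at most \<open>2\<^sup>p\<close>
  times the masses, which add up to at most the total. In the split estimate the sets of a chain that lie beyond
  \<open>d\<close> contribute to the norm of \<open>y\<close> and the others to the norm of \<open>z\<close>. At most one set of the chain meets
  both sides of \<open>d\<close>; it has at most \<open>d\<close> elements and so collects at most \<open>d \<delta>\<close> from \<open>y\<close>.
\<close>

lemma schreier_type_baernstein: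
  assumes "1 < p"
  shows "schreier_type (baernstein_norm p :: (nat \<Rightarrow> 'k::{real_normed_field,banach}) \<Rightarrow> ennreal)
           {(m, F). 1 \<le> m \<and> schreier_chain m F}
           (\<lambda>(m, F) x. (\<Sum>j=1..m. (\<Sum>n\<in>F j. norm (x n)) powr p) powr (1 / p)) 1 p"
proof (rule schreier_type.intro[OF sup_norm_baernstein[OF assms]], unfold_locales)
  fix x y :: "nat \<Rightarrow> 'k" assume "\<And>n. norm (x n) \<le> norm (y n)"
  then show "baernstein_norm p x \<le> baernstein_norm p y"
    unfolding baernstein_norm_def case_prod_beta using assms
    by (intro SUP_mono' ennreal_leI powr_mono2 sum_mono sum_nonneg) (auto intro: sum_nonneg)
next
  fix k
  have "(\<Sum>j=1..m. (\<Sum>n\<in>F j. norm (unit_vec k n :: 'k)) powr p) powr (1 / p) \<le> 1"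
    if F: "schreier_chain m F" for m F
  proof -
    have eq: "(\<Sum>n\<in>F j. norm (unit_vec k n :: 'k)) = (if k \<in> F j then 1 else 0)" if "j \<in> {1..m}" for j
    proof -
      have "(\<Sum>n\<in>F j. norm (unit_vec k n :: 'k)) = (\<Sum>n\<in>F j. if n = k then 1 else 0)"
        by (intro sum.cong) (auto simp: unit_vec_def)
      then show ?thesis using chain_finite[OF F that] by simp
    qed
    have "(\<Sum>j=1..m. (\<Sum>n\<in>F j. norm (unit_vec k n :: 'k)) powr p) powr (1 / p)
        \<le> (\<Sum>j=1..m. (\<Sum>n\<in>F j. norm (unit_vec k n :: 'k)))"
      using assms by (intro lp_le_l1) (auto intro: sum_nonneg)
    also have "\<dots> = (\<Sum>j=1..m. if k \<in> F j then 1 else 0)" using eq by (intro sum.cong) auto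
    also have "\<dots> = card {j\<in>{1..m}. k \<in> F j}" by (simp add: sum.If_cases Int_def)
    also have "\<dots> \<le> 1"
    proof -
      have "i = j" if "i \<in> {1..m}" "j \<in> {1..m}" "k \<in> F i" "k \<in> F j" for i j
        using chain_disjoint[OF F that(1,2)] that by blast
      then have "card {j\<in>{1..m}. k \<in> F j} \<le> Suc 0" by (subst card_le_Suc0_iff_eq) auto
      then show ?thesis by simp
    qed
    finally show ?thesis .
  qed
  then show "baernstein_norm p (unit_vec k :: nat \<Rightarrow> 'k) \<le> 1"
    using baernstein_norm_le_iff[of 1 p "unit_vec k :: nat \<Rightarrow> 'k"] assms by simp
next
  fix F and x :: "nat \<Rightarrow> 'k" and B :: real
  assume "F \<in> schreier" "baernstein_norm p x \<le> ennreal B" "0 \<le> B"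
  then have "(\<Sum>j=1..1::nat. (\<Sum>n\<in>F. norm (x n)) powr p) powr (1 / p) \<le> B"
    using assms by (intro baernstein_sum_le) auto
  then show "(\<Sum>n\<in>F. norm (x n) powr 1) powr (1 / 1) \<le> B"
    using assms by (simp add: powr_powr sum_nonneg)
next
  fix A and w :: "nat \<Rightarrow> real"
  assume w: "finite A" "\<And>n. 0 \<le> w n" "\<And>n. n \<notin> A \<Longrightarrow> w n = 0" "\<And>F. F \<in> schreier \<Longrightarrow> sum w F \<le> 2" "1 \<le> sum w A"
  have "(\<Sum>j=1..m. (\<Sum>n\<in>F j. norm (of_real (w n powr (1 / 1)) :: 'k)) powr p) powr (1 / p) \<le> 2 * sum w A powr (1 / p)"
    if F: "schreier_chain m F" for m F
  proof -
    have "(\<Sum>j=1..m. (\<Sum>n\<in>F j. norm (of_real (w n powr (1 / 1)) :: 'k)) powr p) = (\<Sum>j=1..m. sum w (F j) powr p)"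
      using w(2) by simp
    also have "\<dots> \<le> (\<Sum>j=1..m. 2 powr p * sum w (F j))"
    proof (rule sum_mono)
      fix j assume "j \<in> {1..m}"
      then have "F j \<in> schreier" using F by (auto simp: schreier_chain_def)
      then have le2: "sum w (F j) \<le> 2" using w(4) by blast
      have nonneg: "0 \<le> sum w (F j)" using w(2) by (simp add: sum_nonneg)
      have "sum w (F j) powr p = sum w (F j) powr (p - 1) * sum w (F j)"
        using nonneg powr_add[of "sum w (F j)" "p - 1" 1] by simp
      also have "\<dots> \<le> 2 powr (p - 1) * sum w (F j)"
        using le2 nonneg assms by (intro mult_right_mono powr_mono2) auto
      also have "\<dots> \<le> 2 powr p * sum w (F j)" using nonneg by (intro mult_right_mono powr_mono) auto
      finally show "sum w (F j) powr p \<le> 2 powr p * sum w (F j)" .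
    qed
    also have "\<dots> = 2 powr p * (\<Sum>j=1..m. sum w (F j))" by (simp add: sum_distrib_left)
    also have "(\<Sum>j=1..m. sum w (F j)) = sum w (\<Union>j\<in>{1..m}. F j)"
      using chain_finite[OF F] chain_disjoint[OF F] by (intro sum.UNION_disjoint[symmetric]) auto
    also have "\<dots> = sum w ((\<Union>j\<in>{1..m}. F j) \<inter> A)"
      using chain_finite[OF F] w(3) by (intro sum.mono_neutral_right) auto
    also have "\<dots> \<le> sum w A" using w(1,2) by (intro sum_mono2) auto
    finally have "(\<Sum>j=1..m. (\<Sum>n\<in>F j. norm (of_real (w n powr (1 / 1)) :: 'k)) powr p) \<le> 2 powr p * sum w A"
      by simp
    then have "(\<Sum>j=1..m. (\<Sum>n\<in>F j. norm (of_real (w n powr (1 / 1)) :: 'k)) powr p) powr (1 / p)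
        \<le> (2 powr p * sum w A) powr (1 / p)"
      using assms by (intro powr_mono2) (auto intro: sum_nonneg)
    also have "\<dots> = 2 * sum w A powr (1 / p)" using assms w(5) by (simp add: powr_mult powr_powr)
    finally show ?thesis .
  qed
  then show "baernstein_norm p (\<lambda>n. of_real (w n powr (1 / 1)) :: 'k) \<le> ennreal (2 * sum w A powr (1 / p))"
    using assms by (subst baernstein_norm_le_iff) auto
next
  fix z y :: "nat \<Rightarrow> 'k" and C D \<delta> :: real and d :: nat
  assume z: "baernstein_norm p z \<le> ennreal C" "0 \<le> C" and y: "baernstein_norm p y \<le> ennreal D" "0 \<le> D"
    and supp: "\<And>n. d < n \<Longrightarrow> z n = 0" "\<And>n. n \<le> d \<Longrightarrow> y n = 0" and small: "\<And>n. norm (y n) \<le> \<delta>"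
  have \<delta>: "0 \<le> \<delta>" using small[of 0] norm_ge_zero order_trans by blast
  have "(\<Sum>j=1..m. (\<Sum>n\<in>F j. norm ((z + y) n)) powr p) powr (1 / p) \<le> (C powr p + D powr p) powr (1 / p) + d * \<delta>"
    if F: "schreier_chain m F" for m F
  proof -
    \<comment> \<open>\<open>Y2\<close> is what sets meeting \<open>{..d}\<close> collect from \<open>y\<close>; \<open>Z\<close> and \<open>Y1\<close> never live on the same set of the chain\<close>
    define low where "low j \<longleftrightarrow> (\<exists>n\<in>F j. n \<le> d)" for j
    define high where "high j \<longleftrightarrow> (\<exists>n\<in>F j. d < n)" for j
    define Z where "Z j = (\<Sum>n\<in>F j. norm (z n))" for j
    define Y where "Y j = (\<Sum>n\<in>F j. norm (y n))" for j
    define Y1 where "Y1 j = (if low j then 0 else Y j)" for j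
    define Y2 where "Y2 j = (if low j then Y j else 0)" for j
    have nonneg: "0 \<le> Z j" "0 \<le> Y j" "0 \<le> Y1 j" "0 \<le> Y2 j" for j
      by (auto simp: Z_def Y_def Y1_def Y2_def sum_nonneg)
    have Fj: "F j \<in> schreier" if "j \<in> {1..m}" for j using F that by (auto simp: schreier_chain_def)
    have Z_part: "(\<Sum>j=1..m. Z j powr p) \<le> C powr p"
    proof -
      have "(\<Sum>j=1..m. Z j powr p) powr (1 / p) \<le> C"
        unfolding Z_def using z Fj chain_elements_less[OF F] by (intro baernstein_sum_le[OF assms]) auto
      then have "((\<Sum>j=1..m. Z j powr p) powr (1 / p)) powr p \<le> C powr p"
        using assms by (intro powr_mono2) auto
      then show ?thesis using assms by (simp add: powr_powr sum_nonneg)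
    qed
    have Y_part: "(\<Sum>j=1..m. Y1 j powr p) \<le> D powr p"
    proof -
      have "(\<Sum>j=1..m. Y j powr p) powr (1 / p) \<le> D"
        unfolding Y_def using y Fj chain_elements_less[OF F] by (intro baernstein_sum_le[OF assms]) auto
      then have "((\<Sum>j=1..m. Y j powr p) powr (1 / p)) powr p \<le> D powr p"
        using assms by (intro powr_mono2) auto
      then have "(\<Sum>j=1..m. Y j powr p) \<le> D powr p" using assms by (simp add: powr_powr sum_nonneg)
      moreover have "(\<Sum>j=1..m. Y1 j powr p) \<le> (\<Sum>j=1..m. Y j powr p)"
        by (intro sum_mono) (simp add: Y1_def)
      ultimately show ?thesis by linarith
    qed
    have cross: "(\<Sum>j=1..m. Y2 j) \<le> d * \<delta>"
    proof -
      have zero: "Y2 j = 0" if "\<not> (low j \<and> high j)" for j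
        using that supp(2) by (auto simp: Y2_def Y_def high_def not_less intro!: sum.neutral)
      have uniq: "i = j" if ij: "i \<in> {1..m}" "j \<in> {1..m}" "low i \<and> high i" "low j \<and> high j" for i j
      proof -
        have "\<not> i < j" if "1 \<le> i" "j \<le> m" "high i" "low j" for i j
          using chain_elements_less[OF F that(1) _ that(2)] that(3,4)
          unfolding low_def high_def by (meson leD less_le_trans less_trans)
        then show ?thesis using ij by (metis atLeastAtMost_iff linorder_neqE_nat)
      qed
      have bound: "Y2 j \<le> d * \<delta>" if j: "j \<in> {1..m}" for j
      proof (cases "low j")
        case True
        then obtain n where "n \<in> F j" "n \<le> d" by (auto simp: low_def)
        then have "card (F j) \<le> d" using schreier_card_le[OF Fj[OF j]] order_trans by blast
        then have "card (F j) * \<delta> \<le> d * \<delta>" using \<delta> by (simp add: mult_right_mono)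
        moreover have "Y j \<le> card (F j) * \<delta>" unfolding Y_def using small by (intro sum_bounded_above)
        ultimately show ?thesis using True by (simp add: Y2_def)
      qed (use \<delta> in \<open>simp add: Y2_def\<close>)
      show ?thesis
      proof (cases "\<exists>k\<in>{1..m}. low k \<and> high k")
        case True
        then obtain k where k: "k \<in> {1..m}" "low k \<and> high k" by blast
        then have "(\<Sum>j=1..m. Y2 j) = (\<Sum>j\<in>{k}. Y2 j)"
        proof (intro sum.mono_neutral_right)
          show "\<forall>i\<in>{1..m} - {k}. Y2 i = 0" using zero uniq k by blast
        qed (use k in auto)
        then show ?thesis using bound[OF k(1)] by simp
      next
        case False
        then have "(\<Sum>j=1..m. Y2 j) = 0" using zero by (intro sum.neutral) auto
        then show ?thesis using \<delta> by simp
      qed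
    qed
    have "(\<Sum>j=1..m. (\<Sum>n\<in>F j. norm ((z + y) n)) powr p) powr (1 / p)
        \<le> (\<Sum>j=1..m. ((Z j + Y1 j) + Y2 j) powr p) powr (1 / p)"
    proof (intro powr_mono2 sum_mono)
      fix j
      have "(\<Sum>n\<in>F j. norm ((z + y) n)) \<le> (\<Sum>n\<in>F j. norm (z n) + norm (y n))"
        by (intro sum_mono) (simp add: norm_triangle_ineq)
      then show "(\<Sum>n\<in>F j. norm ((z + y) n)) \<le> Z j + Y1 j + Y2 j"
        by (simp add: Z_def Y1_def Y2_def Y_def sum.distrib)
    qed (use assms in \<open>auto intro: sum_nonneg\<close>)
    also have "\<dots> \<le> (\<Sum>j=1..m. (Z j + Y1 j) powr p) powr (1 / p) + (\<Sum>j=1..m. Y2 j powr p) powr (1 / p)"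
      using assms nonneg by (intro minkowski_sum) (auto intro: add_nonneg_nonneg)
    also have "(\<Sum>j=1..m. (Z j + Y1 j) powr p) = (\<Sum>j=1..m. Z j powr p) + (\<Sum>j=1..m. Y1 j powr p)"
    proof -
      have "Z j = 0 \<or> Y1 j = 0" for j
        using supp(1) by (auto simp: Z_def Y1_def low_def not_le intro!: sum.neutral)
      then have "(Z j + Y1 j) powr p = Z j powr p + Y1 j powr p" for j
        by (metis add.left_neutral add.right_neutral powr_zero_eq_one powr_0 assms less_irrefl not_one_less_zero)
      then show ?thesis by (simp add: sum.distrib)
    qed
    also have "\<dots> powr (1 / p) \<le> (C powr p + D powr p) powr (1 / p)"
      using assms Z_part Y_part by (intro powr_mono2 add_mono add_nonneg_nonneg sum_nonneg) auto
    also have "(\<Sum>j=1..m. Y2 j powr p) powr (1 / p) \<le> (\<Sum>j=1..m. Y2 j)"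
      using assms nonneg by (intro lp_le_l1) auto
    also note cross
    finally show ?thesis by simp
  qed
  then show "baernstein_norm p (z + y) \<le> ennreal ((C powr p + D powr p) powr (1 / p) + d * \<delta>)"
    using assms \<delta> by (subst baernstein_norm_le_iff) auto
qed (use assms in auto)

section \<open>From finite Gasparis--Leung indices to equivalent bases\<close>

text \<open>
  A finite index in the form used for norm estimates: a Schreier set of positions in \<open>N\<close> becomes, in \<open>M\<close>, a union
  of a fixed number of (possibly empty) Schreier sets.
\<close>

lemma schreier_pieces:
  assumes "GL_index M N \<noteq> \<infinity>" "infinite M" "M \<subseteq> {1..}"
  shows "\<exists>K :: nat. \<forall>J. J \<subseteq> {1..} \<longrightarrow> finite J \<longrightarrow> nth_elem N ` J \<in> schreier \<longrightarrow>
    (\<exists>G. J = (\<Union>l<K. G l) \<and> (\<forall>l<K. nth_elem M ` G l \<in> schreier))"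
proof -
  obtain K where K: "GL_index M N = enat K" using assms(1) by auto
  show ?thesis
  proof (intro exI[of _ K] allI impI)
    fix J assume J: "J \<subseteq> {1..}" "finite J" "nth_elem N ` J \<in> schreier"
    let ?A = "nth_elem M ` J"
    have "enat (schreier_cover ?A) \<le> GL_index M N"
      unfolding GL_index_def using J by (intro SUP_upper) auto
    then have k: "schreier_cover ?A \<le> K" using K by simp
    show "\<exists>G. J = (\<Union>l<K. G l) \<and> (\<forall>l<K. nth_elem M ` G l \<in> schreier)"
    proof (cases "J = {}")
      case True
      then show ?thesis by (intro exI[of _ "\<lambda>_. {}"]) (auto simp: schreier_def)
    next
      case False
      have "?A \<subseteq> {1..}" using nth_elem_mem[OF assms(2)] assms(3) by blast
      then obtain F where F: "schreier_chain (schreier_cover ?A) F" "?A \<subseteq> (\<Union>j\<in>{1..schreier_cover ?A}. F j)"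
        using schreier_cover_exists[of ?A] J False by auto
      define G where "G l = {j\<in>J. l < schreier_cover ?A \<and> nth_elem M j \<in> F (Suc l)}" for l
      have "J = (\<Union>l<K. G l)"
      proof (intro equalityI subsetI)
        fix j assume j: "j \<in> J"
        then obtain i where i: "i \<in> {1..schreier_cover ?A}" "nth_elem M j \<in> F i" using F(2) by blast
        then show "j \<in> (\<Union>l<K. G l)" using j k by (intro UN_I[of "i - 1"]) (auto simp: G_def)
      qed (auto simp: G_def)
      moreover have "nth_elem M ` G l \<in> schreier" for l
      proof (cases "l < schreier_cover ?A")
        case True
        then have "F (Suc l) \<in> schreier" using F(1) by (auto simp: schreier_chain_def)
        then show ?thesis by (rule schreier_subset) (auto simp: G_def)
      qed (simp add: G_def schreier_def)
      ultimately show ?thesis by blast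
    qed
  qed
qed

lemma combination_nth_elem:
  assumes "infinite M" "1 \<le> j"
  shows "(\<Sum>i=1..m. seq_scale (\<alpha> i) (unit_vec (nth_elem M i))) (nth_elem M j) = (if j \<le> m then \<alpha> j else 0)"
proof -
  have "(\<Sum>i=1..m. seq_scale (\<alpha> i) (unit_vec (nth_elem M i))) (nth_elem M j) = (\<Sum>i=1..m. if i = j then \<alpha> j else 0)"
    unfolding sum_fun_apply
  proof (rule sum.cong)
    fix i assume "i \<in> {1..m}"
    then have "nth_elem M j = nth_elem M i \<longleftrightarrow> i = j"
      using inj_on_nth_elem[OF assms(1)] assms(2) by (auto simp: inj_on_def)
    then show "seq_scale (\<alpha> i) (unit_vec (nth_elem M i)) (nth_elem M j) = (if i = j then \<alpha> j else 0)"
      by (simp add: seq_scale_def unit_vec_def)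
  qed simp
  then show ?thesis using assms(2) by simp
qed

lemma combination_outside:
  assumes "n \<notin> nth_elem M ` {1..m}"
  shows "(\<Sum>i=1..m. seq_scale (\<alpha> i) (unit_vec (nth_elem M i))) n = 0"
  unfolding sum_fun_apply using assms by (intro sum.neutral) (auto simp: seq_scale_def unit_vec_def)

lemma sum_combination:
  fixes f :: "'k::real_normed_field \<Rightarrow> real"
  assumes "infinite M" "J \<subseteq> {1..m}" "f 0 = 0" "finite F" "nth_elem M ` {1..m} \<inter> F = nth_elem M ` J"
  shows "(\<Sum>n\<in>F. f ((\<Sum>i=1..m. seq_scale (\<alpha> i) (unit_vec (nth_elem M i))) n)) = (\<Sum>j\<in>J. f (\<alpha> j))"
proof -
  have "(\<Sum>n\<in>F. f ((\<Sum>i=1..m. seq_scale (\<alpha> i) (unit_vec (nth_elem M i))) n))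
      = (\<Sum>n\<in>nth_elem M ` J. f ((\<Sum>i=1..m. seq_scale (\<alpha> i) (unit_vec (nth_elem M i))) n))"
  proof (rule sum.mono_neutral_right)
    show "\<forall>n\<in>F - nth_elem M ` J. f ((\<Sum>i=1..m. seq_scale (\<alpha> i) (unit_vec (nth_elem M i))) n) = 0"
    proof
      fix n assume "n \<in> F - nth_elem M ` J"
      then have "n \<notin> nth_elem M ` {1..m}" using assms(5) by blast
      then show "f ((\<Sum>i=1..m. seq_scale (\<alpha> i) (unit_vec (nth_elem M i))) n) = 0"
        using combination_outside[of n M m \<alpha>] assms(3) by simp
    qed
  qed (use assms(4,5) in auto)
  also have "\<dots> = (\<Sum>j\<in>J. f ((\<Sum>i=1..m. seq_scale (\<alpha> i) (unit_vec (nth_elem M i))) (nth_elem M j)))"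
  proof -
    have "inj_on (nth_elem M) J"
      by (rule inj_on_subset[OF inj_on_nth_elem[OF assms(1)]]) (use assms(2) in auto)
    then show ?thesis by (simp add: sum.reindex)
  qed
  also have "\<dots> = (\<Sum>j\<in>J. f (\<alpha> j))"
    using assms(2) by (intro sum.cong refl arg_cong[where f = f]) (subst combination_nth_elem[OF assms(1)], auto)
  finally show ?thesis .
qed

lemma sum_UN_le:
  fixes f :: "'a \<Rightarrow> real" and K :: nat
  assumes "\<And>l. l < K \<Longrightarrow> finite (G l)" "\<And>i. 0 \<le> f i"
  shows "sum f (\<Union>l<K. G l) \<le> (\<Sum>l<K. sum f (G l))"
  using assms(1)
proof (induction K)
  case (Suc K)
  have "sum f (\<Union>l<Suc K. G l) = sum f ((\<Union>l<K. G l) \<union> G K)" by (simp add: lessThan_Suc Un_commute)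
  also have "\<dots> \<le> sum f (\<Union>l<K. G l) + sum f (G K)"
    using Suc.prems assms(2) by (subst sum.union_inter[symmetric]) (auto simp: sum_nonneg)
  finally show ?case using Suc by force
qed simp

lemma minkowski_many:
  fixes a :: "nat \<Rightarrow> 'i \<Rightarrow> real"
  assumes "1 \<le> p" "finite I" "\<And>l i. 0 \<le> a l i"
  shows "(\<Sum>i\<in>I. (\<Sum>l<K. a l i) powr p) powr (1 / p) \<le> (\<Sum>l<K. (\<Sum>i\<in>I. a l i powr p) powr (1 / p))"
proof (induction K)
  case (Suc K)
  have "(\<Sum>i\<in>I. ((\<Sum>l<K. a l i) + a K i) powr p) powr (1 / p)
     \<le> (\<Sum>i\<in>I. (\<Sum>l<K. a l i) powr p) powr (1 / p) + (\<Sum>i\<in>I. a K i powr p) powr (1 / p)"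
    using assms by (intro minkowski_sum) (auto intro: sum_nonneg)
  then show ?case using Suc by simp
qed simp

lemma dominatesI:
  assumes "0 \<le> K" "\<And>m \<alpha> B. 0 \<le> B \<Longrightarrow> nrm (\<Sum>n=1..m. seq_scale (\<alpha> n) (x n)) \<le> ennreal B \<Longrightarrow>
             nrm (\<Sum>n=1..m. seq_scale (\<alpha> n) (y n)) \<le> ennreal (K * B)"
  shows "dominates nrm x y"
  unfolding dominates_def
proof (intro exI[of _ "K + 1"] conjI allI impI)
  fix m \<alpha>
  let ?X = "nrm (\<Sum>n=1..m. seq_scale (\<alpha> n) (x n))"
  show "nrm (\<Sum>n=1..m. seq_scale (\<alpha> n) (y n)) \<le> ennreal (K + 1) * ?X"
  proof (cases ?X)
    case (real B)
    then have "nrm (\<Sum>n=1..m. seq_scale (\<alpha> n) (y n)) \<le> ennreal (K * B)" by (intro assms(2)) auto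
    also have "\<dots> \<le> ennreal ((K + 1) * B)" using real by (intro ennreal_leI mult_right_mono) auto
    finally show ?thesis using real assms(1) by (simp add: ennreal_mult)
  next
    case top
    then show ?thesis using assms(1) by (simp add: ennreal_mult_top)
  qed
qed (use assms in simp)

text \<open>
  The sum over one Schreier set in \<open>N\<close> splits into at most \<open>K\<close> sums over Schreier sets in \<open>M\<close>.
\<close>

lemma GL_finite_imp_dominates_schreier:
  assumes p: "1 \<le> p" and M: "infinite M" "M \<subseteq> {1..}" and N: "infinite N"
    and GL: "GL_index M N \<noteq> \<infinity>"
  shows "dominates (schreier_norm p :: (nat \<Rightarrow> 'k::{real_normed_field,banach}) \<Rightarrow> ennreal)
           (\<lambda>j. unit_vec (nth_elem M j)) (\<lambda>j. unit_vec (nth_elem N j))"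
proof -
  obtain K :: nat where K: "\<forall>J. J \<subseteq> {1..} \<longrightarrow> finite J \<longrightarrow> nth_elem N ` J \<in> schreier \<longrightarrow>
    (\<exists>G. J = (\<Union>l<K. G l) \<and> (\<forall>l<K. nth_elem M ` G l \<in> schreier))"
    using schreier_pieces[OF GL M] ..
  show ?thesis
  proof (rule dominatesI[of "real K"])
    fix m and \<alpha> :: "nat \<Rightarrow> 'k" and B :: real
    let ?x = "\<Sum>n=1..m. seq_scale (\<alpha> n) (unit_vec (nth_elem M n))"
    let ?y = "\<Sum>n=1..m. seq_scale (\<alpha> n) (unit_vec (nth_elem N n))"
    assume B: "0 \<le> B" "schreier_norm p ?x \<le> ennreal B"
    have "(\<Sum>n\<in>F. norm (?y n) powr p) powr (1 / p) \<le> K * B" if F: "F \<in> schreier" for F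
    proof -
      define J where "J = {j\<in>{1..m}. nth_elem N j \<in> F}"
      have J: "J \<subseteq> {1..m}" "finite J" by (auto simp: J_def)
      have "nth_elem N ` J \<in> schreier" using F by (rule schreier_subset) (auto simp: J_def)
      then obtain G where G: "J = (\<Union>l<K. G l)" "\<And>l. l < K \<Longrightarrow> nth_elem M ` G l \<in> schreier"
        using K[rule_format, of J] J(2) order_trans[OF J(1), of "{1..}"] by auto
      have GJ: "G l \<subseteq> J" "finite (G l)" if "l < K" for l
      proof -
        show "G l \<subseteq> J" using G(1) that by blast
        then show "finite (G l)" using J(2) by (rule finite_subset)
      qed
      have "(\<Sum>n\<in>F. norm (?y n) powr p) = (\<Sum>j\<in>J. norm (\<alpha> j) powr p)"
        using J schreier_finite[OF F] p by (intro sum_combination[OF N]) (auto simp: J_def)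
      also have "\<dots> \<le> (\<Sum>l<K. \<Sum>j\<in>G l. norm (\<alpha> j) powr p)"
        unfolding G(1) using GJ by (intro sum_UN_le) auto
      also have "\<dots> = (\<Sum>l<K. (\<Sum>n\<in>nth_elem M ` G l. norm (?x n) powr p))"
      proof (rule sum.cong)
        fix l assume "l \<in> {..<K}"
        then have "G l \<subseteq> {1..m}" "finite (G l)" using GJ J by blast+
        then show "(\<Sum>j\<in>G l. norm (\<alpha> j) powr p) = (\<Sum>n\<in>nth_elem M ` G l. norm (?x n) powr p)"
          using p by (intro sum_combination[OF M(1), symmetric]) auto
      qed simp
      also have "\<dots> = (\<Sum>l<K. ((\<Sum>n\<in>nth_elem M ` G l. norm (?x n) powr p) powr (1 / p)) powr p)"
        using p by (simp add: powr_powr sum_nonneg)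
      finally have "(\<Sum>n\<in>F. norm (?y n) powr p) powr (1 / p)
          \<le> (\<Sum>l<K. ((\<Sum>n\<in>nth_elem M ` G l. norm (?x n) powr p) powr (1 / p)) powr p) powr (1 / p)"
        using p by (intro powr_mono2) (auto intro: sum_nonneg)
      also have "\<dots> \<le> (\<Sum>l<K. (\<Sum>n\<in>nth_elem M ` G l. norm (?x n) powr p) powr (1 / p))"
        using p by (intro lp_le_l1) auto
      also have "\<dots> \<le> (\<Sum>l<K. B)"
        using B G(2) by (intro sum_mono) (auto simp: schreier_norm_le_iff)
      finally show ?thesis by simp
    qed
    then show "schreier_norm p ?y \<le> ennreal (K * B)"
      using B by (subst schreier_norm_le_iff) auto
  qed simp
qed

text \<open>
  Every set of a chain in \<open>N\<close> splits into \<open>K\<close> pieces in \<open>M\<close>. For fixed \<open>l\<close> the \<open>l\<close>-th pieces of the successive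
  sets are again successive Schreier sets, so the chain splits into \<open>K\<close> chains, which Minkowski's inequality recombines.
\<close>

lemma GL_finite_imp_dominates_baernstein:
  assumes p: "1 < p" and M: "infinite M" "M \<subseteq> {1..}" and N: "infinite N"
    and GL: "GL_index M N \<noteq> \<infinity>"
  shows "dominates (baernstein_norm p :: (nat \<Rightarrow> 'k::{real_normed_field,banach}) \<Rightarrow> ennreal)
           (\<lambda>j. unit_vec (nth_elem M j)) (\<lambda>j. unit_vec (nth_elem N j))"
proof -
  obtain K :: nat where K: "\<forall>J. J \<subseteq> {1..} \<longrightarrow> finite J \<longrightarrow> nth_elem N ` J \<in> schreier \<longrightarrow>
    (\<exists>G. J = (\<Union>l<K. G l) \<and> (\<forall>l<K. nth_elem M ` G l \<in> schreier))"
    using schreier_pieces[OF GL M] ..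
  show ?thesis
  proof (rule dominatesI[of "real K"])
    fix m and \<alpha> :: "nat \<Rightarrow> 'k" and B :: real
    let ?x = "\<Sum>n=1..m. seq_scale (\<alpha> n) (unit_vec (nth_elem M n))"
    let ?y = "\<Sum>n=1..m. seq_scale (\<alpha> n) (unit_vec (nth_elem N n))"
    assume B: "0 \<le> B" "baernstein_norm p ?x \<le> ennreal B"
    have "(\<Sum>t=1..r. (\<Sum>n\<in>F t. norm (?y n)) powr p) powr (1 / p) \<le> K * B"
      if F: "schreier_chain r F" for r F
    proof -
      define J where "J t = {j\<in>{1..m}. nth_elem N j \<in> F t}" for t
      have J: "J t \<subseteq> {1..m}" "finite (J t)" for t by (auto simp: J_def)
      have Ft: "F t \<in> schreier" if "t \<in> {1..r}" for t using F that by (auto simp: schreier_chain_def)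
      have "\<exists>G. J t = (\<Union>l<K. G l) \<and> (\<forall>l<K. nth_elem M ` G l \<in> schreier)" if t: "t \<in> {1..r}" for t
      proof -
        have "nth_elem N ` J t \<in> schreier" using Ft[OF t] by (rule schreier_subset) (auto simp: J_def)
        then show ?thesis using K[rule_format, of "J t"] J(2) order_trans[OF J(1), of "{1..}"] by auto
      qed
      then obtain G where G: "\<And>t. t \<in> {1..r} \<Longrightarrow> J t = (\<Union>l<K. G t l)"
        "\<And>t l. t \<in> {1..r} \<Longrightarrow> l < K \<Longrightarrow> nth_elem M ` G t l \<in> schreier" by metis
      have GJ: "G t l \<subseteq> J t" "finite (G t l)" if "t \<in> {1..r}" "l < K" for t l
      proof -
        show "G t l \<subseteq> J t" using G(1)[OF that(1)] that(2) by blast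
        then show "finite (G t l)" using J(2) by (rule finite_subset)
      qed
      define a where "a l t = (\<Sum>n\<in>nth_elem M ` G t l. norm (?x n))" for l t
      have "(\<Sum>n\<in>F t. norm (?y n)) \<le> (\<Sum>l<K. a l t)" if t: "t \<in> {1..r}" for t
      proof -
        have "(\<Sum>n\<in>F t. norm (?y n)) = (\<Sum>j\<in>J t. norm (\<alpha> j))"
          using J schreier_finite[OF Ft[OF t]] by (intro sum_combination[OF N]) (auto simp: J_def)
        also have "\<dots> \<le> (\<Sum>l<K. \<Sum>j\<in>G t l. norm (\<alpha> j))"
          unfolding G(1)[OF t] using GJ[OF t] by (intro sum_UN_le) auto
        also have "\<dots> = (\<Sum>l<K. a l t)"
        proof (rule sum.cong)
          fix l assume "l \<in> {..<K}"
          then have "G t l \<subseteq> {1..m}" "finite (G t l)" using GJ[OF t, of l] J[of t] by blast+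
          then show "(\<Sum>j\<in>G t l. norm (\<alpha> j)) = a l t"
            unfolding a_def by (intro sum_combination[OF M(1), symmetric]) auto
        qed simp
        finally show ?thesis .
      qed
      then have "(\<Sum>t=1..r. (\<Sum>n\<in>F t. norm (?y n)) powr p) powr (1 / p)
          \<le> (\<Sum>t=1..r. (\<Sum>l<K. a l t) powr p) powr (1 / p)"
        using p by (intro powr_mono2 sum_mono) (auto intro: sum_nonneg)
      also have "\<dots> \<le> (\<Sum>l<K. (\<Sum>t=1..r. a l t powr p) powr (1 / p))"
        using p by (intro minkowski_many) (auto simp: a_def intro: sum_nonneg)
      also have "\<dots> \<le> (\<Sum>l<K. B)"
      proof (rule sum_mono)
        fix l assume l: "l \<in> {..<K}"
        have less: "u < v" if t: "1 \<le> t" "t < t'" "t' \<le> r" and uv: "u \<in> nth_elem M ` G t l" "v \<in> nth_elem M ` G t' l" for t t' u v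
        proof -
          obtain i j where ij: "i \<in> G t l" "j \<in> G t' l" "u = nth_elem M i" "v = nth_elem M j"
            using uv by blast
          then have "i \<in> J t" "j \<in> J t'" using GJ(1)[of t l] GJ(1)[of t' l] t l by auto
          then have "1 \<le> i" "1 \<le> j" "nth_elem N i < nth_elem N j"
            using chain_elements_less[OF F t] by (auto simp: J_def)
          then show ?thesis using ij nth_elem_less_iff M(1) N by metis
        qed
        show "(\<Sum>t=1..r. a l t powr p) powr (1 / p) \<le> B"
          unfolding a_def using B G(2) l less by (intro baernstein_sum_le[OF p]) auto
      qed
      finally show ?thesis by simp
    qed
    then show "baernstein_norm p ?y \<le> ennreal (K * B)"
      using B p by (subst baernstein_norm_le_iff) auto
  qed simp
qed

section \<open>The equivalence\<close>

theorem theorem4p8: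
  fixes nrm :: "(nat \<Rightarrow> 'k::{real_normed_field,banach}) \<Rightarrow> ennreal"
    and p :: real and M N :: "nat set"
  assumes "1 < p \<and> nrm = baernstein_norm p \<or> 1 \<le> p \<and> nrm = schreier_norm p"
    and "M \<subseteq> {1..}" "infinite M" "N \<subseteq> {1..}" "infinite N"
  shows "(GL_index M N \<noteq> \<infinity> \<and> GL_index N M \<noteq> \<infinity> \<longleftrightarrow>
            equivalent_seqs nrm (\<lambda>j. unit_vec (nth_elem M j)) (\<lambda>j. unit_vec (nth_elem N j))) \<and>
         (equivalent_seqs nrm (\<lambda>j. unit_vec (nth_elem M j)) (\<lambda>j. unit_vec (nth_elem N j)) \<longleftrightarrow>
            isomorphic_subspaces nrm (unit_subspace nrm M) (unit_subspace nrm N))"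
  (is "(?a \<longleftrightarrow> ?b) \<and> (?b \<longleftrightarrow> ?c)")
proof -
  note MN = assms(3,2) assms(5,4)
  have ab: "?a \<Longrightarrow> ?b"
    using assms GL_finite_imp_dominates_baernstein[of p, where ?'k = 'k] GL_finite_imp_dominates_schreier[of p, where ?'k = 'k]
    unfolding equivalent_seqs_def by blast
  have "(?b \<longrightarrow> ?c) \<and> (?c \<longrightarrow> ?a)"
    using assms(1)
  proof (elim disjE conjE)
    assume "1 < p" and nrm: "nrm = baernstein_norm p"
    then interpret schreier_type nrm "{(m, F). 1 \<le> m \<and> schreier_chain m F}"
      "\<lambda>(m, F) x. (\<Sum>j=1..m. (\<Sum>n\<in>F j. norm (x n)) powr p) powr (1 / p)" 1 p
      using schreier_type_baernstein by blast
    show ?thesis using equivalent_imp_isomorphic[OF MN] isomorphic_imp_GL_finite[OF MN] by blast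
  next
    assume "1 \<le> p" and nrm: "nrm = schreier_norm p"
    then interpret schreier_type nrm "schreier - {{}}"
      "\<lambda>F x. (\<Sum>n\<in>F. norm (x n) powr p) powr (1 / p)" p "p + 1"
      using schreier_type_schreier by blast
    show ?thesis using equivalent_imp_isomorphic[OF MN] isomorphic_imp_GL_finite[OF MN] by blast
  qed
  with ab show ?thesis by blast
qed

end
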